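(* Let $\alpha\in(0,1)$, $\tau>0$, $m=\alpha/(1-\alpha)$, let $(d_n)_{n\ge 1}$ be a queueing discipline (as defined in the context) and let $H_n$ be the time at which a single bus, alone on the line, leaves station $n$. Let $d\ge 2$ denote an integer. (i) If $d_n=\min(d,n)$ for all $n\ge1$ and $\varrho(d-2)<1$, then there exists $c>\tau$ such that $$H_n\sim_{n\to\infty} c\,n\quad\text{a.s.}$$ Moreover, $(H_n-nc)/\sqrt n$ converges weakly, as $n\to\infty$, to a Gaussian random variable with positive variance. (ii) If either $d_n=\min(d,n)$ for all $n\ge 1$ and $\varrho(d-2)>1$, or $d_n\to\infty$, then there exists a finite positive random variable $W$ such that $$H_n\sim_{n\to\infty} m_n W\quad\text{a.s.},$$ where $(m_n)_{n\ge0}$ is defined by $m_0=1$ and $m_n=m\sum_{i=0}^{d_{n+1}-2}m_{n-1-i}$ for $n\ge1$.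
   Context: $\mathbb N=\{0,1,2,\dots\}$. Discipline: a sequence of positive integers $(d_i)_{i\ge1}$ with $d_1=1$, $d_2=2$ and $d_i\le d_{i+1}\le d_i+1$ for $i\ge2$. Arrivals: to the stations $i\ge1$ are associated independent Poisson point processes $(T^{(i)}_k:k\ge1)$ on $[0,\infty)$ with intensity $\alpha$ (points listed in increasing order); $T_k^{(i)}$ is the arrival time of the $k$-th customer at station $i$. Single bus: it starts from station $0$ (where nobody boards) at time $0$, takes time $\tau$ to travel from one station to the next, and each boarding takes one unit of time. A customer at station $i$ can board only if he arrived after the bus left station $i-d_i$ and before it leaves station $i$. Formally $H_0=0$ and recursively for $i\ge1$: $F_i=\min\{j\ge1: T^{(i)}_j>H_{i-d_i}\}$; $\mathcal I_i=\{k\in\mathbb N:\ \forall j\in\{0,\dots,k\},\ T^{(i)}_{F_i+j}\le H_{i-1}+\tau+j\}$; $M_i=F_i-1+\#\mathcal I_i$; $H_i=H_{i-1}+\tau+(M_i-F_i+1)$. For an integer $a\ge0$, $\varrho(a)$ denotes the largest (positive real) root of the polynomial $P_a=X^{a+1}-m\sum_{k=0}^aX^k$. For (possibly random) sequences, $x_n\sim y_n$ means $x_n/y_n\to1$. *)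

theory Defs
  imports "HOL-Probability.Probability"
begin

section \<open>Arrivals\<close>

definition point_count :: "(nat \<Rightarrow> real) \<Rightarrow> real set \<Rightarrow> nat" where
  "point_count t B = card {k. 1 \<le> k \<and> t k \<in> B}"

text \<open>
  A Poisson point process on \<open>[0, \<infinity>)\<close> with constant intensity \<open>\<alpha>\<close>, given by its points
  \<open>T 1 < T 2 < \<dots>\<close> (\<open>T 0\<close> is not a point of the process;
  it is only required to be measurable, which costs nothing and keeps expressions such
  as \<open>T (LEAST j. \<dots>)\<close> measurable also on the null event where the \<open>LEAST\<close> is void).
  Divergence of the points expresses local finiteness, so that almost surely \<open>card\<close> is never applied to an infinite set when the
  points in a bounded set are counted. The Poisson weights are written out because
  \<open>poisson_pmf\<close> is only specified for a positive rate, whereas null sets have rate \<open>0\<close>.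
\<close>

definition poisson_process :: "'a measure \<Rightarrow> real \<Rightarrow> (nat \<Rightarrow> 'a \<Rightarrow> real) \<Rightarrow> bool" where
  "poisson_process M \<alpha> T \<longleftrightarrow>
     (\<forall>k. T k \<in> borel_measurable M) \<and>
     (AE \<omega> in M. 0 \<le> T 1 \<omega> \<and> (\<forall>k\<ge>1. T k \<omega> < T (Suc k) \<omega>) \<and>
                 filterlim (\<lambda>k. T k \<omega>) at_top sequentially) \<and>
     (\<forall>B \<in> sets borel. B \<subseteq> {0..} \<and> bounded B \<longrightarrow>
        (\<forall>n. measure M {\<omega> \<in> space M. point_count (\<lambda>k. T k \<omega>) B = n} =
               exp (- (\<alpha> * measure lborel B)) * (\<alpha> * measure lborel B) ^ n / fact n)) \<and>
     (\<forall>B :: nat \<Rightarrow> real set.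
        (\<forall>j. B j \<in> sets borel \<and> B j \<subseteq> {0..} \<and> bounded (B j)) \<and> disjoint_family B \<longrightarrow>
        prob_space.indep_vars M (\<lambda>_. count_space UNIV)
          (\<lambda>j \<omega>. point_count (\<lambda>k. T k \<omega>) (B j)) UNIV)"

definition independent_poisson_processes ::
    "'a measure \<Rightarrow> real \<Rightarrow> (nat \<Rightarrow> nat \<Rightarrow> 'a \<Rightarrow> real) \<Rightarrow> bool" where
  "independent_poisson_processes M \<alpha> T \<longleftrightarrow>
     (\<forall>i\<ge>1. poisson_process M \<alpha> (T i)) \<and>
     prob_space.indep_vars M (\<lambda>_. Pi\<^sub>M {1..} (\<lambda>_. borel))
       (\<lambda>i \<omega>. \<lambda>k\<in>{1..}. T i k \<omega>) {1..}"

section \<open>A single bus\<close>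

definition queueing_discipline :: "(nat \<Rightarrow> nat) \<Rightarrow> bool" where
  "queueing_discipline d \<longleftrightarrow>
     (\<forall>i\<ge>1. 0 < d i) \<and> d 1 = 1 \<and> d 2 = 2 \<and> (\<forall>i\<ge>2. d i \<le> d (i + 1) \<and> d (i + 1) \<le> d i + 1)"

text \<open>In the next three definitions \<open>t\<close> lists the arrival times at one station, \<open>s\<close> is the
  time after which a customer has to arrive there in order to be allowed to board, and \<open>a\<close> is
  the time at which the bus reaches that station.\<close>

definition first_boarder :: "(nat \<Rightarrow> real) \<Rightarrow> real \<Rightarrow> nat" where
  "first_boarder t s = (LEAST j. 1 \<le> j \<and> s < t j)"

definition boarding_indices :: "(nat \<Rightarrow> real) \<Rightarrow> real \<Rightarrow> real \<Rightarrow> nat set" where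
  "boarding_indices t s a = {k. \<forall>j\<in>{0..k}. t (first_boarder t s + j) \<le> a + real j}"

definition last_boarder :: "(nat \<Rightarrow> real) \<Rightarrow> real \<Rightarrow> real \<Rightarrow> nat" where
  "last_boarder t s a = first_boarder t s - 1 + card (boarding_indices t s a)"

text \<open>
  \<open>departure \<tau> d t i\<close> is \<open>H\<^sub>i\<close> for the arrival times \<open>t i k\<close>. For \<open>i = Suc n\<close> and
  \<open>d i \<ge> 1\<close>, the index \<open>i - d i\<close> is written as \<open>n - (d i - 1)\<close>, which is below \<open>i\<close>
  whatever \<open>d\<close> is, so that the recursion always terminates.
\<close>

fun departure :: "real \<Rightarrow> (nat \<Rightarrow> nat) \<Rightarrow> (nat \<Rightarrow> nat \<Rightarrow> real) \<Rightarrow> nat \<Rightarrow> real" where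
  "departure \<tau> d t 0 = 0"
| "departure \<tau> d t (Suc n) =
     (let s = departure \<tau> d t (n - (d (Suc n) - 1));
          a = departure \<tau> d t n + \<tau>
      in a + (real (last_boarder (t (Suc n)) s a) - real (first_boarder (t (Suc n)) s) + 1))"

section \<open>Growth rates\<close>

definition char_poly :: "real \<Rightarrow> nat \<Rightarrow> real poly" where
  "char_poly m a = monom 1 (a + 1) - smult m (\<Sum>k=0..a. monom 1 k)"

definition rho :: "real \<Rightarrow> nat \<Rightarrow> real" where
  "rho m a = Max {x. 0 < x \<and> poly (char_poly m a) x = 0}"

fun mean_seq :: "real \<Rightarrow> (nat \<Rightarrow> nat) \<Rightarrow> nat \<Rightarrow> real" where
  "mean_seq m d 0 = 1"
| "mean_seq m d (Suc n) = m * (\<Sum>i=0..d (Suc n + 1) - 2. mean_seq m d (n - i))"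

end

theory Submission
  imports Defs "HOL-Real_Asymp.Real_Asymp"
begin

text \<open>
  If \<open>l\<close> is the time span during which the customers boarding at a station may have arrived, then their
  number is the hitting time of zero by a random walk with Poisson steps, and optional stopping gives
  its cumulant function \<open>l * \<psi> w\<close> with \<open>\<psi> w = \<alpha> * (exp (w + \<psi> w) - 1) = m * w + O(w\<^sup>2)\<close>. It is linear
  in \<open>l\<close>, and \<open>l\<close> is linear in the previous increments of \<open>H\<close>; so the cumulant function of any linear
  combination of the increments of \<open>H\<close> is computed by a deterministic backward recursion.

  In the subcritical case its second order expansion at \<open>w = \<i> * t / sqrt n\<close> gives the central
  limit theorem, and Chernoff bounds give the strong law. In the supercritical case the recursion shows that
  the increments grow exponentially almost surely, and then the Chernoff bound for a single
  station shows that the relative errors in \<open>H (n + 1) - H n \<approx> m * l\<close> are eventually summable. From then on the argument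
  is pathwise: a positive solution of the linear recursion with summable relative errors is asymptotically
  proportional to the unperturbed solution \<open>mean_seq\<close>.
\<close>

section \<open>Boarding counts as hitting times\<close>

text \<open>The window length at a station is random and depends on the whole past, so no limit
  theorem for independent summands applies to \<open>H\<close>. But for fixed window ends the log
  transform of the boarding count is exactly proportional to the window length, so integrating out
  the last station merely moves its weight onto the stations of its window. The resulting recursion
  is nonlinear through \<open>\<psi>\<close>; comparison with lines of slope slightly above or below
  \<open>m\<close> makes it linear.

  With windows of \<open>h = d - 1\<close> increments the linear recursion of slope \<open>m\<close>
  is stable iff \<open>m * h < 1\<close>, and then has gain \<open>1 / (1 - m * h)\<close>. Since
  \<open>P_a(1) = 1 - m * (a + 1)\<close>, this is the condition that the largest root for
  \<open>a = d - 2\<close> is below one.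

  If \<open>d_n\<close> grows, the mean recursion has varying order and no characteristic root to
  normalise by. This is why the supercritical argument compares ratios of positive solutions and
  only asks that each increment of a ratio be reused with total weight below one. For a fixed window
  this weight is at most \<open>1 / \<rho>\<close>; for growing windows it tends to zero.\<close>

definition simple_points :: "(nat \<Rightarrow> real) \<Rightarrow> bool" where
  "simple_points t \<longleftrightarrow> (\<forall>k\<ge>1. t k < t (Suc k)) \<and> filterlim t at_top sequentially"

lemma simple_points_less:
  assumes "simple_points t" "1 \<le> i" "i < j"
  shows "t i < t j"
  using assms(3,2)
proof (induction rule: strict_inc_induct)
  case (base i)
  then show ?case using assms(1) by (auto simp: simple_points_def)
next
  case (step i)
  then have "t i < t (Suc i)" using assms(1) by (auto simp: simple_points_def)
  with step show ?case by auto
qed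

lemma simple_points_le:
  assumes "simple_points t" "1 \<le> i" "i \<le> j"
  shows "t i \<le> t j"
  using simple_points_less[OF assms(1,2), of j] assms(3) by (cases "i = j") auto

lemma simple_points_finite:
  assumes "simple_points t"
  shows "finite {k. 1 \<le> k \<and> t k \<le> x}"
proof -
  have "eventually (\<lambda>k. x < t k) sequentially"
    using assms by (auto simp: simple_points_def filterlim_at_top_dense)
  then obtain K where "\<And>k. k \<ge> K \<Longrightarrow> x < t k"
    by (auto simp: eventually_sequentially)
  then have "k < K" if "t k \<le> x" for k
    using that by (meson leD leI)
  then have "{k. 1 \<le> k \<and> t k \<le> x} \<subseteq> {..<K}"
    by auto
  then show ?thesis by (rule finite_subset) auto
qed

lemma
  assumes "simple_points t"
  shows first_boarder_ge1: "1 \<le> first_boarder t s"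
    and first_boarder_after: "s < t (first_boarder t s)"
    and before_first_boarder: "1 \<le> j \<Longrightarrow> j < first_boarder t s \<Longrightarrow> t j \<le> s"
proof -
  have "eventually (\<lambda>k. s < t k) sequentially"
    using assms by (auto simp: simple_points_def filterlim_at_top_dense)
  then obtain K where "\<And>k. k \<ge> K \<Longrightarrow> s < t k"
    by (auto simp: eventually_sequentially)
  then have "1 \<le> Suc K \<and> s < t (Suc K)" by auto
  from LeastI[where P = "\<lambda>j. 1 \<le> j \<and> s < t j", OF this]
  show  "1 \<le> first_boarder t s" "s < t (first_boarder t s)"
    unfolding first_boarder_def by auto
  show "t j \<le> s" if "1 \<le> j" "j < first_boarder t s"
    using not_less_Least[of j "\<lambda>j. 1 \<le> j \<and> s < t j"] that
    unfolding first_boarder_def by auto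
qed

text \<open>The points after \<open>s\<close> are numbered consecutively from
  \<open>first_boarder t s\<close>, so those in \<open>(s, x]\<close> form an initial block of this
  numbering. This is the passage from arrival times to counts, whose joint law is known.\<close>

lemma less_point_count_iff:
  assumes t: "simple_points t"
  shows "j < point_count t {s<..x} \<longleftrightarrow> t (first_boarder t s + j) \<le> x"
proof -
  let ?F = "first_boarder t s" and ?S = "{k. 1 \<le> k \<and> t k \<in> {s<..x}}"
  have F1: "1 \<le> ?F" by (rule first_boarder_ge1[OF t])
  have S: "?S = {k. ?F \<le> k \<and> t k \<le> x}"
  proof safe
    fix k assume "1 \<le> k" "t k \<in> {s<..x}"
    then show "?F \<le> k" using before_first_boarder[OF t, of k s] by (cases "?F \<le> k") auto
  next
    fix k assume k: "?F \<le> k" "t k \<le> x"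
    show "1 \<le> k" using F1 k by simp
    show "t k \<in> {s<..x}"
      using simple_points_le[OF t F1 k(1)] first_boarder_after[OF t, of s] k(2) by auto
  qed auto
  have fin: "finite ?S"
    by (rule finite_subset[OF _ simple_points_finite[OF t, of x]]) auto
  show ?thesis
  proof
    assume "t (?F + j) \<le> x"
    then have "t k \<le> x" if "?F \<le> k" "k \<le> ?F + j" for k
      using simple_points_le[OF t, of k "?F + j"] F1 that by simp
    then have "{?F..?F + j} \<subseteq> ?S"
      unfolding S by auto
    from card_mono[OF fin this] show "j < point_count t {s<..x}"
      by (simp add: point_count_def)
  next
    assume *: "j < point_count t {s<..x}"
    show "t (?F + j) \<le> x"
    proof (rule ccontr)
      assume n: "\<not> t (?F + j) \<le> x"
      have "?S \<subseteq> {?F..<?F + j}"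
        unfolding S
      proof safe
        fix k assume k: "?F \<le> k" "t k \<le> x"
        have "\<not> ?F + j \<le> k"
          using simple_points_le[OF t, of "?F + j" k] F1 k(2) n by linarith
        then show "k \<in> {?F..<?F + j}" using k by auto
      qed
      from card_mono[OF _ this] have "point_count t {s<..x} \<le> j"
        by (simp add: point_count_def)
      with * show False by simp
    qed
  qed
qed

text \<open>Boundedness above keeps both sets of indices finite; \<open>card\<close> of an infinite
  set would be 0 and spoil additivity.\<close>

lemma point_count_disjoint_Un:
  assumes t: "simple_points t" and "B \<inter> B' = {}" "bdd_above B" "bdd_above B'"
  shows "point_count t (B \<union> B') = point_count t B + point_count t B'"
proof -
  have fin: "finite {k. 1 \<le> k \<and> t k \<in> B}" if "bdd_above B" for B
  proof -
    obtain x where "\<And>y. y \<in> B \<Longrightarrow> y \<le> x" using \<open>bdd_above B\<close> unfolding bdd_above_def by blast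
    then show ?thesis
      by (intro finite_subset[OF _ simple_points_finite[OF t, of x]]) auto
  qed
  have "{k. 1 \<le> k \<and> t k \<in> B \<union> B'} = {k. 1 \<le> k \<and> t k \<in> B} \<union> {k. 1 \<le> k \<and> t k \<in> B'}" by auto
  moreover have "{k. 1 \<le> k \<and> t k \<in> B} \<inter> {k. 1 \<le> k \<and> t k \<in> B'} = {}"
    using assms(2) by auto
  ultimately show ?thesis
    unfolding point_count_def
    using card_Un_disjoint[OF fin[OF assms(3)] fin[OF assms(4)]] by simp
qed

text \<open>Cell 0 is the window before the bus arrives, cell \<open>k + 1\<close> the
  \<open>(k + 1)\<close>-st unit of time after its arrival. The cells are open on the left because a
  customer has to arrive strictly after \<open>s\<close>.\<close>

definition waiting_cell :: "real \<Rightarrow> real \<Rightarrow> nat \<Rightarrow> real set" where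
  "waiting_cell s a j = (case j of 0 \<Rightarrow> {s<..a} | Suc k \<Rightarrow> {a + real k<..a + real k + 1})"

lemma point_count_waiting_cells:
  assumes t: "simple_points t" and "s \<le> a"
  shows "point_count t {s<..a + real j} = (\<Sum>i\<le>j. point_count t (waiting_cell s a i))"
proof (induction j)
  case (Suc j)
  have "{s<..a + real (Suc j)} = {s<..a + real j} \<union> waiting_cell s a (Suc j)"
  proof (rule set_eqI)
    fix x
    have "real (Suc j) = real j + 1" "0 \<le> real j" by simp_all
    then show "x \<in> {s<..a + real (Suc j)} \<longleftrightarrow> x \<in> {s<..a + real j} \<union> waiting_cell s a (Suc j)"
      using assms(2) unfolding waiting_cell_def nat.case greaterThanAtMost_iff Un_iff by argo
  qed
  moreover have "{s<..a + real j} \<inter> waiting_cell s a (Suc j) = {}"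
    "bdd_above (waiting_cell s a (Suc j))"
    by (auto simp: waiting_cell_def)
  ultimately show ?case
    using Suc point_count_disjoint_Un[OF t, of "{s<..a + real j}" "waiting_cell s a (Suc j)"]
    by simp
next
  case 0
  show ?case by (simp add: waiting_cell_def)
qed

text \<open>The term \<open>M_i - F_i + 1\<close> of the recursion for \<open>H_i\<close>. Taken in
  the reals, it is nonnegative even where the \<open>LEAST\<close> in \<open>first_boarder\<close>
  is void.\<close>

definition boarders :: "(nat \<Rightarrow> real) \<Rightarrow> real \<Rightarrow> real \<Rightarrow> real" where
  "boarders t s a = real (last_boarder t s a) - real (first_boarder t s) + 1"

lemma boarders_nonneg: "0 \<le> boarders t s a"
  by (simp add: boarders_def last_boarder_def)

lemma boarders_eq_card:
  "simple_points t \<Longrightarrow> boarders t s a = real (card (boarding_indices t s a))"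
  using first_boarder_ge1[of t s] by (simp add: boarders_def last_boarder_def of_nat_diff)

text \<open>Each boarding takes one unit of time, so one customer is removed per cell: boarding goes
  on as long as the walk whose step is the cell count minus one stays positive. Hence the number of
  boarders is a hitting time.\<close>

lemma boarding_indices_eq:
  assumes "simple_points t" "s \<le> a"
  shows "boarding_indices t s a
    = {k. \<forall>j\<le>k. j < (\<Sum>i\<le>j. point_count t (waiting_cell s a i))}"
proof -
  have *: "t (first_boarder t s + j) \<le> a + real j
      \<longleftrightarrow> j < (\<Sum>i\<le>j. point_count t (waiting_cell s a i))" for j
    by (simp only: less_point_count_iff[OF assms(1), symmetric] point_count_waiting_cells[OF assms, symmetric])
  show ?thesis
    unfolding boarding_indices_def by (simp only: * atLeast0AtMost Ball_def atMost_iff)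
qed

lemma simple_points_cong:
  "(\<And>k. 1 \<le> k \<Longrightarrow> t k = t' k) \<Longrightarrow> simple_points t = simple_points t'"
  unfolding simple_points_def
  by (intro conj_cong filterlim_cong refl)
     (auto simp: eventually_sequentially intro!: exI[of _ 1])

lemma point_count_cong:
  "(\<And>k. 1 \<le> k \<Longrightarrow> t k = t' k) \<Longrightarrow> point_count t B = point_count t' B"
  unfolding point_count_def by (intro arg_cong[where f = card]) auto

text \<open>Only cell counts matter, and they do not see coordinate 0. Independence of the stations
  is assumed for the sequences restricted to positive indices, so this is what permits the
  replacement of \<open>T i\<close> by its restriction.\<close>

lemma boarders_cong:
  assumes "simple_points t" "\<And>k. 1 \<le> k \<Longrightarrow> t k = t' k" "s \<le> a"
  shows "boarders t s a = boarders t' s a"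
proof -
  have t': "simple_points t'"
    using assms(1) simple_points_cong[of t t', OF assms(2)] by blast
  have pc: "point_count t B = point_count t' B" for B
    by (rule point_count_cong) (rule assms(2))
  show ?thesis
    unfolding boarders_eq_card[OF assms(1)] boarders_eq_card[OF t']
      boarding_indices_eq[OF assms(1,3)] boarding_indices_eq[OF t' assms(3)] pc ..
qed

section \<open>A stopped Poisson walk\<close>

text \<open>Stated for a general field because the real case serves the Chernoff bounds and the
  complex one the characteristic function.\<close>

lemma (in prob_space)
  fixes X :: "'a \<Rightarrow> nat" and q :: "'b :: {real_normed_field, banach, second_countable_topology}"
  assumes X: "X \<in> measurable M (count_space UNIV)" and "0 \<le> l"
    and law: "\<And>n. prob {\<omega> \<in> space M. X \<omega> = n} = exp (- l) * l ^ n / fact n"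
  shows integrable_poisson_power: "integrable M (\<lambda>\<omega>. q ^ X \<omega>)"
    and integral_poisson_power: "(\<integral>\<omega>. q ^ X \<omega> \<partial>M) = exp (of_real l * (q - 1))"
proof -
  let ?w = "\<lambda>n::nat. exp (- l) * l ^ n / fact n"
  have distr: "distr M (count_space UNIV) X = density (count_space UNIV) (\<lambda>n. ennreal (?w n))"
  proof (rule measure_eqI_countable[where A = UNIV])
    fix n
    have "emeasure (distr M (count_space UNIV) X) {n} = emeasure M {\<omega> \<in> space M. X \<omega> = n}"
      using X by (subst emeasure_distr) (auto intro!: arg_cong[where f = "emeasure M"])
    also have "\<dots> = ennreal (?w n)"
      by (simp add: emeasure_eq_measure law)
    finally show "emeasure (distr M (count_space UNIV) X) {n}
        = emeasure (density (count_space UNIV) (\<lambda>n. ennreal (?w n))) {n}"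
      by (simp add: emeasure_density nn_integral_count_space_indicator[symmetric] one_ennreal_def[symmetric])
  qed auto
  have summand: "?w n *\<^sub>R q ^ n = exp (- l) *\<^sub>R ((of_real l * q) ^ n /\<^sub>R fact n)" for n
    by (simp add: scaleR_conv_of_real power_mult_distrib divide_inverse mult_ac)
  have sums: "(\<lambda>n. ?w n *\<^sub>R q ^ n) sums (exp (- l) *\<^sub>R exp (of_real l * q))"
    unfolding summand by (intro sums_scaleR_right exp_converges)
  have "norm (?w n *\<^sub>R q ^ n) = ?w n *\<^sub>R norm q ^ n" for n
    using \<open>0 \<le> l\<close> by (simp add: norm_power)
  moreover have "?w n *\<^sub>R norm q ^ n = exp (- l) *\<^sub>R ((of_real l * norm q) ^ n /\<^sub>R fact n)" for n
    by (simp add: power_mult_distrib divide_inverse mult_ac)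
  ultimately have summable: "summable (\<lambda>n. norm (?w n *\<^sub>R q ^ n))"
    by (simp only:) (intro summable_scaleR_right summable_exp_generic)
  have int: "integrable (count_space UNIV) (\<lambda>n. ?w n *\<^sub>R q ^ n)"
    using summable by (simp add: integrable_count_space_nat_iff)
  have int': "integrable (distr M (count_space UNIV) X) (\<lambda>n. q ^ n)"
    unfolding distr using int \<open>0 \<le> l\<close> by (subst integrable_density) auto
  then show "integrable M (\<lambda>\<omega>. q ^ X \<omega>)"
    using X by (subst (asm) integrable_distr_eq) auto
  have "(\<integral>\<omega>. q ^ X \<omega> \<partial>M) = (\<integral>n. q ^ n \<partial>distr M (count_space UNIV) X)"
    using X by (subst integral_distr) auto
  also have "\<dots> = (\<integral>n. ?w n *\<^sub>R q ^ n \<partial>count_space UNIV)"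
    unfolding distr using \<open>0 \<le> l\<close> by (subst integral_density) auto
  also have "\<dots> = (\<Sum>n. ?w n *\<^sub>R q ^ n)"
    by (rule integral_count_space_nat[OF int])
  also have "\<dots> = exp (- l) *\<^sub>R exp (of_real l * q)"
    using sums by (rule sums_unique[symmetric])
  also have "\<dots> = exp (of_real l * (q - 1))"
    by (simp add: right_diff_distrib exp_diff scaleR_conv_of_real exp_minus divide_inverse exp_of_real)
  finally show "(\<integral>\<omega>. q ^ X \<omega> \<partial>M) = exp (of_real l * (q - 1))" .
qed

text \<open>\<open>N 0\<close>, with mean \<open>l\<close>, is the starting population in the
  window; each later cell brings a Poisson number of mean \<open>\<alpha>\<close> while one customer
  boards. The associated walk is \<open>C j - j\<close>.\<close>

locale poisson_walk = prob_space M for M :: "'a measure" +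
  fixes N :: "nat \<Rightarrow> 'a \<Rightarrow> nat" and l \<alpha> :: real
  assumes indep: "indep_vars (\<lambda>_. count_space UNIV) N UNIV"
    and l: "0 \<le> l" and alpha: "0 \<le> \<alpha>"
    and law0: "\<And>n. prob {\<omega> \<in> space M. N 0 \<omega> = n} = exp (- l) * l ^ n / fact n"
    and law: "\<And>j n. prob {\<omega> \<in> space M. N (Suc j) \<omega> = n} = exp (- \<alpha>) * \<alpha> ^ n / fact n"
begin

lemma N_measurable [measurable]: "N j \<in> measurable M (count_space UNIV)"
  using indep by (auto simp: indep_vars_def)

definition C :: "nat \<Rightarrow> 'a \<Rightarrow> nat" where
  "C j \<omega> = (\<Sum>i\<le>j. N i \<omega>)"

lemma C_0: "C 0 \<omega> = N 0 \<omega>" and C_Suc: "C (Suc j) \<omega> = C j \<omega> + N (Suc j) \<omega>"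
  by (simp_all add: C_def)

lemma C_measurable [measurable]: "C j \<in> measurable M (count_space UNIV)"
  unfolding C_def by measurable

definition alive :: "nat \<Rightarrow> 'a \<Rightarrow> bool" where
  "alive n \<omega> \<longleftrightarrow> (\<forall>j\<le>n. j < C j \<omega>)"

definition run :: "'a \<Rightarrow> nat" where
  "run \<omega> = card {n. alive n \<omega>}"

definition finite_run :: "'a \<Rightarrow> bool" where
  "finite_run \<omega> \<longleftrightarrow> (\<exists>n. \<not> alive n \<omega>)"

lemma alive_measurable [measurable]: "Measurable.pred M (alive n)"
  unfolding alive_def by measurable

lemma run_measurable [measurable]: "run \<in> measurable M (count_space UNIV)"
  unfolding run_def by measurable

lemma alive_mono: "alive n \<omega> \<Longrightarrow> k \<le> n \<Longrightarrow> alive k \<omega>"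
  by (auto simp: alive_def)

lemma run_eqI:
  assumes "\<not> alive b \<omega>" "\<And>j. j < b \<Longrightarrow> alive j \<omega>"
  shows "run \<omega> = b"
proof -
  have "n < b" if "alive n \<omega>" for n
    using that assms(1) alive_mono leI by blast
  then have "{n. alive n \<omega>} = {..<b}"
    using assms(2) by auto
  then show ?thesis by (simp add: run_def)
qed

text \<open>\<open>Z z q n \<omega>\<close> is \<open>z ^ k * q ^ (C k \<omega> - k)\<close> at the stopping time \<open>k = min n (run \<omega>)\<close>, a martingale
  in \<open>n\<close> if \<open>q = z * exp (\<alpha> * (q - 1))\<close>. At \<open>k = run \<omega>\<close> the exponent of \<open>q\<close> is \<open>0\<close>.\<close>

definition U :: "'b::{real_normed_field, banach, second_countable_topology} \<Rightarrow> 'b \<Rightarrow> nat \<Rightarrow> 'a \<Rightarrow> 'b" where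
  "U z q n \<omega> = (if alive n \<omega> then z ^ n * q ^ (C n \<omega> - n) else 0)"

fun Z :: "'b::{real_normed_field, banach, second_countable_topology} \<Rightarrow> 'b \<Rightarrow> nat \<Rightarrow> 'a \<Rightarrow> 'b" where
  "Z z q 0 \<omega> = q ^ N 0 \<omega>"
| "Z z q (Suc n) \<omega> = Z z q n \<omega> + (U z q n \<omega> * ((z / q) * q ^ N (Suc n) \<omega>) - U z q n \<omega>)"

lemma U_measurable [measurable]: "U z q n \<in> borel_measurable M"
  unfolding U_def[abs_def] by measurable

lemma Z_measurable [measurable]: "Z z q n \<in> borel_measurable M"
proof (induction n)
  case 0
  have "Z z q 0 = (\<lambda>\<omega>. q ^ N 0 \<omega>)" by (simp add: fun_eq_iff)
  then show ?case by simp
next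
  case (Suc n)
  note Suc[measurable]
  have "Z z q (Suc n) = (\<lambda>\<omega>. Z z q n \<omega> + (U z q n \<omega> * ((z / q) * q ^ N (Suc n) \<omega>) - U z q n \<omega>))"
    by (simp add: fun_eq_iff)
  then show ?case by simp
qed

text \<open>Alive at \<open>n\<close> means \<open>C n - n \<ge> 1\<close>, so the walk is still
  nonnegative one step later and the natural subtraction in the exponent loses nothing.\<close>

lemma U_next:
  assumes "q \<noteq> 0" "alive n \<omega>"
  shows "U z q n \<omega> * ((z / q) * q ^ N (Suc n) \<omega>) = z ^ Suc n * q ^ (C (Suc n) \<omega> - Suc n)"
proof -
  have "n < C n \<omega>" using assms(2) by (auto simp: alive_def)
  then have "C (Suc n) \<omega> - Suc n + 1 = (C n \<omega> - n) + N (Suc n) \<omega>"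
    by (simp add: C_Suc)
  then have "q ^ (C n \<omega> - n) * q ^ N (Suc n) \<omega> = q ^ (C (Suc n) \<omega> - Suc n) * q"
    by (metis power_add power_one_right)
  then show ?thesis using assms by (simp add: U_def field_simps)
qed

lemma Z_alive:
  assumes "q \<noteq> 0"
  shows "(\<And>j. j < n \<Longrightarrow> alive j \<omega>) \<Longrightarrow> Z z q n \<omega> = z ^ n * q ^ (C n \<omega> - n)"
proof (induction n)
  case (Suc n)
  then have "alive n \<omega>" by simp
  with Suc U_next[OF assms this, of z] show ?case
    by (simp add: U_def)
qed (simp add: C_0)

text \<open>At the first index \<open>b\<close> that is not alive the exponent of \<open>q\<close>
  is 0; from then on \<open>U\<close> vanishes and \<open>Z\<close> stays frozen.\<close>

lemma Z_finished:
  assumes "q \<noteq> 0" "\<not> alive b \<omega>" "\<And>j. j < b \<Longrightarrow> alive j \<omega>" "b \<le> n"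
  shows "Z z q n \<omega> = z ^ b"
  using assms(4)
proof (induction n rule: dec_induct)
  case base
  have "C b \<omega> \<le> b"
  proof (cases b)
    case 0
    then show ?thesis using assms(2) by (simp add: alive_def)
  next
    case (Suc k)
    then have "alive k \<omega>" using assms(3) by simp
    then have "\<not> b < C b \<omega>"
      using assms(2) unfolding alive_def Suc by (metis le_Suc_eq)
    then show ?thesis by simp
  qed
  with Z_alive[OF assms(1,3), of b z] show ?case by simp
next
  case (step n)
  have "\<not> alive n \<omega>" using assms(2) alive_mono[of n \<omega> b] step.hyps by auto
  with step show ?case by (simp add: U_def)
qed

lemma finite_run_cases:
  obtains (infinite) "\<not> finite_run \<omega>" "\<And>n. alive n \<omega>"
    | (finite) b where "finite_run \<omega>" "\<not> alive b \<omega>" "\<And>j. j < b \<Longrightarrow> alive j \<omega>" "run \<omega> = b"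
proof (cases "finite_run \<omega>")
  case False
  with infinite show ?thesis by (auto simp: finite_run_def)
next
  case True
  define b where "b = (LEAST n. \<not> alive n \<omega>)"
  have b: "\<not> alive b \<omega>"
    using True unfolding finite_run_def b_def by (rule LeastI_ex)
  have b': "alive j \<omega>" if "j < b" for j
    using not_less_Least[of j "\<lambda>n. \<not> alive n \<omega>"] that unfolding b_def by blast
  show ?thesis by (rule finite[OF True b b' run_eqI[OF b b']])
qed

text \<open>\<open>U z q n\<close> is a function of the steps up to \<open>n\<close>. Restricting
  the family to the disjoint index sets \<open>{..n}\<close> and \<open>{Suc n}\<close> takes the
  place of a filtration.\<close>

lemma U_future_indep:
  fixes z q :: "'b::{real_normed_field, banach, second_countable_topology}"
  shows "indep_var borel (U z q n) borel (\<lambda>\<omega>. q ^ N (Suc n) \<omega>)"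
proof -
  let ?P = "PiM {..n} (\<lambda>_. count_space (UNIV :: nat set))"
  let ?al = "\<lambda>f. \<forall>j\<in>{..n}. j < (\<Sum>i\<le>j. f i)"
  let ?u = "\<lambda>f. if ?al f then z ^ n * q ^ ((\<Sum>i\<le>n. f i) - n) else 0"
  have comp: "(\<lambda>f. f i) \<in> measurable ?P (count_space UNIV)" if "i \<le> n" for i
    using that by (intro measurable_component_singleton) auto
  have sum: "(\<lambda>f. \<Sum>i\<le>j. f i) \<in> measurable ?P (count_space UNIV)" if "j \<le> n" for j
    using that by (intro measurable_sum_nat comp) auto
  have pr: "Measurable.pred ?P ?al"
    by (intro pred_intros_finite) (auto intro!: measurable_compose[OF sum])
  have "?u \<in> borel_measurable ?P"
    using pr sum[of n] by (intro measurable_If) (auto intro!: measurable_compose[OF sum])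
  then have "indep_var borel (?u \<circ> (\<lambda>\<omega>. restrict (\<lambda>i. N i \<omega>) {..n}))
    borel ((\<lambda>f. q ^ f (Suc n)) \<circ> (\<lambda>\<omega>. restrict (\<lambda>i. N i \<omega>) {Suc n}))"
    by (intro indep_var_compose[OF indep_var_restrict[OF indep]]) auto
  moreover have "?u \<circ> (\<lambda>\<omega>. restrict (\<lambda>i. N i \<omega>) {..n}) = U z q n"
    by (auto simp: fun_eq_iff U_def alive_def C_def)
  moreover have "(\<lambda>f. q ^ f (Suc n)) \<circ> (\<lambda>\<omega>. restrict (\<lambda>i. N i \<omega>) {Suc n}) = (\<lambda>\<omega>. q ^ N (Suc n) \<omega>)"
    by (auto simp: fun_eq_iff)
  ultimately show ?thesis by simp
qed

lemma U_integrable: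
  fixes z q :: "'b::{real_normed_field, banach, second_countable_topology}"
  assumes "q \<noteq> 0"
  shows "integrable M (U z q n)"
proof (induction n)
  case 0
  show ?case
    by (rule Bochner_Integration.integrable_bound[OF integrable_poisson_power[OF _ l law0, of q]])
       (auto simp: U_def C_0)
next
  case (Suc n)
  have "integrable M (\<lambda>\<omega>. U z q n \<omega> * q ^ N (Suc n) \<omega>)"
    by (intro indep_var_integrable[OF U_future_indep] Suc integrable_poisson_power[OF _ alpha law]) simp
  from integrable_mult_right[OF this, of "z / q"] show ?case
  proof (rule Bochner_Integration.integrable_bound)
    show "AE \<omega> in M. norm (U z q (Suc n) \<omega>) \<le> norm (z / q * (U z q n \<omega> * q ^ N (Suc n) \<omega>))"
    proof (intro always_eventually allI)
      fix \<omega>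
      show "norm (U z q (Suc n) \<omega>) \<le> norm (z / q * (U z q n \<omega> * q ^ N (Suc n) \<omega>))"
      proof (cases "alive (Suc n) \<omega>")
        case True
        then have "alive n \<omega>" by (rule alive_mono) simp
        from U_next[OF assms this, of z] True
        have "U z q (Suc n) \<omega> = z / q * (U z q n \<omega> * q ^ N (Suc n) \<omega>)"
          by (simp add: U_def[of z q "Suc n"] mult_ac)
        then show ?thesis by simp
      qed (simp add: U_def)
    qed
  qed simp
qed

text \<open>The drift factor is kept explicit because two cases are needed: it is nonpositive for
  the supermartingale behind the real bounds and zero for the complex martingale.\<close>

lemma
  fixes z q :: "'b::{real_normed_field, banach, second_countable_topology}"
  assumes "q \<noteq> 0"
  shows Z_integrable: "integrable M (Z z q n)"
    and Z_integral_0: "(\<integral>\<omega>. Z z q 0 \<omega> \<partial>M) = exp (of_real l * (q - 1))"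
    and Z_integral_Suc: "(\<integral>\<omega>. Z z q (Suc n) \<omega> \<partial>M) = (\<integral>\<omega>. Z z q n \<omega> \<partial>M)
      + (z / q * exp (of_real \<alpha> * (q - 1)) - 1) * (\<integral>\<omega>. U z q n \<omega> \<partial>M)"
proof -
  have pow: "integrable M (\<lambda>\<omega>. q ^ N (Suc n) \<omega>)" for n
    by (rule integrable_poisson_power[OF _ alpha law]) simp
  have UN: "integrable M (\<lambda>\<omega>. U z q n \<omega> * q ^ N (Suc n) \<omega>)" for n
    by (intro indep_var_integrable[OF U_future_indep] U_integrable assms pow)
  have UN': "integrable M (\<lambda>\<omega>. U z q n \<omega> * ((z / q) * q ^ N (Suc n) \<omega>))" for n
    using integrable_mult_right[OF UN[of n], of "z / q"] by (simp add: mult_ac)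
  show Zi: "integrable M (Z z q n)" for n
  proof (induction n)
    case 0
    have "Z z q 0 = (\<lambda>\<omega>. q ^ N 0 \<omega>)" by (simp add: fun_eq_iff)
    then show ?case using integrable_poisson_power[OF _ l law0, of q] by simp
  next
    case (Suc n)
    have "Z z q (Suc n) = (\<lambda>\<omega>. Z z q n \<omega> + (U z q n \<omega> * ((z / q) * q ^ N (Suc n) \<omega>) - U z q n \<omega>))"
      by (simp add: fun_eq_iff)
    then show ?case using Suc UN' U_integrable[OF assms] by simp
  qed
  show "(\<integral>\<omega>. Z z q 0 \<omega> \<partial>M) = exp (of_real l * (q - 1))"
    using integral_poisson_power[OF _ l law0, of q] by simp
  have "(\<integral>\<omega>. U z q n \<omega> * ((z / q) * q ^ N (Suc n) \<omega>) \<partial>M)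
      = z / q * (\<integral>\<omega>. U z q n \<omega> * q ^ N (Suc n) \<omega> \<partial>M)"
    by (subst integral_mult_right_zero[symmetric]) (simp add: mult_ac)
  also have "\<dots> = z / q * ((\<integral>\<omega>. U z q n \<omega> \<partial>M) * exp (of_real \<alpha> * (q - 1)))"
    by (simp add: indep_var_lebesgue_integral[OF U_future_indep U_integrable[OF assms] pow]
        integral_poisson_power[OF _ alpha law])
  finally show "(\<integral>\<omega>. Z z q (Suc n) \<omega> \<partial>M) = (\<integral>\<omega>. Z z q n \<omega> \<partial>M)
      + (z / q * exp (of_real \<alpha> * (q - 1)) - 1) * (\<integral>\<omega>. U z q n \<omega> \<partial>M)"
    using Zi UN' U_integrable[OF assms] by (simp add: algebra_simps)
qed

lemma Z_nonneg:
  fixes z q :: real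
  assumes "0 < z" "0 < q"
  shows "0 \<le> Z z q n \<omega>"
proof (cases \<omega> rule: finite_run_cases)
  case infinite
  then show ?thesis using Z_alive[of q n \<omega> z] assms by simp
next
  case (finite b)
  show ?thesis
  proof (cases "b \<le> n")
    case True
    then show ?thesis using Z_finished[of q b \<omega> n z] finite assms by simp
  next
    case False
    then show ?thesis using Z_alive[of q n \<omega> z] finite assms by simp
  qed
qed

lemma Z_integral_le:
  fixes z q :: real
  assumes "0 < z" "0 < q" "z * exp (\<alpha> * (q - 1)) \<le> q"
  shows "(\<integral>\<omega>. Z z q n \<omega> \<partial>M) \<le> exp (l * (q - 1))"
proof (induction n)
  case 0
  show ?case using Z_integral_0[of q z] assms by simp
next
  case (Suc n)
  have "0 \<le> (\<integral>\<omega>. U z q n \<omega> \<partial>M)"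
    using assms by (intro integral_nonneg_AE always_eventually) (auto simp: U_def)
  moreover have "z / q * exp (\<alpha> * (q - 1)) - 1 \<le> 0"
    using assms by (simp add: field_simps)
  ultimately have "(z / q * exp (\<alpha> * (q - 1)) - 1) * (\<integral>\<omega>. U z q n \<omega> \<partial>M) \<le> 0"
    by (rule mult_nonpos_nonneg[rotated])
  then show ?case using Suc Z_integral_Suc[of q z n] assms by simp
qed

lemma nn_integral_liminf_Z_le:
  fixes z q :: real
  assumes "0 < z" "0 < q" "z * exp (\<alpha> * (q - 1)) \<le> q"
  shows "(\<integral>\<^sup>+\<omega>. liminf (\<lambda>n. ennreal (Z z q n \<omega>)) \<partial>M) \<le> ennreal (exp (l * (q - 1)))"
proof -
  have "(\<integral>\<^sup>+\<omega>. liminf (\<lambda>n. ennreal (Z z q n \<omega>)) \<partial>M)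
      \<le> liminf (\<lambda>n. \<integral>\<^sup>+\<omega>. ennreal (Z z q n \<omega>) \<partial>M)"
    by (rule nn_integral_liminf) simp
  also have "\<dots> \<le> liminf (\<lambda>n. ennreal (exp (l * (q - 1))))"
  proof (intro Liminf_mono always_eventually allI)
    fix n
    show "(\<integral>\<^sup>+\<omega>. ennreal (Z z q n \<omega>) \<partial>M) \<le> ennreal (exp (l * (q - 1)))"
      using Z_integral_le[OF assms] assms
      by (subst nn_integral_eq_integral) (auto intro!: Z_integrable Z_nonneg ennreal_leI)
  qed
  also have "\<dots> = ennreal (exp (l * (q - 1)))"
    by (simp add: Liminf_const)
  finally show ?thesis .
qed

text \<open>On an infinite run \<open>Z\<close> is at least \<open>z ^ n\<close> and explodes,
  whereas Fatou's lemma bounds the integral of its lower limit.\<close>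

lemma AE_finite_run:
  fixes z q :: real
  assumes "1 < z" "1 < q" "z * exp (\<alpha> * (q - 1)) \<le> q"
  shows "AE \<omega> in M. finite_run \<omega>"
proof -
  have "(\<integral>\<^sup>+\<omega>. liminf (\<lambda>n. ennreal (Z z q n \<omega>)) \<partial>M) \<le> ennreal (exp (l * (q - 1)))"
    using assms by (intro nn_integral_liminf_Z_le) auto
  then have "(\<integral>\<^sup>+\<omega>. liminf (\<lambda>n. ennreal (Z z q n \<omega>)) \<partial>M) \<noteq> \<infinity>"
    by (metis ennreal_neq_top infinity_ennreal_def neq_top_trans)
  then have "AE \<omega> in M. liminf (\<lambda>n. ennreal (Z z q n \<omega>)) \<noteq> \<infinity>"
    by (rule nn_integral_PInf_AE[rotated]) measurable
  then show ?thesis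
  proof eventually_elim
    case (elim \<omega>)
    show ?case
    proof (cases \<omega> rule: finite_run_cases)
      case infinite
      have "z ^ n \<le> Z z q n \<omega>" for n
        using Z_alive[of q n \<omega> z] infinite assms by simp
      then have ge: "eventually (\<lambda>n. z ^ n \<le> Z z q n \<omega>) sequentially"
        by (intro always_eventually allI)
      have "filterlim (\<lambda>n. z ^ n) at_top sequentially"
      proof (rule filterlim_at_infinity_imp_filterlim_at_top)
        show "filterlim (\<lambda>n. z ^ n) at_infinity sequentially"
          using assms(1) by (intro filterlim_realpow_sequentially_gt1) simp
        show "eventually (\<lambda>n. 0 < z ^ n) sequentially"
          using assms(1) by simp
      qed
      from filterlim_at_top_mono[OF this ge]
      have "(\<lambda>n. ennreal (Z z q n \<omega>)) \<longlonglongrightarrow> \<infinity>"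
        by (simp add: ennreal_tendsto_top_eq_at_top)
      from lim_imp_Liminf[OF _ this] elim show ?thesis by simp
    qed
  qed
qed

lemma nn_integral_power_run_le:
  fixes z q :: real
  assumes "0 < z" "0 < q" "z * exp (\<alpha> * (q - 1)) \<le> q" "AE \<omega> in M. finite_run \<omega>"
  shows "(\<integral>\<^sup>+\<omega>. ennreal (z ^ run \<omega>) \<partial>M) \<le> ennreal (exp (l * (q - 1)))"
proof -
  have "(\<integral>\<^sup>+\<omega>. ennreal (z ^ run \<omega>) \<partial>M) = (\<integral>\<^sup>+\<omega>. liminf (\<lambda>n. ennreal (Z z q n \<omega>)) \<partial>M)"
    using assms(4)
  proof (intro nn_integral_cong_AE, eventually_elim)
    case (elim \<omega>)
    then obtain b where b: "\<not> alive b \<omega>" "\<And>j. j < b \<Longrightarrow> alive j \<omega>" "run \<omega> = b"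
      by (cases \<omega> rule: finite_run_cases) auto
    have "eventually (\<lambda>n. ennreal (z ^ b) = ennreal (Z z q n \<omega>)) sequentially"
      using eventually_ge_at_top[of b]
      by eventually_elim (use Z_finished[of q b \<omega> _ z] b assms in auto)
    then have "(\<lambda>n. ennreal (Z z q n \<omega>)) \<longlonglongrightarrow> ennreal (z ^ b)"
      by (rule Lim_transform_eventually[OF tendsto_const])
    from lim_imp_Liminf[OF _ this] b show ?case by simp
  qed
  with nn_integral_liminf_Z_le[OF assms(1-3)] show ?thesis by simp
qed

text \<open>Optional stopping by dominated convergence: for \<open>z\<close> and \<open>q\<close> in
  the closed unit disc, \<open>Z\<close> has norm at most one. Characteristic functions require this
  exact identity, not just an inequality.\<close>

lemma integral_power_run:
  fixes z q :: complex
  assumes "norm z \<le> 1" "norm q \<le> 1" "q \<noteq> 0" "z * exp (of_real \<alpha> * (q - 1)) = q"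
    and fin: "AE \<omega> in M. finite_run \<omega>"
  shows "(\<integral>\<omega>. z ^ run \<omega> \<partial>M) = exp (of_real l * (q - 1))"
proof -
  have const: "(\<integral>\<omega>. Z z q n \<omega> \<partial>M) = exp (of_real l * (q - 1))" for n
  proof (induction n)
    case 0
    show ?case using Z_integral_0[of q z] assms(3) by simp
  next
    case (Suc n)
    have "z / q * exp (of_real \<alpha> * (q - 1)) = 1" using assms(3,4) by (simp add: field_simps)
    with Suc Z_integral_Suc[of q z n] assms(3) show ?case by simp
  qed
  have "(\<lambda>n. \<integral>\<omega>. Z z q n \<omega> \<partial>M) \<longlonglongrightarrow> (\<integral>\<omega>. z ^ run \<omega> \<partial>M)"
  proof (rule integral_dominated_convergence[where w = "\<lambda>_. 1"])
    show "AE \<omega> in M. (\<lambda>n. Z z q n \<omega>) \<longlonglongrightarrow> z ^ run \<omega>"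
      using fin
    proof eventually_elim
      case (elim \<omega>)
      then obtain b where b: "\<not> alive b \<omega>" "\<And>j. j < b \<Longrightarrow> alive j \<omega>" "run \<omega> = b"
        by (cases \<omega> rule: finite_run_cases) auto
      have "eventually (\<lambda>n. z ^ b = Z z q n \<omega>) sequentially"
        using eventually_ge_at_top[of b]
        by eventually_elim (use Z_finished[of q b \<omega> _ z] b assms in auto)
      then have "(\<lambda>n. Z z q n \<omega>) \<longlonglongrightarrow> z ^ b"
        by (rule Lim_transform_eventually[OF tendsto_const])
      then show ?case using b by simp
    qed
    show "AE \<omega> in M. norm (Z z q n \<omega>) \<le> 1" for n
    proof (intro always_eventually allI)
      fix \<omega>
      have le: "norm (z ^ i * q ^ j) \<le> 1" for i j
        using assms(1,2) by (simp add: norm_mult norm_power mult_le_one power_le_one)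
      show "norm (Z z q n \<omega>) \<le> 1"
      proof (cases \<omega> rule: finite_run_cases)
        case infinite
        then show ?thesis using Z_alive[of q n \<omega> z] assms(3) le by simp
      next
        case (finite b)
        show ?thesis
        proof (cases "b \<le> n")
          case True
          then show ?thesis using Z_finished[of q b \<omega> n z] finite assms(3) le[of b 0] by simp
        next
          case False
          then show ?thesis using Z_alive[of q n \<omega> z] finite assms(3) le by simp
        qed
      qed
    qed
  qed auto
  with const show ?thesis by (simp add: LIMSEQ_const_iff)
qed

end

section \<open>The bus as a process with affine conditional cumulants\<close>

lemma exp_le_quadratic:
  fixes y :: real
  assumes "\<bar>y\<bar> \<le> 1"
  shows "exp y - 1 \<le> y + y\<^sup>2"
proof (cases "0 \<le> y")
  case True
  then show ?thesis using exp_bound[of y] assms by simp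
next
  case False
  define x where "x = - y"
  have x: "0 \<le> x" "x \<le> 1" using False assms by (auto simp: x_def)
  have "1 \<le> (1 - x + x\<^sup>2) * (1 + x)"
    using x by (simp add: algebra_simps power2_eq_square)
  also have "\<dots> \<le> (1 - x + x\<^sup>2) * exp x"
    using x exp_ge_add_one_self[of x] by (intro mult_left_mono) auto
  finally have "exp (- x) \<le> 1 - x + x\<^sup>2"
    by (simp add: exp_minus field_simps)
  then show ?thesis by (simp add: x_def)
qed

section \<open>Measurability and locality of the departure times\<close>

lemma boarders_measurable:
  assumes [measurable]: "\<And>k. (\<lambda>\<omega>. t \<omega> k) \<in> borel_measurable M"
    "s \<in> borel_measurable M" "a \<in> borel_measurable M"
  shows "(\<lambda>\<omega>. boarders (t \<omega>) (s \<omega>) (a \<omega>)) \<in> borel_measurable M"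
proof -
  have [measurable]: "(\<lambda>\<omega>. first_boarder (t \<omega>) (s \<omega>)) \<in> measurable M (count_space UNIV)"
    unfolding first_boarder_def by measurable
  have [measurable]: "(\<lambda>\<omega>. t \<omega> (first_boarder (t \<omega>) (s \<omega>) + j)) \<in> borel_measurable M" for j
    by (rule measurable_compose_countable[where f = "\<lambda>i \<omega>. t \<omega> (i + j)"]) measurable
  have "(\<lambda>\<omega>. card (boarding_indices (t \<omega>) (s \<omega>) (a \<omega>))) \<in> measurable M (count_space UNIV)"
    unfolding boarding_indices_def by measurable
  then show ?thesis
    unfolding boarders_def last_boarder_def by measurable
qed

lemma departure_Suc:
  "departure \<tau> d t (Suc n) = departure \<tau> d t n + \<tau> +
     boarders (t (Suc n)) (departure \<tau> d t (n - (d (Suc n) - 1))) (departure \<tau> d t n + \<tau>)"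
  by (simp add: boarders_def Let_def)

declare departure.simps(2) [simp del]

lemma departure_mono:
  assumes "0 \<le> \<tau>" "k \<le> n"
  shows "departure \<tau> d t k \<le> departure \<tau> d t n"
  using assms(2)
proof (induction n rule: dec_induct)
  case (step n)
  have "departure \<tau> d t n \<le> departure \<tau> d t (Suc n)"
    unfolding departure_Suc using assms(1) boarders_nonneg by (simp add: add_nonneg_nonneg)
  with step show ?case by simp
qed simp

lemma departure_nonneg: "0 \<le> \<tau> \<Longrightarrow> 0 \<le> departure \<tau> d t n"
  using departure_mono[of \<tau> 0 n d t] by simp

lemma departure_cong:
  assumes "\<And>i. 1 \<le> i \<Longrightarrow> i \<le> n \<Longrightarrow> t i = t' i"
  shows "departure \<tau> d t n = departure \<tau> d t' n"
  using assms
proof (induction n rule: less_induct)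
  case (less n)
  show ?case
  proof (cases n)
    case (Suc k)
    have "departure \<tau> d t k = departure \<tau> d t' k"
      "departure \<tau> d t (k - (d n - 1)) = departure \<tau> d t' (k - (d n - 1))"
      using less Suc by auto
    then show ?thesis using less.prems[of n] Suc by (simp add: departure_Suc)
  qed simp
qed

lemma departure_cong_points:
  assumes "0 \<le> \<tau>" "\<And>i. 1 \<le> i \<Longrightarrow> simple_points (t i)"
    "\<And>i k. 1 \<le> i \<Longrightarrow> 1 \<le> k \<Longrightarrow> t i k = t' i k"
  shows "departure \<tau> d t n = departure \<tau> d t' n"
proof (induction n rule: less_induct)
  case (less n)
  show ?case
  proof (cases n)
    case (Suc k)
    let ?s = "departure \<tau> d t (k - (d n - 1))" and ?a = "departure \<tau> d t k + \<tau>"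
    have "departure \<tau> d t k = departure \<tau> d t' k" "?s = departure \<tau> d t' (k - (d n - 1))"
      using less Suc by auto
    moreover have "?s \<le> ?a"
      using departure_mono[of \<tau> "k - (d n - 1)" k d t] assms(1) by simp
    then have "boarders (t n) ?s ?a = boarders (t' n) ?s ?a"
      using assms Suc by (intro boarders_cong) auto
    ultimately show ?thesis using Suc by (simp add: departure_Suc)
  qed simp
qed

lemma departure_measurable:
  assumes t: "\<And>i k. 1 \<le> i \<Longrightarrow> i \<le> n \<Longrightarrow> (\<lambda>\<omega>. t \<omega> i k) \<in> borel_measurable M"
  shows "(\<lambda>\<omega>. departure \<tau> d (t \<omega>) n) \<in> borel_measurable M"
  using t
proof (induction n rule: less_induct)
  case (less n)
  show ?case
  proof (cases n)
    case (Suc k)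
    have m[measurable]: "(\<lambda>\<omega>. departure \<tau> d (t \<omega>) k) \<in> borel_measurable M"
      "(\<lambda>\<omega>. departure \<tau> d (t \<omega>) (k - (d n - 1))) \<in> borel_measurable M"
    proof -
      have "(\<lambda>\<omega>. departure \<tau> d (t \<omega>) m) \<in> borel_measurable M" if "m \<le> k" for m
        by (rule less.IH) (use less.prems Suc that in auto)
      then show "(\<lambda>\<omega>. departure \<tau> d (t \<omega>) k) \<in> borel_measurable M"
        "(\<lambda>\<omega>. departure \<tau> d (t \<omega>) (k - (d n - 1))) \<in> borel_measurable M"
        by simp_all
    qed
    have [measurable]: "(\<lambda>\<omega>. boarders (t \<omega> n) (departure \<tau> d (t \<omega>) (k - (d n - 1)))
        (departure \<tau> d (t \<omega>) k + \<tau>)) \<in> borel_measurable M"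
      by (intro boarders_measurable m borel_measurable_add measurable_const less.prems)
        (auto simp: Suc)
    show ?thesis
      unfolding Suc departure_Suc unfolding Suc[symmetric] by measurable
  qed simp
qed

text \<open>The joint law of independent variables is the product of their laws, so Fubini applies.
  This replaces conditional expectation given the past.\<close>

lemma (in prob_space) nn_integral_indep_var:
  assumes XY: "indep_var S X N Y" and f[measurable]: "f \<in> borel_measurable (S \<Otimes>\<^sub>M N)"
  shows "(\<integral>\<^sup>+\<omega>. f (X \<omega>, Y \<omega>) \<partial>M) = (\<integral>\<^sup>+\<omega>. (\<integral>\<^sup>+\<omega>'. f (X \<omega>, Y \<omega>') \<partial>M) \<partial>M)"
proof -
  have X[measurable]: "X \<in> measurable M S" and Y[measurable]: "Y \<in> measurable M N"
    and eq: "distr M S X \<Otimes>\<^sub>M distr M N Y = distr M (S \<Otimes>\<^sub>M N) (\<lambda>x. (X x, Y x))"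
    using XY unfolding indep_var_distribution_eq by auto
  interpret Y: prob_space "distr M N Y" by (rule prob_space_distr) fact
  have "(\<integral>\<^sup>+\<omega>. f (X \<omega>, Y \<omega>) \<partial>M) = (\<integral>\<^sup>+p. f p \<partial>distr M (S \<Otimes>\<^sub>M N) (\<lambda>x. (X x, Y x)))"
    by (subst nn_integral_distr) auto
  also have "\<dots> = (\<integral>\<^sup>+x. \<integral>\<^sup>+y. f (x, y) \<partial>distr M N Y \<partial>distr M S X)"
    unfolding eq[symmetric] by (rule Y.nn_integral_fst[symmetric]) simp
  also have "\<dots> = (\<integral>\<^sup>+\<omega>. \<integral>\<^sup>+y. f (X \<omega>, y) \<partial>distr M N Y \<partial>M)"
    by (subst nn_integral_distr) (auto intro!: Y.borel_measurable_nn_integral)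
  also have "\<dots> = (\<integral>\<^sup>+\<omega>. \<integral>\<^sup>+\<omega>'. f (X \<omega>, Y \<omega>') \<partial>M \<partial>M)"
    by (intro nn_integral_cong, subst nn_integral_distr) (auto dest: measurable_space[OF X])
  finally show ?thesis .
qed

lemma (in prob_space) integral_indep_var:
  fixes f :: "'b \<times> 'b \<Rightarrow> 'e::{banach, second_countable_topology}"
  assumes XY: "indep_var S X N Y" and f[measurable]: "f \<in> borel_measurable (S \<Otimes>\<^sub>M N)"
    and bounded: "\<And>p. norm (f p) \<le> B"
  shows "(\<integral>\<omega>. f (X \<omega>, Y \<omega>) \<partial>M) = (\<integral>\<omega>. (\<integral>\<omega>'. f (X \<omega>, Y \<omega>') \<partial>M) \<partial>M)"
proof -
  have X[measurable]: "X \<in> measurable M S" and Y[measurable]: "Y \<in> measurable M N"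
    and eq: "distr M S X \<Otimes>\<^sub>M distr M N Y = distr M (S \<Otimes>\<^sub>M N) (\<lambda>x. (X x, Y x))"
    using XY unfolding indep_var_distribution_eq by auto
  interpret X: prob_space "distr M S X" by (rule prob_space_distr) fact
  interpret Y: prob_space "distr M N Y" by (rule prob_space_distr) fact
  interpret XY: pair_prob_space "distr M S X" "distr M N Y" ..
  have int: "integrable (distr M S X \<Otimes>\<^sub>M distr M N Y) f"
    by (rule XY.integrable_const_bound[of _ B]) (auto simp: bounded)
  have "(\<integral>\<omega>. f (X \<omega>, Y \<omega>) \<partial>M) = (\<integral>p. f p \<partial>distr M (S \<Otimes>\<^sub>M N) (\<lambda>x. (X x, Y x)))"
    by (subst integral_distr) auto
  also have "\<dots> = (\<integral>x. \<integral>y. f (x, y) \<partial>distr M N Y \<partial>distr M S X)"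
    unfolding eq[symmetric] by (rule XY.integral_fst'[symmetric, OF int])
  also have "\<dots> = (\<integral>\<omega>. \<integral>y. f (X \<omega>, y) \<partial>distr M N Y \<partial>M)"
    by (subst integral_distr) (auto intro!: Y.borel_measurable_lebesgue_integral)
  also have "\<dots> = (\<integral>\<omega>. \<integral>\<omega>'. f (X \<omega>, Y \<omega>') \<partial>M \<partial>M)"
    by (intro Bochner_Integration.integral_cong refl, subst integral_distr)
       (auto dest: measurable_space[OF X])
  finally show ?thesis .
qed

section \<open>The bus line as a stochastic process\<close>

locale bus_line = prob_space M for M :: "'a measure" +
  fixes T :: "nat \<Rightarrow> nat \<Rightarrow> 'a \<Rightarrow> real" and \<alpha> \<tau> :: real and d :: "nat \<Rightarrow> nat"
  assumes alpha: "0 < \<alpha>" "\<alpha> < 1" and tau: "0 < \<tau>"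
    and arrivals: "independent_poisson_processes M \<alpha> T"
    and discipline: "queueing_discipline d"
begin

abbreviation "arr_space \<equiv> PiM {1::nat..} (\<lambda>_. borel :: real measure)"

text \<open>The form in which independence of the stations is assumed; at index 0 it is the constant
  \<open>undefined\<close>. Almost surely the departure times do not change, see
  \<open>AE_departure_eq\<close>.\<close>

definition arr :: "nat \<Rightarrow> 'a \<Rightarrow> nat \<Rightarrow> real" where
  "arr i \<omega> = (\<lambda>k\<in>{1..}. T i k \<omega>)"

lemma poisson: "1 \<le> i \<Longrightarrow> poisson_process M \<alpha> (T i)"
  using arrivals by (auto simp: independent_poisson_processes_def)

lemma arr_indep: "indep_vars (\<lambda>_. arr_space) arr {1..}"
  using arrivals unfolding independent_poisson_processes_def arr_def[abs_def] by blast

lemma T_measurable: "1 \<le> i \<Longrightarrow> T i k \<in> borel_measurable M"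
  using poisson[of i] by (auto simp: poisson_process_def)

lemma AE_simple_points_T: "1 \<le> i \<Longrightarrow> AE \<omega> in M. simple_points (\<lambda>k. T i k \<omega>)"
  using poisson[of i] by (auto simp: poisson_process_def simple_points_def)

lemma simple_points_arr: "simple_points (arr i \<omega>) = simple_points (\<lambda>k. T i k \<omega>)"
  by (rule simple_points_cong) (simp add: arr_def)

lemma point_count_arr: "point_count (arr i \<omega>) B = point_count (\<lambda>k. T i k \<omega>) B"
  by (rule point_count_cong) (simp add: arr_def)

lemma arr_coordinate [measurable]: "(\<lambda>t. t k) \<in> borel_measurable arr_space"
proof (cases "1 \<le> k")
  case True
  then show ?thesis by (intro measurable_component_singleton) auto
next
  case False
  have "t k = undefined" if "t \<in> space arr_space" for t
    using that False by (auto simp: space_PiM PiE_def extensional_def)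
  then show ?thesis by (subst measurable_cong[where g = "\<lambda>_. undefined"]) auto
qed

lemma arr_measurable: "1 \<le> i \<Longrightarrow> arr i \<in> measurable M arr_space"
  using arr_indep by (auto simp: indep_vars_def)

lemma poisson_walk_cells:
  assumes i: "1 \<le> i" and sa: "0 \<le> s" "s \<le> a"
  shows "poisson_walk M (\<lambda>j \<omega>. point_count (arr i \<omega>) (waiting_cell s a j)) (\<alpha> * (a - s)) \<alpha>"
proof -
  have b: "bounded {u<..v}" for u v :: real
    by (rule bounded_subset[OF bounded_closed_interval[of u v]]) auto
  have cell: "waiting_cell s a j \<in> sets borel \<and> waiting_cell s a j \<subseteq> {0..} \<and> bounded (waiting_cell s a j)" for j
    using sa by (cases j) (auto simp: waiting_cell_def b)
  have cell_less: "y < z" if "y \<in> waiting_cell s a j" "z \<in> waiting_cell s a k" "j < k" for y z j k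
  proof -
    from \<open>j < k\<close> obtain k' where k: "k = Suc k'" by (cases k) auto
    have "real j \<le> real k'" using that(3) k by simp
    moreover have "y \<le> a + real j"
      using that(1) by (cases j) (auto simp: waiting_cell_def)
    ultimately show ?thesis using that(2) by (simp add: waiting_cell_def k)
  qed
  have disj: "disjoint_family (waiting_cell s a)"
    unfolding disjoint_family_on_def
  proof (intro ballI impI equals0I)
    fix j k x assume "j \<noteq> k" "x \<in> waiting_cell s a j \<inter> waiting_cell s a k"
    then show False using cell_less[of x j x k] cell_less[of x k x j] by (cases "j < k") auto
  qed
  have P: "poisson_process M \<alpha> (T i)" by (rule poisson[OF i])
  have len0: "measure lborel (waiting_cell s a 0) = a - s"
    using sa by (simp add: waiting_cell_def)
  have len: "measure lborel (waiting_cell s a (Suc j)) = 1" for j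
    by (simp add: waiting_cell_def)
  have law: "measure M {\<omega> \<in> space M. point_count (\<lambda>k. T i k \<omega>) (waiting_cell s a j) = n} =
      exp (- (\<alpha> * measure lborel (waiting_cell s a j))) * (\<alpha> * measure lborel (waiting_cell s a j)) ^ n / fact n" for j n
    using P cell unfolding poisson_process_def by blast
  show ?thesis
  proof
    show "indep_vars (\<lambda>_. count_space UNIV) (\<lambda>j \<omega>. point_count (arr i \<omega>) (waiting_cell s a j)) UNIV"
      unfolding point_count_arr using P cell disj unfolding poisson_process_def by blast
    show "0 \<le> \<alpha> * (a - s)" "0 \<le> \<alpha>" using alpha sa by auto
    show "prob {\<omega> \<in> space M. point_count (arr i \<omega>) (waiting_cell s a 0) = n}
        = exp (- (\<alpha> * (a - s))) * (\<alpha> * (a - s)) ^ n / fact n" for n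
      unfolding point_count_arr using law[of 0 n] by (simp add: len0)
    show "prob {\<omega> \<in> space M. point_count (arr i \<omega>) (waiting_cell s a (Suc j)) = n}
        = exp (- \<alpha>) * \<alpha> ^ n / fact n" for j n
      unfolding point_count_arr using law[of "Suc j" n] by (simp add: len)
  qed
qed

text \<open>With \<open>z = exp x\<close> and \<open>q = exp y\<close> the supermartingale condition
  reads \<open>x + \<alpha> * (exp y - 1) \<le> y\<close>. Thus \<open>y - x\<close> bounds the
  cumulant at \<open>x\<close> per unit of window length; equality gives the functional equation of
  \<open>\<psi>\<close> with \<open>v = w + \<psi> w\<close>.\<close>

lemma
  fixes w v :: complex
  assumes i: "1 \<le> i" and sa: "0 \<le> s" "s \<le> a"
  shows nn_integral_exp_boarders: "x + \<alpha> * (exp y - 1) \<le> y \<Longrightarrow>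
      (\<integral>\<^sup>+\<omega>. ennreal (exp (x * boarders (arr i \<omega>) s a)) \<partial>M) \<le> ennreal (exp (\<alpha> * (a - s) * (exp y - 1)))"
    and integral_exp_boarders: "Re w \<le> 0 \<Longrightarrow> Re v \<le> 0 \<Longrightarrow> v = w + \<alpha> * (exp v - 1) \<Longrightarrow>
      (\<integral>\<omega>. exp (w * of_real (boarders (arr i \<omega>) s a)) \<partial>M) = exp (\<alpha> * (a - s) * (exp v - 1))"
proof -
  interpret W: poisson_walk M "\<lambda>j \<omega>. point_count (arr i \<omega>) (waiting_cell s a j)" "\<alpha> * (a - s)" \<alpha>
    by (rule poisson_walk_cells[OF assms])
  have run: "AE \<omega> in M. boarders (arr i \<omega>) s a = real (W.run \<omega>)"
    using AE_simple_points_T[OF i]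
  proof eventually_elim
    case (elim \<omega>)
    then have "simple_points (arr i \<omega>)" by (simp add: simple_points_arr)
    then show ?case
      by (simp add: boarders_eq_card boarding_indices_eq sa W.run_def W.alive_def W.C_def)
  qed
  \<comment> \<open>The run ends almost surely if
    \<open>x0 + \<alpha> * (exp y0 - 1) \<le> y0\<close> for some positive \<open>x0\<close> and
    \<open>y0\<close>. As \<open>\<alpha> < 1\<close>, a small \<open>y0\<close> exceeds
    \<open>\<alpha> * (exp y0 - 1)\<close> by at least \<open>x0\<close>, a fixed proportion of
    \<open>y0\<close>.\<close>
  define y0 where "y0 = min 1 ((1 - \<alpha>) / (2 * \<alpha>))"
  have y0: "0 < y0" "y0 \<le> 1" "\<alpha> * y0 \<le> (1 - \<alpha>) / 2"
    using alpha by (auto simp: y0_def min_def field_simps)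
  define x0 where "x0 = y0 * (1 - \<alpha>) / 2"
  have "x0 > 0" using y0 alpha by (simp add: x0_def)
  have "\<alpha> * (exp y0 - 1) \<le> \<alpha> * (y0 + y0\<^sup>2)"
    using exp_le_quadratic[of y0] y0 alpha by (intro mult_left_mono) auto
  also have "\<dots> = \<alpha> * y0 + (\<alpha> * y0) * y0" by (simp add: power2_eq_square algebra_simps)
  also have "\<dots> \<le> \<alpha> * y0 + ((1 - \<alpha>) / 2) * y0"
    using y0 by (intro add_left_mono mult_right_mono) auto
  also have "\<dots> = y0 - x0" by (simp add: x0_def field_simps)
  finally have le: "x0 + \<alpha> * (exp y0 - 1) \<le> y0" by simp
  have fin: "AE \<omega> in M. W.finite_run \<omega>"
  proof (rule W.AE_finite_run)
    show "1 < exp x0" "1 < exp y0" using \<open>0 < x0\<close> y0 by auto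
    show "exp x0 * exp (\<alpha> * (exp y0 - 1)) \<le> exp y0"
      using le by (simp flip: exp_add)
  qed
  show "(\<integral>\<^sup>+\<omega>. ennreal (exp (x * boarders (arr i \<omega>) s a)) \<partial>M) \<le> ennreal (exp (\<alpha> * (a - s) * (exp y - 1)))"
    if "x + \<alpha> * (exp y - 1) \<le> y"
  proof -
    have "(\<integral>\<^sup>+\<omega>. ennreal (exp (x * boarders (arr i \<omega>) s a)) \<partial>M) = (\<integral>\<^sup>+\<omega>. ennreal (exp x ^ W.run \<omega>) \<partial>M)"
      using run by (intro nn_integral_cong_AE, eventually_elim) (simp add: exp_of_nat_mult[symmetric] mult.commute)
    also have "\<dots> \<le> ennreal (exp (\<alpha> * (a - s) * (exp y - 1)))"
      using that by (intro W.nn_integral_power_run_le fin) (auto simp flip: exp_add)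
    finally show ?thesis .
  qed
  show "(\<integral>\<omega>. exp (w * of_real (boarders (arr i \<omega>) s a)) \<partial>M) = exp (\<alpha> * (a - s) * (exp v - 1))"
    if w: "Re w \<le> 0" "Re v \<le> 0" "v = w + \<alpha> * (exp v - 1)"
  proof -
    have meas: "(\<lambda>\<omega>. boarders (arr i \<omega>) s a) \<in> borel_measurable M"
      by (intro boarders_measurable measurable_compose[OF arr_measurable[OF i] arr_coordinate]) auto
    have "(\<integral>\<omega>. exp (w * of_real (boarders (arr i \<omega>) s a)) \<partial>M) = (\<integral>\<omega>. exp w ^ W.run \<omega> \<partial>M)"
    proof (rule integral_cong_AE)
      show "AE \<omega> in M. exp (w * of_real (boarders (arr i \<omega>) s a)) = exp w ^ W.run \<omega>"
        using run by eventually_elim (simp add: exp_of_nat_mult[symmetric] mult.commute)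
      show "(\<lambda>\<omega>. exp (w * of_real (boarders (arr i \<omega>) s a))) \<in> borel_measurable M"
        using meas by measurable
      show "(\<lambda>\<omega>. exp w ^ W.run \<omega>) \<in> borel_measurable M"
        by (rule measurable_compose[OF W.run_measurable]) simp
    qed
    also have "\<dots> = exp (\<alpha> * (a - s) * (exp v - 1))"
      using w(1,2) by (subst W.integral_power_run[where q = "exp v"])
        (auto simp: fin simp flip: exp_add w(3))
    finally show ?thesis .
  qed
qed

text \<open>The stations up to \<open>n\<close> as one random element of a product space. Together
  with \<open>present n\<close>, the same for station \<open>n + 1\<close> alone, it is a pair of
  restrictions of one independent family to disjoint index sets.\<close>

definition past :: "nat \<Rightarrow> 'a \<Rightarrow> nat \<Rightarrow> nat \<Rightarrow> real" where
  "past n \<omega> = (\<lambda>i\<in>{1..n}. arr i \<omega>)"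

abbreviation "past_space n \<equiv> PiM {1..n} (\<lambda>_. arr_space)"

definition D :: "nat \<Rightarrow> 'a \<Rightarrow> real" where
  "D n \<omega> = departure \<tau> d (\<lambda>i. arr i \<omega>) n"

lemma D_past: "k \<le> n \<Longrightarrow> departure \<tau> d (past n \<omega>) k = D k \<omega>"
  unfolding D_def by (rule departure_cong) (auto simp: past_def)

lemma past_measurable: "past n \<in> measurable M (past_space n)"
  unfolding past_def[abs_def] by (intro measurable_restrict arr_measurable) simp

lemma component_coordinate:
  assumes "i \<in> I"
  shows "(\<lambda>p. p i k) \<in> borel_measurable (PiM I (\<lambda>_. arr_space))"
  using measurable_compose[OF measurable_component_singleton[OF assms] arr_coordinate] .

lemma departure_past_measurable: "k \<le> n \<Longrightarrow> (\<lambda>p. departure \<tau> d p k) \<in> borel_measurable (past_space n)"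
  by (intro departure_measurable component_coordinate) simp

lemma D_measurable [measurable]: "D n \<in> borel_measurable M"
  using measurable_compose[OF past_measurable departure_past_measurable, of n n] by (simp add: D_past)

lemma AE_departure_eq: "AE \<omega> in M. \<forall>n. departure \<tau> d (\<lambda>i k. T i k \<omega>) n = D n \<omega>"
proof -
  have "AE \<omega> in M. \<forall>i. 1 \<le> i \<longrightarrow> simple_points (\<lambda>k. T i k \<omega>)"
    using AE_simple_points_T by (subst AE_all_countable) (auto intro: AE_impI)
  then show ?thesis
  proof eventually_elim
    case (elim \<omega>)
    then show ?case
      unfolding D_def using tau by (intro allI departure_cong_points) (auto simp: arr_def)
  qed
qed

definition present :: "nat \<Rightarrow> 'a \<Rightarrow> nat \<Rightarrow> nat \<Rightarrow> real" where
  "present n \<omega> = (\<lambda>i\<in>{Suc n}. arr i \<omega>)"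

abbreviation "present_space n \<equiv> PiM {Suc n} (\<lambda>_. arr_space)"

lemma past_indep: "indep_var (past_space n) (past n) (present_space n) (present n)"
  unfolding past_def[abs_def] present_def[abs_def] by (intro indep_var_restrict[OF arr_indep]) auto

text \<open>Indexed by the last station left: \<open>gate n\<close> and \<open>span n\<close> belong
  to station \<open>n + 1\<close>, and \<open>span n\<close> is the \<open>l\<close> of the
  overview.\<close>

definition gate :: "nat \<Rightarrow> 'a \<Rightarrow> real" where
  "gate n \<omega> = D (n - (d (Suc n) - 1)) \<omega>"

definition span :: "nat \<Rightarrow> 'a \<Rightarrow> real" where
  "span n \<omega> = D n \<omega> + \<tau> - gate n \<omega>"

lemma gate_measurable [measurable]: "gate n \<in> borel_measurable M"
  unfolding gate_def[abs_def] by measurable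

lemma span_measurable [measurable]: "span n \<in> borel_measurable M"
  unfolding span_def[abs_def] by measurable

lemma gate_nonneg: "0 \<le> gate n \<omega>"
  unfolding gate_def D_def using tau by (intro departure_nonneg) auto

lemma span_ge: "\<tau> \<le> span n \<omega>"
  unfolding span_def gate_def D_def using tau
  by (simp add: departure_mono)

lemma D_Suc: "D (Suc n) \<omega> = D n \<omega> + \<tau> + boarders (arr (Suc n) \<omega>) (gate n \<omega>) (D n \<omega> + \<tau>)"
  unfolding D_def departure_Suc gate_def ..

lemma D_0: "D 0 \<omega> = 0"
  by (simp add: D_def)

lemma boarders_pair_measurable:
  "(\<lambda>(p, t). boarders (t (Suc n)) (departure \<tau> d p (n - (d (Suc n) - 1))) (departure \<tau> d p n + \<tau>))
     \<in> borel_measurable (past_space n \<Otimes>\<^sub>M present_space n)"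
proof -
  have [measurable]: "(\<lambda>q. departure \<tau> d (fst q) (n - (d (Suc n) - 1))) \<in> borel_measurable (past_space n \<Otimes>\<^sub>M present_space n)"
    "(\<lambda>q. departure \<tau> d (fst q) n) \<in> borel_measurable (past_space n \<Otimes>\<^sub>M present_space n)"
    by (intro measurable_compose[OF measurable_fst departure_past_measurable] diff_le_self order_refl)+
  show ?thesis
    unfolding split_beta'
    by (intro boarders_measurable measurable_compose[OF measurable_snd component_coordinate]) measurable
qed

text \<open>The window ends \<open>gate n\<close> and \<open>D n + \<tau>\<close> are functions of
  the past. Once the past is frozen they are constants, and the transform computed for deterministic
  window ends applies.\<close>

lemma nn_integral_boarders:
  assumes F: "(\<lambda>(p, b). F p b) \<in> borel_measurable (past_space n \<Otimes>\<^sub>M borel)"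
  shows "(\<integral>\<^sup>+\<omega>. F (past n \<omega>) (D (Suc n) \<omega> - D n \<omega> - \<tau>) \<partial>M) =
    (\<integral>\<^sup>+\<omega>. (\<integral>\<^sup>+\<omega>'. F (past n \<omega>) (boarders (arr (Suc n) \<omega>') (gate n \<omega>) (D n \<omega> + \<tau>)) \<partial>M) \<partial>M)"
proof -
  let ?b = "\<lambda>p t. boarders (t (Suc n)) (departure \<tau> d p (n - (d (Suc n) - 1))) (departure \<tau> d p n + \<tau>)"
  let ?f = "\<lambda>(p, t). F p (?b p t)"
  have "?f = (\<lambda>(p, b). F p b) \<circ> (\<lambda>q. (fst q, (\<lambda>(p, t). ?b p t) q))"
    by (auto simp: fun_eq_iff)
  also have "\<dots> \<in> borel_measurable (past_space n \<Otimes>\<^sub>M present_space n)"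
    by (intro measurable_comp[OF _ F] measurable_Pair boarders_pair_measurable measurable_fst)
  finally have "(\<integral>\<^sup>+\<omega>. ?f (past n \<omega>, present n \<omega>) \<partial>M) = (\<integral>\<^sup>+\<omega>. \<integral>\<^sup>+\<omega>'. ?f (past n \<omega>, present n \<omega>') \<partial>M \<partial>M)"
    by (rule nn_integral_indep_var[OF past_indep])
  then show ?thesis
    by (simp add: D_past D_Suc gate_def present_def)
qed

lemma integral_boarders:
  fixes F :: "(nat \<Rightarrow> nat \<Rightarrow> real) \<Rightarrow> real \<Rightarrow> complex"
  assumes F: "(\<lambda>(p, b). F p b) \<in> borel_measurable (past_space n \<Otimes>\<^sub>M borel)"
    and bounded: "\<And>p b. 0 \<le> b \<Longrightarrow> norm (F p b) \<le> B"
  shows "(\<integral>\<omega>. F (past n \<omega>) (D (Suc n) \<omega> - D n \<omega> - \<tau>) \<partial>M) =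
    (\<integral>\<omega>. (\<integral>\<omega>'. F (past n \<omega>) (boarders (arr (Suc n) \<omega>') (gate n \<omega>) (D n \<omega> + \<tau>)) \<partial>M) \<partial>M)"
proof -
  let ?b = "\<lambda>p t. boarders (t (Suc n)) (departure \<tau> d p (n - (d (Suc n) - 1))) (departure \<tau> d p n + \<tau>)"
  let ?f = "\<lambda>(p, t). F p (?b p t)"
  have "?f = (\<lambda>(p, b). F p b) \<circ> (\<lambda>q. (fst q, (\<lambda>(p, t). ?b p t) q))"
    by (auto simp: fun_eq_iff)
  also have "\<dots> \<in> borel_measurable (past_space n \<Otimes>\<^sub>M present_space n)"
    by (intro measurable_comp[OF _ F] measurable_Pair boarders_pair_measurable measurable_fst)
  finally have "(\<integral>\<omega>. ?f (past n \<omega>, present n \<omega>) \<partial>M) = (\<integral>\<omega>. \<integral>\<omega>'. ?f (past n \<omega>, present n \<omega>') \<partial>M \<partial>M)"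
    by (rule integral_indep_var[OF past_indep, where B = B]) (auto simp: bounded boarders_nonneg)
  then show ?thesis
    by (simp add: D_past D_Suc gate_def present_def)
qed

end

section \<open>Cumulants of linear combinations of the increments\<close>

context bus_line
begin

definition m :: real where "m = \<alpha> / (1 - \<alpha>)"

lemma m_pos: "0 < m"
  using alpha by (simp add: m_def)

lemma alpha_m: "\<alpha> * (1 + m) = m" "(1 - \<alpha>) * m = \<alpha>"
  using alpha by (auto simp: m_def field_simps)

lemma d_pos: "1 \<le> i \<Longrightarrow> 1 \<le> d i"
  using discipline by (auto simp: queueing_discipline_def Suc_le_eq)

text \<open>\<open>p\<close> is an upper bound for the log transform at \<open>x\<close> per unit of
  window length. A relation is used because any such \<open>p\<close> will do in the recursion,
  while the transform itself may be infinite for large positive \<open>x\<close>.\<close>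

definition log_mgf_le :: "real \<Rightarrow> real \<Rightarrow> bool" where
  "log_mgf_le x p \<longleftrightarrow> (\<forall>i s a. 1 \<le> i \<longrightarrow> 0 \<le> s \<longrightarrow> s \<le> a \<longrightarrow>
     (\<integral>\<^sup>+\<omega>. ennreal (exp (x * boarders (arr i \<omega>) s a)) \<partial>M) \<le> ennreal (exp ((a - s) * p)))"

lemma log_mgf_leI:
  assumes "\<alpha> * (exp (x + p) - 1) \<le> p"
  shows "log_mgf_le x p"
  unfolding log_mgf_le_def
proof (intro allI impI)
  fix i :: nat and s a :: real assume sa: "1 \<le> i" "0 \<le> s" "s \<le> a"
  have "(\<integral>\<^sup>+\<omega>. ennreal (exp (x * boarders (arr i \<omega>) s a)) \<partial>M)
      \<le> ennreal (exp (\<alpha> * (a - s) * (exp (x + p) - 1)))"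
    using assms by (intro nn_integral_exp_boarders sa) simp
  also have "\<alpha> * (a - s) * (exp (x + p) - 1) \<le> (a - s) * p"
    using mult_left_mono[OF assms, of "a - s"] sa by (simp add: mult_ac)
  finally show "(\<integral>\<^sup>+\<omega>. ennreal (exp (x * boarders (arr i \<omega>) s a)) \<partial>M) \<le> ennreal (exp ((a - s) * p))"
    by (simp add: ennreal_leI)
qed

lemma log_mgf_le_mono:
  assumes "log_mgf_le x p" "x' \<le> x" "p \<le> p'"
  shows "log_mgf_le x' p'"
  unfolding log_mgf_le_def
proof (intro allI impI)
  fix i :: nat and s a :: real assume sa: "1 \<le> i" "0 \<le> s" "s \<le> a"
  have "(\<integral>\<^sup>+\<omega>. ennreal (exp (x' * boarders (arr i \<omega>) s a)) \<partial>M)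
      \<le> (\<integral>\<^sup>+\<omega>. ennreal (exp (x * boarders (arr i \<omega>) s a)) \<partial>M)"
    using assms(2) by (intro nn_integral_mono ennreal_leI) (simp add: mult_right_mono boarders_nonneg)
  also have "\<dots> \<le> ennreal (exp ((a - s) * p))"
    using assms(1) sa by (auto simp: log_mgf_le_def)
  also have "\<dots> \<le> ennreal (exp ((a - s) * p'))"
    using assms(3) sa by (intro ennreal_leI) (simp add: mult_left_mono)
  finally show "(\<integral>\<^sup>+\<omega>. ennreal (exp (x' * boarders (arr i \<omega>) s a)) \<partial>M) \<le> ennreal (exp ((a - s) * p'))" .
qed

lemma log_mgf_quadratic:
  obtains K x0 where "0 < K" "0 < x0" "\<And>x. \<bar>x\<bar> \<le> x0 \<Longrightarrow> log_mgf_le x (m * x + K * x\<^sup>2)"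
proof
  \<comment> \<open>Put \<open>p = m * x + K * x^2\<close> and \<open>y = x + p\<close>. In
    \<open>\<alpha> * (y + y^2) \<le> p\<close> the linear terms agree by
    \<open>\<alpha> * (1 + m) = m\<close>, and with
    \<open>\<bar>y\<bar> \<le> (2 + m) * \<bar>x\<bar>\<close> the quadratic ones agree if
    \<open>(1 - \<alpha>) * K = \<alpha> * (2 + m)^2\<close>, that is
    \<open>K = m * (2 + m)^2\<close>. The range \<open>x0\<close> guarantees this bound on
    \<open>y\<close> and \<open>\<bar>y\<bar> \<le> 1\<close>.\<close>
  let ?K = "m * (2 + m)\<^sup>2" and ?x0 = "min (1 / (m * (2 + m)\<^sup>2)) (1 / (2 + m))"
  show K: "0 < ?K" and "0 < ?x0" using m_pos by auto
  fix x :: real assume x: "\<bar>x\<bar> \<le> ?x0"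
  define y where "y = x + (m * x + ?K * x\<^sup>2)"
  have Kx: "?K * \<bar>x\<bar> \<le> 1" and mx: "(2 + m) * \<bar>x\<bar> \<le> 1"
    using x K m_pos by (auto simp: field_simps)
  have "y = x * ((1 + m) + ?K * x)" by (simp add: y_def algebra_simps power2_eq_square)
  then have "\<bar>y\<bar> = \<bar>x\<bar> * \<bar>(1 + m) + ?K * x\<bar>" by (simp only: abs_mult)
  also have "\<bar>(1 + m) + ?K * x\<bar> \<le> (1 + m) + ?K * \<bar>x\<bar>"
    using m_pos abs_triangle_ineq[of "1 + m" "?K * x"] by (simp add: abs_mult)
  also have "\<dots> \<le> 2 + m" using Kx by simp
  finally have y: "\<bar>y\<bar> \<le> \<bar>x\<bar> * (2 + m)"
    by (simp add: mult_left_mono)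
  then have "\<bar>y\<bar> \<le> 1" using mx by (simp add: mult.commute)
  then have "\<alpha> * (exp y - 1) \<le> \<alpha> * (y + y\<^sup>2)"
    using alpha by (intro mult_left_mono exp_le_quadratic) auto
  also have "y\<^sup>2 \<le> (2 + m)\<^sup>2 * x\<^sup>2"
    using power_mono[OF y, of 2] by (simp add: power_mult_distrib mult.commute)
  also have "\<alpha> * (y + (2 + m)\<^sup>2 * x\<^sup>2) = (\<alpha> * (1 + m)) * x + \<alpha> * ?K * x\<^sup>2 + \<alpha> * (2 + m)\<^sup>2 * x\<^sup>2"
    by (simp add: y_def algebra_simps)
  also have "\<dots> = m * x + \<alpha> * ?K * x\<^sup>2 + ((1 - \<alpha>) * m) * (2 + m)\<^sup>2 * x\<^sup>2"
    by (simp only: alpha_m)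
  also have "\<dots> = m * x + ?K * x\<^sup>2" by (simp add: algebra_simps)
  finally have "\<alpha> * (exp (x + (m * x + ?K * x\<^sup>2)) - 1) \<le> m * x + ?K * x\<^sup>2"
    using alpha by (simp add: y_def)
  then show "log_mgf_le x (m * x + ?K * x\<^sup>2)" by (rule log_mgf_leI)
qed

definition inc :: "nat \<Rightarrow> 'a \<Rightarrow> real" where
  "inc j \<omega> = D j \<omega> - D (j - 1) \<omega>"

lemma inc_measurable [measurable]: "inc j \<in> borel_measurable M"
  unfolding inc_def[abs_def] by measurable

lemma inc_Suc: "inc (Suc n) \<omega> = \<tau> + (D (Suc n) \<omega> - D n \<omega> - \<tau>)"
  by (simp add: inc_def)

lemma inc_ge: "1 \<le> j \<Longrightarrow> \<tau> \<le> inc j \<omega>"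
  using D_Suc[of "j - 1" \<omega>] boarders_nonneg by (cases j) (simp_all add: inc_def)

lemma inc_nonneg: "0 \<le> inc j \<omega>"
  using inc_ge[of j \<omega>] tau by (cases j) (auto simp: inc_def)

lemma sum_inc: "k \<le> n \<Longrightarrow> (\<Sum>j\<in>{k<..n}. inc j \<omega>) = D n \<omega> - D k \<omega>"
proof (induction n rule: dec_induct)
  case (step n)
  then have "{k<..Suc n} = insert (Suc n) {k<..n}" by auto
  with step show ?case by (simp add: inc_def)
qed simp

lemma span_eq: "span n \<omega> = \<tau> + (\<Sum>j\<in>{Suc n - d (Suc n)<..n}. inc j \<omega>)"
proof -
  have "n - (d (Suc n) - 1) = Suc n - d (Suc n)" using d_pos[of "Suc n"] by simp
  then show ?thesis using d_pos[of "Suc n"] by (simp add: span_def gate_def sum_inc)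
qed

lemma span_eq': "span n \<omega> = \<tau> + (\<Sum>j=1..n. if Suc n - d (Suc n) < j then inc j \<omega> else 0)"
proof -
  have "{Suc n - d (Suc n)<..n} = {j \<in> {1..n}. Suc n - d (Suc n) < j}" by auto
  then show ?thesis
    unfolding span_eq by (simp only: sum.inter_filter[OF finite_atLeastAtMost])
qed

lemma inc_past: "1 \<le> j \<Longrightarrow> j \<le> n \<Longrightarrow>
    departure \<tau> d (past n \<omega>) j - departure \<tau> d (past n \<omega>) (j - 1) = inc j \<omega>"
  by (simp add: inc_def D_past)

text \<open>Integrating out the last station replaces its weight \<open>w\<close> by the weight \<open>p\<close> on all stations in its
  window; \<open>w j\<close> is the weight accumulated by station \<open>j\<close> when its turn comes.\<close>

theorem nn_integral_exp_linear:
  assumes "\<And>j. 1 \<le> j \<Longrightarrow> j \<le> n \<Longrightarrow> log_mgf_le (w j) (p j)"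
    and "\<And>j. 1 \<le> j \<Longrightarrow> j \<le> n \<Longrightarrow> w j = z j + (\<Sum>i\<in>{j<..n}. if i - d i < j then p i else 0)"
  shows "(\<integral>\<^sup>+\<omega>. ennreal (exp (\<Sum>j=1..n. z j * inc j \<omega>)) \<partial>M) \<le> ennreal (exp (\<tau> * (\<Sum>j=1..n. w j + p j)))"
  using assms
proof (induction n arbitrary: z)
  case 0
  then show ?case by (simp add: emeasure_space_1)
next
  case (Suc n)
  let ?x = "z (Suc n)" and ?q = "p (Suc n)"
  let ?z' = "\<lambda>j. z j + (if Suc n - d (Suc n) < j then ?q else 0)"
  let ?S = "\<lambda>q. \<Sum>j=1..n. z j * (departure \<tau> d q j - departure \<tau> d q (j - 1))"
  let ?F = "\<lambda>q b. ennreal (exp (?S q + ?x * \<tau> + ?x * b))"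
  have w_top: "w (Suc n) = ?x" using Suc.prems(2)[of "Suc n"] by simp
  have mgf: "log_mgf_le ?x ?q" using Suc.prems(1)[of "Suc n"] w_top by simp
  have S: "?S (past n \<omega>) = (\<Sum>j=1..n. z j * inc j \<omega>)" for \<omega>
    by (intro sum.cong refl arg_cong2[where f = "(*)"] inc_past) simp_all
  have [measurable]: "?S \<in> borel_measurable (past_space n)"
    by (intro borel_measurable_sum borel_measurable_times borel_measurable_diff
        borel_measurable_const departure_past_measurable) auto
  have "(\<integral>\<^sup>+\<omega>. ennreal (exp (\<Sum>j=1..Suc n. z j * inc j \<omega>)) \<partial>M)
      = (\<integral>\<^sup>+\<omega>. ?F (past n \<omega>) (D (Suc n) \<omega> - D n \<omega> - \<tau>) \<partial>M)"
    unfolding S by (intro nn_integral_cong) (simp add: inc_Suc algebra_simps)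
  also have "\<dots> = (\<integral>\<^sup>+\<omega>. (\<integral>\<^sup>+\<omega>'. ?F (past n \<omega>) (boarders (arr (Suc n) \<omega>') (gate n \<omega>) (D n \<omega> + \<tau>)) \<partial>M) \<partial>M)"
    by (intro nn_integral_boarders) measurable
  also have "\<dots> \<le> (\<integral>\<^sup>+\<omega>. ennreal (exp (\<tau> * (?x + ?q))) * ennreal (exp (\<Sum>j=1..n. ?z' j * inc j \<omega>)) \<partial>M)"
  proof (intro nn_integral_mono)
    fix \<omega>
    have meas: "(\<lambda>\<omega>'. boarders (arr (Suc n) \<omega>') (gate n \<omega>) (D n \<omega> + \<tau>)) \<in> borel_measurable M"
      by (intro boarders_measurable measurable_compose[OF arr_measurable arr_coordinate]) auto
    have "(\<integral>\<^sup>+\<omega>'. ?F (past n \<omega>) (boarders (arr (Suc n) \<omega>') (gate n \<omega>) (D n \<omega> + \<tau>)) \<partial>M)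
      = ennreal (exp (?S (past n \<omega>) + ?x * \<tau>)) *
        (\<integral>\<^sup>+\<omega>'. ennreal (exp (?x * boarders (arr (Suc n) \<omega>') (gate n \<omega>) (D n \<omega> + \<tau>))) \<partial>M)"
      using meas by (subst nn_integral_cmult[symmetric]) (auto simp: exp_add ennreal_mult')
    also have "\<dots> \<le> ennreal (exp (?S (past n \<omega>) + ?x * \<tau>)) * ennreal (exp (span n \<omega> * ?q))"
    proof (rule mult_left_mono)
      have "gate n \<omega> \<le> D n \<omega> + \<tau>" using span_ge[of n \<omega>] tau by (simp add: span_def)
      then show "(\<integral>\<^sup>+\<omega>'. ennreal (exp (?x * boarders (arr (Suc n) \<omega>') (gate n \<omega>) (D n \<omega> + \<tau>))) \<partial>M)
          \<le> ennreal (exp (span n \<omega> * ?q))"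
        using mgf gate_nonneg[of n \<omega>] by (auto simp: log_mgf_le_def span_def)
    qed simp
    also have "\<dots> = ennreal (exp (?S (past n \<omega>) + ?x * \<tau> + span n \<omega> * ?q))"
      by (simp add: exp_add ennreal_mult')
    also have "?S (past n \<omega>) + ?x * \<tau> + span n \<omega> * ?q = \<tau> * (?x + ?q) + (\<Sum>j=1..n. ?z' j * inc j \<omega>)"
      unfolding S span_eq' distrib_right sum.distrib
      by (simp add: algebra_simps sum_distrib_left) (auto intro!: sum.cong)
    also have "ennreal (exp \<dots>) = ennreal (exp (\<tau> * (?x + ?q))) * ennreal (exp (\<Sum>j=1..n. ?z' j * inc j \<omega>))"
      by (simp add: exp_add ennreal_mult')
    finally show "(\<integral>\<^sup>+\<omega>'. ?F (past n \<omega>) (boarders (arr (Suc n) \<omega>') (gate n \<omega>) (D n \<omega> + \<tau>)) \<partial>M)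
      \<le> ennreal (exp (\<tau> * (?x + ?q))) * ennreal (exp (\<Sum>j=1..n. ?z' j * inc j \<omega>))" .
  qed
  also have "\<dots> = ennreal (exp (\<tau> * (?x + ?q))) * (\<integral>\<^sup>+\<omega>. ennreal (exp (\<Sum>j=1..n. ?z' j * inc j \<omega>)) \<partial>M)"
    by (intro nn_integral_cmult) measurable
  also have "\<dots> \<le> ennreal (exp (\<tau> * (?x + ?q))) * ennreal (exp (\<tau> * (\<Sum>j=1..n. w j + p j)))"
  proof (intro mult_left_mono Suc.IH)
    fix j assume j: "1 \<le> j" "j \<le> n"
    then show "log_mgf_le (w j) (p j)" using Suc.prems(1) by simp
    have "{j<..Suc n} = insert (Suc n) {j<..n}" using j by auto
    then show "w j = ?z' j + (\<Sum>i\<in>{j<..n}. if i - d i < j then p i else 0)"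
      using Suc.prems(2)[of j] j by simp
  qed simp
  also have "\<dots> = ennreal (exp (\<tau> * (\<Sum>j=1..Suc n. w j + p j)))"
    by (simp add: w_top distrib_left ennreal_mult'[symmetric] exp_add[symmetric] add_ac)
  finally show ?case .
qed

text \<open>The same induction with equalities. Nonpositive real parts keep the exponentials bounded
  by one, as Fubini requires, and they persist because every \<open>p j\<close> has nonpositive real
  part.\<close>

theorem integral_exp_linear:
  fixes z w p :: "nat \<Rightarrow> complex"
  assumes "\<And>j. 1 \<le> j \<Longrightarrow> j \<le> n \<Longrightarrow> Re (w j) \<le> 0 \<and> Re (w j + p j) \<le> 0 \<and> p j = \<alpha> * (exp (w j + p j) - 1)"
    and "\<And>j. 1 \<le> j \<Longrightarrow> j \<le> n \<Longrightarrow> w j = z j + (\<Sum>i\<in>{j<..n}. if i - d i < j then p i else 0)"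
    and "\<And>j. 1 \<le> j \<Longrightarrow> j \<le> n \<Longrightarrow> Re (z j) \<le> 0"
  shows "(\<integral>\<omega>. exp (\<Sum>j=1..n. z j * inc j \<omega>) \<partial>M) = exp (\<tau> * (\<Sum>j=1..n. w j + p j))"
  using assms
proof (induction n arbitrary: z)
  case 0
  then show ?case by (simp add: prob_space)
next
  case (Suc n)
  let ?x = "z (Suc n)" and ?q = "p (Suc n)"
  let ?z' = "\<lambda>j. z j + (if Suc n - d (Suc n) < j then ?q else 0)"
  let ?S = "\<lambda>q. \<Sum>j=1..n. z j * of_real (departure \<tau> d q j - departure \<tau> d q (j - 1))"
  let ?F = "\<lambda>q b. exp (?S q + ?x * of_real \<tau> + ?x * of_real b)"
  have w_top: "w (Suc n) = ?x" using Suc.prems(2)[of "Suc n"] by simp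
  have q: "Re ?x \<le> 0" "Re (?x + ?q) \<le> 0" "?q = \<alpha> * (exp (?x + ?q) - 1)"
    using Suc.prems(1)[of "Suc n"] w_top by simp_all
  have Req: "Re ?q \<le> 0"
  proof -
    have "Re (exp (?x + ?q)) \<le> norm (exp (?x + ?q))" by (rule complex_Re_le_cmod)
    also have "\<dots> \<le> 1" using q(2) by simp
    finally have "\<alpha> * (Re (exp (?x + ?q)) - 1) \<le> 0"
      using alpha by (intro mult_nonneg_nonpos) auto
    then show ?thesis by (subst q(3)) simp
  qed
  have S: "?S (past n \<omega>) = (\<Sum>j=1..n. z j * inc j \<omega>)" for \<omega>
    by (intro sum.cong refl arg_cong2[where f = "(*)"] arg_cong[where f = of_real] inc_past) simp_all
  have [measurable]: "?S \<in> borel_measurable (past_space n)"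
    by (intro borel_measurable_sum borel_measurable_times borel_measurable_diff measurable_compose[OF _ borel_measurable_of_real]
        borel_measurable_const departure_past_measurable) auto
  have "(\<integral>\<omega>. exp (\<Sum>j=1..Suc n. z j * inc j \<omega>) \<partial>M)
      = (\<integral>\<omega>. ?F (past n \<omega>) (D (Suc n) \<omega> - D n \<omega> - \<tau>) \<partial>M)"
    unfolding S by (intro Bochner_Integration.integral_cong refl) (simp add: inc_Suc algebra_simps)
  also have "\<dots> = (\<integral>\<omega>. (\<integral>\<omega>'. ?F (past n \<omega>) (boarders (arr (Suc n) \<omega>') (gate n \<omega>) (D n \<omega> + \<tau>)) \<partial>M) \<partial>M)"
  proof (rule integral_boarders[where B = 1])
    fix q :: "nat \<Rightarrow> nat \<Rightarrow> real" and b :: real assume "0 \<le> b"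
    have "Re (?S q) \<le> 0"
      unfolding Re_sum
    proof (rule sum_nonpos)
      fix j assume j: "j \<in> {1..n}"
      have "departure \<tau> d q (j - 1) \<le> departure \<tau> d q j"
        using tau by (intro departure_mono) auto
      then show "Re (z j * of_real (departure \<tau> d q j - departure \<tau> d q (j - 1))) \<le> 0"
        using Suc.prems(3)[of j] j by (simp add: mult_nonpos_nonneg)
    qed
    moreover have "Re (?x * of_real \<tau> + ?x * of_real b) \<le> 0"
      using q(1) tau \<open>0 \<le> b\<close> by (simp add: mult_nonpos_nonneg add_nonpos_nonpos)
    ultimately show "norm (?F q b) \<le> 1" by simp
  qed measurable
  also have "\<dots> = (\<integral>\<omega>. exp (\<tau> * (?x + ?q)) * exp (\<Sum>j=1..n. ?z' j * inc j \<omega>) \<partial>M)"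
  proof (intro Bochner_Integration.integral_cong refl)
    fix \<omega>
    have ga: "gate n \<omega> \<le> D n \<omega> + \<tau>" using span_ge[of n \<omega>] tau by (simp add: span_def)
    have "(\<integral>\<omega>'. ?F (past n \<omega>) (boarders (arr (Suc n) \<omega>') (gate n \<omega>) (D n \<omega> + \<tau>)) \<partial>M)
      = exp (?S (past n \<omega>) + ?x * \<tau>) *
        (\<integral>\<omega>'. exp (?x * boarders (arr (Suc n) \<omega>') (gate n \<omega>) (D n \<omega> + \<tau>)) \<partial>M)"
      by (subst integral_mult_right_zero[symmetric]) (simp add: exp_add)
    also have "(\<integral>\<omega>'. exp (?x * boarders (arr (Suc n) \<omega>') (gate n \<omega>) (D n \<omega> + \<tau>)) \<partial>M)
      = exp (\<alpha> * (D n \<omega> + \<tau> - gate n \<omega>) * (exp (?x + ?q) - 1))"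
      using q by (intro integral_exp_boarders gate_nonneg ga) auto
    also have "\<alpha> * (D n \<omega> + \<tau> - gate n \<omega>) * (exp (?x + ?q) - 1) = span n \<omega> * (\<alpha> * (exp (?x + ?q) - 1))"
      by (simp add: span_def)
    also have "\<dots> = span n \<omega> * ?q" by (simp only: q(3)[symmetric])
    also have "exp (?S (past n \<omega>) + ?x * \<tau>) * exp (span n \<omega> * ?q) = exp (?S (past n \<omega>) + ?x * \<tau> + span n \<omega> * ?q)"
      by (simp add: exp_add)
    also have "?S (past n \<omega>) + ?x * \<tau> + span n \<omega> * ?q = \<tau> * (?x + ?q) + (\<Sum>j=1..n. ?z' j * inc j \<omega>)"
      unfolding S span_eq' distrib_right sum.distrib
      by (simp add: algebra_simps sum_distrib_left) (auto intro!: sum.cong)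
    also have "exp \<dots> = exp (\<tau> * (?x + ?q)) * exp (\<Sum>j=1..n. ?z' j * inc j \<omega>)"
      by (simp add: exp_add)
    finally show "(\<integral>\<omega>'. ?F (past n \<omega>) (boarders (arr (Suc n) \<omega>') (gate n \<omega>) (D n \<omega> + \<tau>)) \<partial>M)
      = exp (\<tau> * (?x + ?q)) * exp (\<Sum>j=1..n. ?z' j * inc j \<omega>)" .
  qed
  also have "\<dots> = exp (\<tau> * (?x + ?q)) * (\<integral>\<omega>. exp (\<Sum>j=1..n. ?z' j * inc j \<omega>) \<partial>M)"
    by simp
  also have "(\<integral>\<omega>. exp (\<Sum>j=1..n. ?z' j * inc j \<omega>) \<partial>M) = exp (\<tau> * (\<Sum>j=1..n. w j + p j))"
  proof (intro Suc.IH)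
    fix j assume j: "1 \<le> j" "j \<le> n"
    then show "Re (w j) \<le> 0 \<and> Re (w j + p j) \<le> 0 \<and> p j = \<alpha> * (exp (w j + p j) - 1)"
      using Suc.prems(1) by simp
    have "{j<..Suc n} = insert (Suc n) {j<..n}" using j by auto
    then show "w j = ?z' j + (\<Sum>i\<in>{j<..n}. if i - d i < j then p i else 0)"
      using Suc.prems(2)[of j] j by simp
    show "Re (?z' j) \<le> 0" using Suc.prems(3)[of j] j Req by simp
  qed
  also have "exp (\<tau> * (?x + ?q)) * exp (\<tau> * (\<Sum>j=1..n. w j + p j)) = exp (\<tau> * (\<Sum>j=1..Suc n. w j + p j))"
    by (simp add: w_top distrib_left exp_add[symmetric] add_ac)
  finally show ?case .
qed

end

section \<open>The backward recursion\<close>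

text \<open>Time is reversed: \<open>k\<close> stands for station \<open>n - k\<close>, and
  \<open>Q l k\<close> says that it lies in the window of the later station \<open>n - l\<close>.
  Summation over \<open>k - i\<close> keeps the recursive arguments at most \<open>k\<close>
  whatever \<open>i\<close> is, which makes termination evident; \<open>backward_eq\<close> is the
  intended form.\<close>

fun backward :: "('b \<Rightarrow> 'b) \<Rightarrow> (nat \<Rightarrow> 'b::comm_monoid_add) \<Rightarrow> (nat \<Rightarrow> nat \<Rightarrow> bool) \<Rightarrow> nat \<Rightarrow> 'b" where
  "backward \<psi> c Q 0 = c 0"
| "backward \<psi> c Q (Suc k) = c (Suc k) +
     (\<Sum>i\<le>k. if Q (k - i) (Suc k) then \<psi> (backward \<psi> c Q (k - i)) else 0)"

lemma backward_eq:
  "backward \<psi> c Q k = c k + (\<Sum>l<k. if Q l k then \<psi> (backward \<psi> c Q l) else 0)"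
proof (cases k)
  case (Suc j)
  have "(\<Sum>i\<le>j. if Q (j - i) k then \<psi> (backward \<psi> c Q (j - i)) else 0)
      = (\<Sum>l<k. if Q l k then \<psi> (backward \<psi> c Q l) else 0)"
    by (rule sum.reindex_bij_witness[of _ "\<lambda>l. j - l" "\<lambda>i. j - i"]) (auto simp: Suc)
  then show ?thesis using Suc by simp
qed simp

lemma sum_window:
  fixes f :: "nat \<Rightarrow> 'b::comm_monoid_add"
  shows "(\<Sum>l<k. if k - l \<le> h then f l else 0) = (\<Sum>i=1..h. if i \<le> k then f (k - i) else 0)"
proof -
  have "(\<Sum>l<k. if k - l \<le> h then f l else 0) = (\<Sum>l\<in>{l \<in> {..<k}. k - l \<le> h}. f l)"
    by (simp only: sum.inter_filter[OF finite_lessThan])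
  also have "\<dots> = (\<Sum>i\<in>{i \<in> {1..h}. i \<le> k}. f (k - i))"
    by (rule sum.reindex_bij_witness[of _ "\<lambda>i. k - i" "\<lambda>l. k - l"]) auto
  also have "\<dots> = (\<Sum>i=1..h. if i \<le> k then f (k - i) else 0)"
    by (simp only: sum.inter_filter[OF finite_atLeastAtMost])
  finally show ?thesis .
qed

text \<open>After exchanging the sums, each \<open>f l\<close> occurs \<open>h\<close> times, except
  for the last \<open>h\<close> indices, where part of the shifted indices \<open>l + i\<close> fall
  beyond \<open>n\<close>.\<close>

lemma sum_sum_window:
  fixes f :: "nat \<Rightarrow> 'b::real_normed_vector"
  assumes B: "\<And>l. l < n \<Longrightarrow> norm (f l) \<le> B" and "0 \<le> B"
  shows "norm ((\<Sum>k<n. \<Sum>i=1..h. if i \<le> k then f (k - i) else 0) - real h *\<^sub>R (\<Sum>l<n. f l)) \<le> (real h)\<^sup>2 * B"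
proof -
  have shift: "(\<Sum>k<n. if i \<le> k then f (k - i) else 0) = (\<Sum>l<n - i. f l)" for i
  proof -
    have "(\<Sum>k<n. if i \<le> k then f (k - i) else 0) = (\<Sum>k\<in>{k \<in> {..<n}. i \<le> k}. f (k - i))"
      by (simp only: sum.inter_filter[OF finite_lessThan])
    also have "\<dots> = (\<Sum>l<n - i. f l)"
      by (rule sum.reindex_bij_witness[of _ "\<lambda>l. l + i" "\<lambda>k. k - i"]) auto
    finally show ?thesis .
  qed
  have tail: "norm ((\<Sum>l<n - i. f l) - (\<Sum>l<n. f l)) \<le> real i * B" for i
  proof -
    have "{..<n} = {..<n - i} \<union> {n - i..<n}" by auto
    then have "(\<Sum>l<n. f l) = (\<Sum>l<n - i. f l) + (\<Sum>l\<in>{n - i..<n}. f l)"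
      by (metis finite_atLeastLessThan finite_lessThan ivl_disj_int_one(2) sum.union_disjoint lessThan_atLeast0 ivl_disj_int_two(3))
    then have "norm ((\<Sum>l<n - i. f l) - (\<Sum>l<n. f l)) = norm (\<Sum>l\<in>{n - i..<n}. f l)"
      by (simp add: norm_minus_commute)
    also have "\<dots> \<le> real (card {n - i..<n}) * B"
      by (rule sum_norm_bound) (use B in auto)
    also have "\<dots> \<le> real i * B"
      using \<open>0 \<le> B\<close> by (intro mult_right_mono) auto
    finally show ?thesis .
  qed
  have "(\<Sum>k<n. \<Sum>i=1..h. if i \<le> k then f (k - i) else 0) = (\<Sum>i=1..h. \<Sum>l<n - i. f l)"
    by (subst sum.swap) (simp only: shift)
  moreover have "real h *\<^sub>R (\<Sum>l<n. f l) = (\<Sum>i=1..h. \<Sum>l<n. f l)"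
    by (simp add: sum_constant_scaleR)
  ultimately have "(\<Sum>k<n. \<Sum>i=1..h. if i \<le> k then f (k - i) else 0) - real h *\<^sub>R (\<Sum>l<n. f l)
      = (\<Sum>i=1..h. (\<Sum>l<n - i. f l) - (\<Sum>l<n. f l))"
    by (simp add: sum_subtractf)
  also have "norm \<dots> \<le> real (card {1..h}) * (real h * B)"
  proof (rule sum_norm_bound)
    fix i assume i: "i \<in> {1..h}"
    have "norm ((\<Sum>l<n - i. f l) - (\<Sum>l<n. f l)) \<le> real i * B" by (rule tail)
    also have "\<dots> \<le> real h * B"
      using \<open>0 \<le> B\<close> i by (intro mult_right_mono) auto
    finally show "norm ((\<Sum>l<n - i. f l) - (\<Sum>l<n. f l)) \<le> real h * B" .
  qed
  finally show ?thesis by (simp add: power2_eq_square)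
qed

text \<open>The weights accumulated by unit weights on all stations when \<open>\<psi>\<close> is
  replaced by the line of slope \<open>\<mu>\<close>. They stay below the gain
  \<open>K = 1 / (1 - \<mu> * h)\<close>, and their deficits from \<open>K\<close> have bounded
  sum.\<close>

definition response :: "real \<Rightarrow> nat \<Rightarrow> nat \<Rightarrow> real" where
  "response \<mu> h = backward (\<lambda>y. \<mu> * y) (\<lambda>_. 1) (\<lambda>l k. k - l \<le> h)"

lemma response_eq:
  "response \<mu> h k = 1 + (\<Sum>i=1..h. if i \<le> k then \<mu> * response \<mu> h (k - i) else 0)"
  using backward_eq[of "\<lambda>y. \<mu> * y" "\<lambda>_. 1" "\<lambda>l k. k - l \<le> h" k]
    sum_window[of k h "\<lambda>l. \<mu> * response \<mu> h l"]
  unfolding response_def by simp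

lemma window_sum_le:
  fixes f :: "nat \<Rightarrow> real"
  assumes "\<And>i. 1 \<le> i \<Longrightarrow> i \<le> k \<Longrightarrow> f (k - i) \<le> B" "0 \<le> B"
  shows "(\<Sum>i=1..h. if i \<le> k then f (k - i) else 0) \<le> real h * B"
proof -
  have "(\<Sum>i=1..h. if i \<le> k then f (k - i) else 0) \<le> (\<Sum>i=1..h. B)"
    using assms by (intro sum_mono) auto
  then show ?thesis by simp
qed

context
  fixes \<mu> :: real and h :: nat and K :: real
  assumes mu: "0 \<le> \<mu>" "\<mu> * real h < 1"
  defines "K \<equiv> 1 / (1 - \<mu> * real h)"
begin

lemma gain: "0 < K" "1 \<le> K" "1 + \<mu> * real h * K = K"
proof -
  have "0 \<le> \<mu> * real h" using mu by simp
  with mu show "0 < K" "1 \<le> K" "1 + \<mu> * real h * K = K"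
    by (simp_all add: K_def field_simps)
qed

lemma response_bounds: "1 \<le> response \<mu> h k \<and> response \<mu> h k \<le> K"
proof (induction k rule: less_induct)
  case (less k)
  have "0 \<le> (\<Sum>i=1..h. if i \<le> k then \<mu> * response \<mu> h (k - i) else 0)"
  proof (intro sum_nonneg)
    fix i assume "i \<in> {1..h}"
    then show "0 \<le> (if i \<le> k then \<mu> * response \<mu> h (k - i) else 0)"
      using less.IH[of "k - i"] mu by (auto intro!: mult_nonneg_nonneg)
  qed
  moreover have "(\<Sum>i=1..h. if i \<le> k then \<mu> * response \<mu> h (k - i) else 0) \<le> real h * (\<mu> * K)"
  proof (rule window_sum_le)
    fix i assume "1 \<le> i" "i \<le> k"
    then show "\<mu> * response \<mu> h (k - i) \<le> \<mu> * K"
      using less.IH[of "k - i"] mu by (intro mult_left_mono) auto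
  qed (use mu gain in auto)
  ultimately show ?case
    using gain(3) by (subst (1 2) response_eq) (simp add: mult_ac)
qed

lemma sum_response: "\<bar>(\<Sum>k<n. response \<mu> h k) - real n * K\<bar> \<le> (real h)\<^sup>2 * \<mu> * K\<^sup>2"
proof -
  let ?S = "\<Sum>k<n. response \<mu> h k"
  let ?E = "(\<Sum>k<n. \<Sum>i=1..h. if i \<le> k then \<mu> * response \<mu> h (k - i) else 0)
      - real h *\<^sub>R (\<Sum>l<n. \<mu> * response \<mu> h l)"
  have E: "\<bar>?E\<bar> \<le> (real h)\<^sup>2 * (\<mu> * K)"
    unfolding real_norm_def[symmetric]
  proof (rule sum_sum_window)
    fix l
    show "norm (\<mu> * response \<mu> h l) \<le> \<mu> * K"
      using response_bounds[of l] mu by (simp add: abs_mult mult_left_mono)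
  qed (use mu gain in auto)
  have "?S = (\<Sum>k<n. 1 + (\<Sum>i=1..h. if i \<le> k then \<mu> * response \<mu> h (k - i) else 0))"
    by (intro sum.cong refl response_eq)
  also have "\<dots> = real n + (?E + \<mu> * real h * ?S)"
    by (simp add: sum.distrib sum_distrib_left[symmetric])
  finally have "?S * (1 - \<mu> * real h) = real n + ?E" by (simp add: algebra_simps)
  then have "?S = (real n + ?E) * K" using mu by (simp add: K_def field_simps)
  then have "?S - real n * K = ?E * K" by (simp add: algebra_simps)
  then have "\<bar>?S - real n * K\<bar> = \<bar>?E\<bar> * K" using gain by (simp add: abs_mult)
  also have "\<dots> \<le> ((real h)\<^sup>2 * (\<mu> * K)) * K"
    using E gain by (intro mult_right_mono) auto
  finally show ?thesis by (simp add: power2_eq_square mult_ac)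
qed

text \<open>Since \<open>1 \<le> response \<mu> h k \<le> K\<close>, the deficit of the square is at
  most \<open>2 * K\<close> times the deficit of the response.\<close>

lemma sum_response_square: "\<bar>(\<Sum>k<n. (response \<mu> h k)\<^sup>2) - real n * K\<^sup>2\<bar> \<le> 2 * K * ((real h)\<^sup>2 * \<mu> * K\<^sup>2)"
proof -
  have le: "0 \<le> K\<^sup>2 - (response \<mu> h k)\<^sup>2 \<and> K\<^sup>2 - (response \<mu> h k)\<^sup>2 \<le> 2 * K * (K - response \<mu> h k)" for k
  proof -
    have b: "1 \<le> response \<mu> h k" "response \<mu> h k \<le> K" using response_bounds by auto
    have "K\<^sup>2 - (response \<mu> h k)\<^sup>2 = (K + response \<mu> h k) * (K - response \<mu> h k)"
      by (simp add: power2_eq_square algebra_simps)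
    moreover have "\<dots> \<le> (2 * K) * (K - response \<mu> h k)"
      using b by (intro mult_right_mono) auto
    moreover have "0 \<le> (K + response \<mu> h k) * (K - response \<mu> h k)"
      using b by (intro mult_nonneg_nonneg) auto
    ultimately show ?thesis by simp
  qed
  have eq: "real n * K\<^sup>2 - (\<Sum>k<n. (response \<mu> h k)\<^sup>2) = (\<Sum>k<n. K\<^sup>2 - (response \<mu> h k)\<^sup>2)"
    by (simp add: sum_subtractf)
  have "0 \<le> (\<Sum>k<n. K\<^sup>2 - (response \<mu> h k)\<^sup>2)" using le by (intro sum_nonneg) auto
  moreover have "(\<Sum>k<n. K\<^sup>2 - (response \<mu> h k)\<^sup>2) \<le> (\<Sum>k<n. 2 * K * (K - response \<mu> h k))"
    using le by (intro sum_mono) auto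
  moreover have "\<dots> = 2 * K * (real n * K - (\<Sum>k<n. response \<mu> h k))"
    by (simp add: sum_subtractf sum_distrib_left[symmetric])
  moreover have "\<dots> \<le> 2 * K * ((real h)\<^sup>2 * \<mu> * K\<^sup>2)"
    using sum_response[of n] gain by (intro mult_left_mono) auto
  ultimately show ?thesis using eq by linarith
qed

end

section \<open>The cumulant of a busy period\<close>

lemma norm_exp_diff_le:
  fixes x y :: complex
  assumes "Re x \<le> 0" "Re y \<le> 0"
  shows "norm (exp x - exp y) \<le> norm (x - y)"
proof -
  have "norm (exp x - exp y) \<le> 1 * norm (x - y)"
  proof (rule field_differentiable_bound[of "{z. Re z \<le> 0}" exp exp])
    show "convex {z. Re z \<le> 0}" by (rule convex_halfspace_Re_le)
  qed (use assms in \<open>auto intro!: derivative_eq_intros\<close>)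
  then show ?thesis by simp
qed

lemma norm_exp_minus_quadratic:
  fixes v :: complex
  assumes "norm v \<le> R"
  shows "norm (exp v - (1 + v + v\<^sup>2 / 2)) \<le> exp R / 2 * norm v ^ 3"
proof -
  have "norm (exp v - (\<Sum>k\<le>2. v ^ k / fact k)) \<le> exp \<bar>Re v\<bar> * norm v ^ Suc 2 / fact 2"
    by (rule Taylor_exp)
  also have "(\<Sum>k\<le>2. v ^ k / fact k) = 1 + v + v\<^sup>2 / 2"
    by (simp add: numeral_2_eq_2 power2_eq_square)
  also have "exp \<bar>Re v\<bar> * norm v ^ Suc 2 / fact 2 \<le> exp R * norm v ^ Suc 2 / fact 2"
    using assms abs_Re_le_cmod[of v] by (intro divide_right_mono mult_right_mono) auto
  finally show ?thesis by (simp add: numeral_3_eq_3 numeral_2_eq_2)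
qed

text \<open>\<open>w + \<psi> w\<close> is the fixed point of
  \<open>v \<mapsto> w + \<alpha> * (exp v - 1)\<close>, a contraction of the closed left half-plane
  with constant \<open>\<alpha>\<close>, because \<open>exp\<close> is 1-Lipschitz there. The
  coefficient \<open>m * (1 + m)^2\<close> is the variance of the boarding count per unit of window
  length.\<close>

lemma busy_cumulant:
  fixes \<alpha> :: real
  assumes alpha: "0 < \<alpha>" "\<alpha> < 1"
  defines "m \<equiv> \<alpha> / (1 - \<alpha>)"
  obtains \<psi> :: "complex \<Rightarrow> complex" and B
  where "\<And>w::complex. Re w \<le> 0 \<Longrightarrow> \<psi> w = \<alpha> * (exp (w + \<psi> w) - 1)"
    "\<And>w::complex. Re w \<le> 0 \<Longrightarrow> Re (w + \<psi> w) \<le> 0"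
    "\<And>w::complex. Re w \<le> 0 \<Longrightarrow> Re (\<psi> w) \<le> 0"
    "\<And>w::complex. Re w \<le> 0 \<Longrightarrow> norm (\<psi> w) \<le> m * norm w"
    "\<And>w::complex. Re w \<le> 0 \<Longrightarrow> norm w \<le> 1 \<Longrightarrow> norm (\<psi> w - of_real m * w) \<le> B * (norm w)\<^sup>2"
    "\<And>w::complex. Re w \<le> 0 \<Longrightarrow> norm w \<le> 1 \<Longrightarrow>
       norm (\<psi> w - (of_real m * w + of_real (m * (1 + m)\<^sup>2 / 2) * w\<^sup>2)) \<le> B * norm w ^ 3"
    "0 \<le> B"
proof -
  have m: "0 < m"
    using alpha by (auto simp: m_def)
  let ?S = "{z::complex. Re z \<le> 0}"
  have ex: "\<exists>!v\<in>?S. w + of_real \<alpha> * (exp v - 1) = v" if w: "Re w \<le> 0" for w :: complex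
  proof (rule Banach_fix[where c = \<alpha>, OF iffD2[OF complete_eq_closed closed_halfspace_Re_le[of 0]]])
    show "(\<lambda>v. w + of_real \<alpha> * (exp v - 1)) ` ?S \<subseteq> ?S"
    proof safe
      fix v :: complex assume "Re v \<le> 0"
      then have "Re (exp v) \<le> 1"
        using complex_Re_le_cmod[of "exp v"] by (simp add: order_trans)
      then have "\<alpha> * (Re (exp v) - 1) \<le> 0" using alpha by (intro mult_nonneg_nonpos) auto
      then show "Re (w + of_real \<alpha> * (exp v - 1)) \<le> 0" using w by simp
    qed
    fix x y assume "x \<in> ?S" "y \<in> ?S"
    then have xy: "Re x \<le> 0" "Re y \<le> 0" by auto
    show "dist (w + of_real \<alpha> * (exp x - 1)) (w + of_real \<alpha> * (exp y - 1)) \<le> \<alpha> * dist x y"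
    proof -
      have "dist (w + of_real \<alpha> * (exp x - 1)) (w + of_real \<alpha> * (exp y - 1)) = norm (of_real \<alpha> * (exp x - exp y))"
        by (simp add: dist_norm algebra_simps)
      also have "\<dots> = \<alpha> * norm (exp x - exp y)" using alpha by (simp add: norm_mult)
      also have "\<dots> \<le> \<alpha> * dist x y"
        using norm_exp_diff_le[OF xy] alpha by (simp add: dist_norm)
      finally show "dist (w + of_real \<alpha> * (exp x - 1)) (w + of_real \<alpha> * (exp y - 1)) \<le> \<alpha> * dist x y" .
    qed
  qed (use alpha in \<open>auto intro: exI[of _ 0]\<close>)
  define \<psi> where "\<psi> w = (THE v. v \<in> ?S \<and> w + of_real \<alpha> * (exp v - 1) = v) - w" for w :: complex
  have fp: "Re (w + \<psi> w) \<le> 0" "w + \<alpha> * (exp (w + \<psi> w) - 1) = w + \<psi> w" if "Re w \<le> 0" for w :: complex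
    using theI'[OF ex[OF that]] by (auto simp: \<psi>_def)
  have eq: "\<psi> w = \<alpha> * (exp (w + \<psi> w) - 1)" if "Re w \<le> 0" for w :: complex
    using fp(2)[OF that] by simp
  have Re: "Re (\<psi> w) \<le> 0" if "Re w \<le> 0" for w :: complex
  proof -
    have "Re (exp (w + \<psi> w)) \<le> 1"
      using complex_Re_le_cmod[of "exp (w + \<psi> w)"] fp(1)[OF that] by (simp add: order_trans)
    then have "\<alpha> * (Re (exp (w + \<psi> w)) - 1) \<le> 0" using alpha by (intro mult_nonneg_nonpos) auto
    then show ?thesis by (subst eq[OF that]) simp
  qed
  have lin: "norm (\<psi> w) \<le> m * norm w" if w: "Re w \<le> 0" for w :: complex
  proof -
    have "norm (\<psi> w) = \<alpha> * norm (exp (w + \<psi> w) - exp 0)"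
      using alpha by (subst eq[OF w]) (simp add: norm_mult)
    also have "\<dots> \<le> \<alpha> * norm (w + \<psi> w)"
      using norm_exp_diff_le[of "w + \<psi> w" 0] fp(1)[OF w] alpha by simp
    also have "\<dots> \<le> \<alpha> * (norm w + norm (\<psi> w))"
      using alpha norm_triangle_ineq by (intro mult_left_mono) auto
    finally have "(1 - \<alpha>) * norm (\<psi> w) \<le> \<alpha> * norm w" by (simp add: algebra_simps)
    then show ?thesis using alpha by (simp add: m_def field_simps)
  qed
  define E where "E = exp (1 + m) / 2"
  define B2 where "B2 = m / 2 * (1 + m)\<^sup>2 + m * E * (1 + m) ^ 3"
  define B3 where "B3 = m * E * (1 + m) ^ 3 + m / 2 * (B2 * (2 * (1 + m) + B2))"
  have E: "0 \<le> E" by (simp add: E_def)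
  then have B2: "0 \<le> B2" using m by (simp add: B2_def)
  then have "0 \<le> B3" using m E by (simp add: B3_def)
  note pos = E B2 this
  have main: "norm (\<psi> w - of_real m * w) \<le> B2 * (norm w)\<^sup>2 \<and>
      norm (\<psi> w - (of_real m * w + of_real (m * (1 + m)\<^sup>2 / 2) * w\<^sup>2)) \<le> B3 * norm w ^ 3"
    if w: "Re w \<le> 0" "norm w \<le> 1" for w :: complex
  proof -
    define v where "v = w + \<psi> w"
    define R where "R = exp v - (1 + v + v\<^sup>2 / 2)"
    have v: "norm v \<le> (1 + m) * norm w"
      using lin[OF w(1)] norm_triangle_ineq[of w "\<psi> w"] by (simp add: v_def algebra_simps)
    also have "\<dots> \<le> (1 + m) * 1" using w m by (intro mult_left_mono) auto
    finally have v1: "norm v \<le> 1 + m" by simp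
    have "norm R \<le> E * norm v ^ 3"
      using norm_exp_minus_quadratic[OF v1] by (simp add: R_def E_def)
    also have "\<dots> \<le> E * ((1 + m) * norm w) ^ 3"
      using pos v by (intro mult_left_mono power_mono) auto
    finally have R: "norm R \<le> E * (1 + m) ^ 3 * norm w ^ 3" by (simp add: power_mult_distrib)
    have "\<psi> w = \<alpha> * (v + v\<^sup>2 / 2 + R)"
      by (subst eq[OF w(1)]) (simp add: v_def[symmetric] R_def)
    then have "(1 - \<alpha>) * \<psi> w = \<alpha> * (w + v\<^sup>2 / 2 + R)" by (simp add: v_def algebra_simps)
    \<comment> \<open>As \<open>1 + m = 1 / (1 - \<alpha>)\<close>, this solves for the linear
      occurrence of \<open>\<psi> w\<close> inside \<open>v\<close>.\<close>
    then have "(1 + m) * ((1 - \<alpha>) * \<psi> w) = (1 + m) * (\<alpha> * (w + v\<^sup>2 / 2 + R))"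
      by simp
    then have "of_real ((1 - \<alpha>) * (1 + m)) * \<psi> w = of_real (\<alpha> * (1 + m)) * (w + v\<^sup>2 / 2 + R)"
      by (simp only: of_real_mult mult_ac)
    moreover have "(1 - \<alpha>) * (1 + m) = 1" "\<alpha> * (1 + m) = m"
      using alpha by (auto simp: m_def field_simps)
    ultimately have "\<psi> w = m * (w + v\<^sup>2 / 2 + R)"
      by (simp only: of_real_1 mult_1)
    then have psi: "\<psi> w = m * w + m / 2 * v\<^sup>2 + m * R"
      by (simp add: distrib_left)
    have "norm (\<psi> w - of_real m * w) = norm (m / 2 * v\<^sup>2 + m * R)" by (simp add: psi)
    also have "\<dots> \<le> norm (m / 2 * v\<^sup>2) + norm (m * R)" by (rule norm_triangle_ineq)
    also have "\<dots> = m / 2 * (norm v)\<^sup>2 + m * norm R"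
      using m by (simp add: norm_mult norm_power norm_divide)
    also have "\<dots> \<le> m / 2 * ((1 + m) * norm w)\<^sup>2 + m * (E * (1 + m) ^ 3 * norm w ^ 3)"
      using m v R by (intro add_mono mult_left_mono power_mono) auto
    also have "\<dots> \<le> m / 2 * ((1 + m) * norm w)\<^sup>2 + m * (E * (1 + m) ^ 3 * (norm w)\<^sup>2)"
    proof -
      have "norm w ^ 3 \<le> (norm w)\<^sup>2" using w(2) by (intro power_decreasing) auto
      then show ?thesis using m pos by (intro add_left_mono mult_left_mono) auto
    qed
    also have "\<dots> = B2 * (norm w)\<^sup>2" unfolding B2_def power_mult_distrib by (simp add: algebra_simps)
    finally have one: "norm (\<psi> w - of_real m * w) \<le> B2 * (norm w)\<^sup>2" .
    \<comment> \<open>Second pass: the first order estimate shows that \<open>v\<close> is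
      \<open>(1 + m) * w\<close> up to \<open>r = O(w^2)\<close>, which is now inserted into the
      quadratic term.\<close>
    define r where "r = \<psi> w - m * w"
    have v_r: "v = (1 + m) * w + r" by (simp add: v_def r_def algebra_simps)
    have "v\<^sup>2 - (1 + m)\<^sup>2 * w\<^sup>2 = r * (2 * (1 + m) * w + r)"
      by (simp add: v_r power2_eq_square algebra_simps)
    then have "norm (v\<^sup>2 - (1 + m)\<^sup>2 * w\<^sup>2) = norm r * norm (2 * (1 + m) * w + r)"
      by (simp only: norm_mult)
    also have "\<dots> \<le> (B2 * (norm w)\<^sup>2) * ((2 * (1 + m) + B2) * norm w)"
    proof (intro mult_mono)
      show "norm r \<le> B2 * (norm w)\<^sup>2" using one by (simp add: r_def)
      have "norm (2 * (1 + m) * w + r) \<le> norm (2 * (1 + m) * w) + norm r" by (rule norm_triangle_ineq)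
      also have "norm (2 * (1 + m) * w) = 2 * (1 + m) * norm w"
      proof -
        have "2 * (1 + m) * w = of_real (2 * (1 + m)) * w" by simp
        then show ?thesis using m by (simp only: norm_mult norm_of_real) simp
      qed
      also have "norm r \<le> B2 * norm w"
      proof -
        have "(norm w)\<^sup>2 \<le> norm w" using w(2) by (simp add: power2_eq_square mult_left_le)
        then have "B2 * (norm w)\<^sup>2 \<le> B2 * norm w" using pos by (intro mult_left_mono) auto
        then show ?thesis using one by (simp add: r_def)
      qed
      finally show "norm (2 * (1 + m) * w + r) \<le> (2 * (1 + m) + B2) * norm w"
        by (simp add: algebra_simps)
    qed (use pos in auto)
    finally have sq: "norm (v\<^sup>2 - (1 + m)\<^sup>2 * w\<^sup>2) \<le> B2 * (2 * (1 + m) + B2) * norm w ^ 3"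
      by (simp add: power2_eq_square power3_eq_cube mult_ac)
    have "\<psi> w - (of_real m * w + of_real (m * (1 + m)\<^sup>2 / 2) * w\<^sup>2) = m / 2 * (v\<^sup>2 - (1 + m)\<^sup>2 * w\<^sup>2) + m * R"
      by (subst psi) (simp add: algebra_simps)
    then have "norm (\<psi> w - (of_real m * w + of_real (m * (1 + m)\<^sup>2 / 2) * w\<^sup>2))
        \<le> norm (m / 2 * (v\<^sup>2 - (1 + m)\<^sup>2 * w\<^sup>2)) + norm (m * R)"
      by (simp only: norm_triangle_ineq)
    also have "\<dots> = m / 2 * norm (v\<^sup>2 - (1 + m)\<^sup>2 * w\<^sup>2) + m * norm R"
      using m by (simp add: norm_mult norm_divide)
    also have "\<dots> \<le> m / 2 * (B2 * (2 * (1 + m) + B2) * norm w ^ 3) + m * (E * (1 + m) ^ 3 * norm w ^ 3)"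
      using m sq R by (intro add_mono mult_left_mono) auto
    also have "\<dots> = B3 * norm w ^ 3" by (simp add: B3_def algebra_simps)
    finally show ?thesis using one by simp
  qed
  show thesis
  proof (rule that[of \<psi> "max B2 B3"])
    fix w :: complex assume w: "Re w \<le> 0" "norm w \<le> 1"
    have "B2 * (norm w)\<^sup>2 \<le> max B2 B3 * (norm w)\<^sup>2" "B3 * norm w ^ 3 \<le> max B2 B3 * norm w ^ 3"
      by (intro mult_right_mono; simp)+
    with main[OF w] show "norm (\<psi> w - of_real m * w) \<le> max B2 B3 * (norm w)\<^sup>2"
      "norm (\<psi> w - (of_real m * w + of_real (m * (1 + m)\<^sup>2 / 2) * w\<^sup>2)) \<le> max B2 B3 * norm w ^ 3"
      by linarith+
  qed (use fp eq Re lin pos in auto)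
qed

section \<open>Second order expansion of the cumulant of the departure times\<close>

text \<open>Let \<open>U\<close>, \<open>Psi\<close> and \<open>Q\<close> be the sums over
  \<open>k < n\<close> of \<open>u k\<close>, \<open>\<psi> (u k)\<close> and
  \<open>(u k)^2\<close>. Up to boundary terms the recursion gives
  \<open>U = n * \<epsilon> + h * Psi\<close>, the expansion of \<open>\<psi>\<close> gives
  \<open>Psi = m * U + v / 2 * Q\<close>, and \<open>Q\<close> is about
  \<open>n * K^2 * \<epsilon>^2\<close> because \<open>u k\<close> is \<open>\<epsilon>\<close>
  times the response to first order. Solving this linear system yields both coefficients. For
  \<open>\<epsilon>\<close> of order \<open>1 / sqrt n\<close> the error vanishes.\<close>

lemma cumulant_expansion:
  fixes h :: nat and \<psi> :: "complex \<Rightarrow> complex"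
  assumes m: "0 \<le> m" and mh: "m * real h < 1"
    and Re: "\<And>w::complex. Re w \<le> 0 \<Longrightarrow> Re (\<psi> w) \<le> 0"
    and lin: "\<And>w::complex. Re w \<le> 0 \<Longrightarrow> norm (\<psi> w) \<le> m * norm w"
    and quad: "\<And>w::complex. Re w \<le> 0 \<Longrightarrow> norm w \<le> 1 \<Longrightarrow> norm (\<psi> w - of_real m * w) \<le> B * (norm w)\<^sup>2"
    and cub: "\<And>w::complex. Re w \<le> 0 \<Longrightarrow> norm w \<le> 1 \<Longrightarrow>
       norm (\<psi> w - (of_real m * w + of_real (v / 2) * w\<^sup>2)) \<le> B * norm w ^ 3"
    and B: "0 \<le> B"
  defines "K \<equiv> 1 / (1 - m * real h)"
  obtains A where "\<And>(\<epsilon>::complex) u n. Re \<epsilon> \<le> 0 \<Longrightarrow> K * norm \<epsilon> \<le> 1 \<Longrightarrow>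
      (\<And>k. u k = \<epsilon> + (\<Sum>i=1..h. if i \<le> k then \<psi> (u (k - i)) else 0)) \<Longrightarrow>
      (\<forall>k. Re (u k) \<le> 0) \<and>
      norm ((\<Sum>k<n. u k + \<psi> (u k)) - of_nat n * (of_real ((1 + m) * K) * \<epsilon> + of_real ((1 + real h) * K ^ 3 * v / 2) * \<epsilon>\<^sup>2))
        \<le> A * (norm \<epsilon> + real n * norm \<epsilon> ^ 3)"
proof -
  note gain = gain[OF m mh, folded K_def]
  note response_bounds = response_bounds[OF m mh, folded K_def]
  note sum_response_square = sum_response_square[OF m mh, folded K_def]
  \<comment> \<open>The solution of \<open>h * B * K^2 + m * h * C = C\<close>, which closes the
    induction for \<open>diff\<close>.\<close>
  define C where "C = K * real h * B * K\<^sup>2"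
  define A1 where "A1 = (real h)\<^sup>2 * m * K"
  define A2 where "A2 = 2 * K * C"
  define A3 where "A3 = 2 * K * ((real h)\<^sup>2 * m * K\<^sup>2)"
  define A4 where "A4 = B * K ^ 3 + \<bar>v\<bar> / 2 * A2"
  define A where "A = (1 + real h) * K * (A1 * m + A4 + \<bar>v\<bar> / 2 * A3) + A1"
  show thesis
  proof (rule that[of A])
    fix \<epsilon> :: complex and u n
    assume eps: "Re \<epsilon> \<le> 0" "K * norm \<epsilon> \<le> 1"
      and u: "\<And>k. u k = \<epsilon> + (\<Sum>i=1..h. if i \<le> k then \<psi> (u (k - i)) else 0)"
    let ?e = "norm \<epsilon>"
    have e1: "?e \<le> 1" using eps(2) gain mult_right_mono[of 1 K ?e] by simp
    have window: "norm (\<Sum>i=1..h. if i \<le> k then f (k - i) else 0) \<le> real h * b"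
      if "\<And>j. j < k \<Longrightarrow> norm (f j) \<le> b" "0 \<le> b" for f :: "nat \<Rightarrow> complex" and b k
    proof -
      have "norm (\<Sum>i=1..h. if i \<le> k then f (k - i) else 0) \<le> (\<Sum>i=1..h. b)"
        using that by (intro sum_norm_le) auto
      then show ?thesis by simp
    qed
    have bound: "Re (u k) \<le> 0 \<and> norm (u k) \<le> K * ?e" for k
    proof (induction k rule: less_induct)
      case (less k)
      have "Re (\<Sum>i=1..h. if i \<le> k then \<psi> (u (k - i)) else 0) \<le> 0"
        unfolding Re_sum using less.IH Re by (intro sum_nonpos) auto
      then have 1: "Re (u k) \<le> 0" using u[of k] eps by simp
      have "norm (\<Sum>i=1..h. if i \<le> k then \<psi> (u (k - i)) else 0) \<le> real h * (m * (K * ?e))"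
      proof (rule window)
        fix j assume "j < k"
        then have "norm (\<psi> (u j)) \<le> m * norm (u j)" "norm (u j) \<le> K * ?e"
          using less.IH lin by auto
        then show "norm (\<psi> (u j)) \<le> m * (K * ?e)"
          using m by (meson mult_left_mono order_trans)
      qed (use m gain in auto)
      then have "norm (u k) \<le> ?e + real h * (m * (K * ?e))"
        using u[of k] norm_triangle_mono[of \<epsilon> ?e] by auto
      also have "\<dots> = (1 + m * real h * K) * ?e" by (simp add: algebra_simps)
      also have "\<dots> = K * ?e" by (simp only: gain)
      finally show ?case using 1 by simp
    qed
    have bound1: "norm (u k) \<le> 1" for k using bound[of k] eps by simp
    define P where "P = response m h"
    have diff: "norm (u k - \<epsilon> * P k) \<le> C * ?e\<^sup>2" for k
    proof (induction k rule: less_induct)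
      case (less k)
      have P: "P k = 1 + (\<Sum>i=1..h. if i \<le> k then m * P (k - i) else 0)"
        unfolding P_def by (rule response_eq)
      have "\<epsilon> * P k = \<epsilon> + (\<Sum>i=1..h. if i \<le> k then m * (\<epsilon> * P (k - i)) else 0)"
        by (subst P) (auto simp: algebra_simps sum_distrib_left if_distrib intro!: sum.cong)
      then have "u k - \<epsilon> * P k = (\<Sum>i=1..h. if i \<le> k then \<psi> (u (k - i)) - m * (\<epsilon> * P (k - i)) else 0)"
        by (subst u) (auto simp: sum_subtractf[symmetric] intro!: sum.cong)
      also have "norm \<dots> \<le> real h * (B * (K * ?e)\<^sup>2 + m * (C * ?e\<^sup>2))"
      proof (rule window[where f = "\<lambda>j. \<psi> (u j) - m * (\<epsilon> * P j)"])
        fix j assume j: "j < k"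
        have "\<psi> (u j) - m * (\<epsilon> * P j) = (\<psi> (u j) - m * u j) + m * (u j - \<epsilon> * P j)"
          by (simp add: algebra_simps)
        also have "norm \<dots> \<le> B * (K * ?e)\<^sup>2 + m * (C * ?e\<^sup>2)"
        proof (rule norm_triangle_mono)
          have "norm (\<psi> (u j) - m * u j) \<le> B * (norm (u j))\<^sup>2" using bound bound1 quad by simp
          also have "\<dots> \<le> B * (K * ?e)\<^sup>2" using bound B by (intro mult_left_mono power_mono) auto
          finally show "norm (\<psi> (u j) - m * u j) \<le> B * (K * ?e)\<^sup>2" .
          show "norm (m * (u j - \<epsilon> * P j)) \<le> m * (C * ?e\<^sup>2)"
            using less.IH[OF j] m by (simp add: norm_mult mult_left_mono)
        qed
        finally show "norm (\<psi> (u j) - m * (\<epsilon> * P j)) \<le> B * (K * ?e)\<^sup>2 + m * (C * ?e\<^sup>2)" .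
      qed (use m B gain in \<open>simp add: C_def\<close>)
      also have "\<dots> = (real h * B * K\<^sup>2 + m * real h * C) * ?e\<^sup>2"
        by (simp add: algebra_simps power_mult_distrib)
      also have "real h * B * K\<^sup>2 + m * real h * C = (1 + m * real h * K) * (real h * B * K\<^sup>2)"
        by (simp add: C_def algebra_simps)
      also have "\<dots> = C" by (simp only: gain) (simp add: C_def)
      finally show ?case .
    qed
    have C: "0 \<le> C" using gain B by (simp add: C_def)
    have square: "norm ((u k)\<^sup>2 - \<epsilon>\<^sup>2 * (P k)\<^sup>2) \<le> A2 * ?e ^ 3" for k
    proof -
      have "(u k)\<^sup>2 - \<epsilon>\<^sup>2 * (P k)\<^sup>2 = (u k - \<epsilon> * P k) * (u k + \<epsilon> * P k)"
        by (simp add: power2_eq_square algebra_simps)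
      then have "norm ((u k)\<^sup>2 - \<epsilon>\<^sup>2 * (P k)\<^sup>2) = norm (u k - \<epsilon> * P k) * norm (u k + \<epsilon> * P k)"
        by (simp only: norm_mult)
      also have "\<dots> \<le> (C * ?e\<^sup>2) * (K * ?e + K * ?e)"
      proof (intro mult_mono diff norm_triangle_mono)
        show "norm (\<epsilon> * P k) \<le> K * ?e"
          using response_bounds[of k] mult_left_mono[of "P k" K ?e] by (simp add: norm_mult P_def mult.commute)
      qed (use bound C in auto)
      finally show ?thesis by (simp add: A2_def power2_eq_square power3_eq_cube mult_ac)
    qed
    let ?U = "\<Sum>k<n. u k" and ?Psi = "\<Sum>k<n. \<psi> (u k)" and ?Q = "\<Sum>k<n. (u k)\<^sup>2"
    define E1 where "E1 = (\<Sum>k<n. \<Sum>i=1..h. if i \<le> k then \<psi> (u (k - i)) else 0) - real h *\<^sub>R ?Psi"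
    define E2 where "E2 = ?Psi - (m * ?U + v / 2 * ?Q)"
    define E3 where "E3 = ?Q - real n * K\<^sup>2 * \<epsilon>\<^sup>2"
    have E1: "norm E1 \<le> A1 * ?e"
    proof -
      have "norm E1 \<le> (real h)\<^sup>2 * (m * (K * ?e))"
        unfolding E1_def
      proof (rule sum_sum_window)
        fix l
        have "norm (\<psi> (u l)) \<le> m * norm (u l)" using bound lin by auto
        then show "norm (\<psi> (u l)) \<le> m * (K * ?e)"
          using m bound by (meson mult_left_mono order_trans)
      qed (use m gain in auto)
      then show ?thesis by (simp add: A1_def mult_ac)
    qed
    have E2: "norm E2 \<le> real n * (B * K ^ 3 * ?e ^ 3)"
    proof -
      have "E2 = (\<Sum>k<n. \<psi> (u k) - (m * u k + v / 2 * (u k)\<^sup>2))"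
        by (simp add: E2_def sum_subtractf sum.distrib sum_distrib_left)
      also have "norm \<dots> \<le> real (card {..<n}) * (B * K ^ 3 * ?e ^ 3)"
      proof (rule sum_norm_bound)
        fix k
        have "norm (\<psi> (u k) - (m * u k + v / 2 * (u k)\<^sup>2)) \<le> B * norm (u k) ^ 3"
          using bound bound1 cub[of "u k"] by simp
        also have "\<dots> \<le> B * (K * ?e) ^ 3" using bound B by (intro mult_left_mono power_mono) auto
        finally show "norm (\<psi> (u k) - (m * u k + v / 2 * (u k)\<^sup>2)) \<le> B * K ^ 3 * ?e ^ 3"
          by (simp add: power_mult_distrib)
      qed
      finally show ?thesis by simp
    qed
    have E3: "norm E3 \<le> real n * (A2 * ?e ^ 3) + A3 * ?e"
    proof -
      have "E3 = (\<Sum>k<n. (u k)\<^sup>2 - \<epsilon>\<^sup>2 * (P k)\<^sup>2) + \<epsilon>\<^sup>2 * of_real ((\<Sum>k<n. (P k)\<^sup>2) - real n * K\<^sup>2)"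
        by (simp add: E3_def sum_subtractf sum_distrib_left algebra_simps)
      also have "norm \<dots> \<le> real n * (A2 * ?e ^ 3) + A3 * ?e"
      proof (rule norm_triangle_mono)
        have "norm (\<Sum>k<n. (u k)\<^sup>2 - \<epsilon>\<^sup>2 * (P k)\<^sup>2) \<le> real (card {..<n}) * (A2 * ?e ^ 3)"
          by (rule sum_norm_bound) (rule square)
        then show "norm (\<Sum>k<n. (u k)\<^sup>2 - \<epsilon>\<^sup>2 * (P k)\<^sup>2) \<le> real n * (A2 * ?e ^ 3)" by simp
        have "norm (\<epsilon>\<^sup>2 * of_real ((\<Sum>k<n. (P k)\<^sup>2) - real n * K\<^sup>2))
            = ?e\<^sup>2 * \<bar>(\<Sum>k<n. (P k)\<^sup>2) - real n * K\<^sup>2\<bar>"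
          by (simp only: norm_mult norm_power norm_of_real)
        also have "\<dots> \<le> ?e * A3"
        proof (rule mult_mono)
          show "?e\<^sup>2 \<le> ?e" using e1 by (simp add: power2_eq_square mult_left_le)
          show "\<bar>(\<Sum>k<n. (P k)\<^sup>2) - real n * K\<^sup>2\<bar> \<le> A3"
            unfolding P_def A3_def by (rule sum_response_square)
        qed auto
        finally show "norm (\<epsilon>\<^sup>2 * of_real ((\<Sum>k<n. (P k)\<^sup>2) - real n * K\<^sup>2)) \<le> A3 * ?e"
          by (simp add: mult.commute)
      qed
      finally show ?thesis .
    qed
    have U: "?U = real n * \<epsilon> + real h * ?Psi + E1"
    proof -
      have "?U = (\<Sum>k<n. \<epsilon> + (\<Sum>i=1..h. if i \<le> k then \<psi> (u (k - i)) else 0))"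
        by (intro sum.cong refl u)
      then show ?thesis by (simp add: E1_def sum.distrib scaleR_conv_of_real)
    qed
    have Psi: "?Psi = m * ?U + v / 2 * (real n * K\<^sup>2 * \<epsilon>\<^sup>2) + v / 2 * E3 + E2"
      by (simp add: E2_def E3_def algebra_simps)
    have K1: "of_real (1 - m * real h) * of_real K = (1::complex)"
      unfolding of_real_mult[symmetric] using mh by (simp add: K_def)
    define F where "F = m * E1 + v / 2 * E3 + E2"
    have "of_real (1 - m * real h) * ?Psi = m * (real n * \<epsilon>) + v / 2 * (real n * K\<^sup>2 * \<epsilon>\<^sup>2) + F"
    proof -
      have "?Psi = m * (real n * \<epsilon> + real h * ?Psi + E1) + v / 2 * (real n * K\<^sup>2 * \<epsilon>\<^sup>2) + v / 2 * E3 + E2"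
        using Psi unfolding U .
      then show ?thesis by (simp add: F_def algebra_simps)
    qed
    then have "?Psi = K * (m * (real n * \<epsilon>) + v / 2 * (real n * K\<^sup>2 * \<epsilon>\<^sup>2) + F)"
      using K1 by (metis mult.assoc mult.commute mult_1)
    moreover have "(\<Sum>k<n. u k + \<psi> (u k)) = real n * \<epsilon> + (1 + real h) * ?Psi + E1"
      by (simp add: sum.distrib U algebra_simps)
    ultimately have "(\<Sum>k<n. u k + \<psi> (u k)) - of_nat n * (of_real ((1 + m) * K) * \<epsilon> + of_real ((1 + real h) * K ^ 3 * v / 2) * \<epsilon>\<^sup>2)
        = real n * \<epsilon> * (of_real (1 + (1 + real h) * (m * K)) - of_real ((1 + m) * K)) + ((1 + real h) * K * F + E1)"
      by (simp add: algebra_simps power2_eq_square power3_eq_cube)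
    moreover have "1 + (1 + real h) * (m * K) = (1 + m) * K"
      using mh by (simp add: K_def field_simps)
    ultimately have "(\<Sum>k<n. u k + \<psi> (u k)) - of_nat n * (of_real ((1 + m) * K) * \<epsilon> + of_real ((1 + real h) * K ^ 3 * v / 2) * \<epsilon>\<^sup>2)
        = (1 + real h) * K * F + E1"
      by simp
    moreover have "norm ((1 + real h) * K * F + E1) \<le> A * (?e + real n * ?e ^ 3)"
    proof -
      let ?N = "?e + real n * ?e ^ 3"
      have N: "?e \<le> ?N" "real n * ?e ^ 3 \<le> ?N" "0 \<le> ?N" by auto
      have A: "0 \<le> A1" "0 \<le> A2" "0 \<le> A3" using m gain C by (simp_all add: A1_def A2_def A3_def)
      have "norm F \<le> m * (A1 * ?e) + \<bar>v\<bar> / 2 * (real n * (A2 * ?e ^ 3) + A3 * ?e) + real n * (B * K ^ 3 * ?e ^ 3)"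
        unfolding F_def
        using E1 E2 E3 m
        by (intro norm_triangle_mono) (auto simp: norm_mult norm_divide intro!: mult_left_mono)
      also have "\<dots> = (m * A1 + \<bar>v\<bar> / 2 * A3) * ?e + A4 * (real n * ?e ^ 3)"
        by (simp add: A4_def algebra_simps)
      also have "\<dots> \<le> (m * A1 + \<bar>v\<bar> / 2 * A3) * ?N + A4 * ?N"
        using N A m B gain by (intro add_mono mult_left_mono) (auto simp: A4_def)
      finally have F: "norm F \<le> (A1 * m + A4 + \<bar>v\<bar> / 2 * A3) * ?N" by (simp add: algebra_simps)
      have "norm ((1 + real h) * K * F + E1) \<le> (1 + real h) * K * ((A1 * m + A4 + \<bar>v\<bar> / 2 * A3) * ?N) + A1 * ?N"
      proof (rule norm_triangle_mono)
        have "(1 + real h) * K * F = of_real ((1 + real h) * K) * F" by simp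
        then have "norm ((1 + real h) * K * F) = (1 + real h) * K * norm F"
          using gain by (simp only: norm_mult norm_of_real) simp
        then show "norm ((1 + real h) * K * F) \<le> (1 + real h) * K * ((A1 * m + A4 + \<bar>v\<bar> / 2 * A3) * ?N)"
          using F gain by (simp add: mult_left_mono)
        show "norm E1 \<le> A1 * ?N"
          using E1 N A by (meson mult_left_mono order_trans)
      qed
      also have "\<dots> = A * ?N" unfolding A_def by (simp only: distrib_right mult.assoc)
      finally show ?thesis .
    qed
    ultimately show "(\<forall>k. Re (u k) \<le> 0) \<and>
      norm ((\<Sum>k<n. u k + \<psi> (u k)) - of_nat n * (of_real ((1 + m) * K) * \<epsilon> + of_real ((1 + real h) * K ^ 3 * v / 2) * \<epsilon>\<^sup>2))
        \<le> A * (norm \<epsilon> + real n * norm \<epsilon> ^ 3)"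
      using bound by simp
  qed
qed

section \<open>Strong law and central limit theorem in the subcritical case\<close>

text \<open>Markov's inequality at level 1 followed by Borel-Cantelli; all almost sure bounds below
  enter through an exponential \<open>f\<close>.\<close>

lemma (in prob_space) AE_eventually_less_1:
  fixes f :: "nat \<Rightarrow> 'a \<Rightarrow> real"
  assumes f[measurable]: "\<And>n. f n \<in> borel_measurable M"
    and le: "\<And>n. n \<ge> n0 \<Longrightarrow> (\<integral>\<^sup>+\<omega>. ennreal (f n \<omega>) \<partial>M) \<le> ennreal (a n)"
    and a: "summable a" "\<And>n. 0 \<le> a n"
  shows "AE \<omega> in M. eventually (\<lambda>n. f n \<omega> < 1) sequentially"
proof -
  let ?A = "\<lambda>n. {\<omega> \<in> space M. 1 \<le> f n \<omega>}"
  have le_a: "emeasure M (?A n) \<le> ennreal (a n)" if "n \<ge> n0" for n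
  proof -
    have "emeasure M (?A n) = (\<integral>\<^sup>+\<omega>. indicator (?A n) \<omega> \<partial>M)"
      by (subst nn_integral_indicator) auto
    also have "\<dots> \<le> (\<integral>\<^sup>+\<omega>. ennreal (f n \<omega>) \<partial>M)"
      by (intro nn_integral_mono) (auto simp: indicator_def)
    finally show ?thesis using le[OF that] by simp
  qed
  have "norm (measure M (?A n)) \<le> a n" if "n \<ge> n0" for n
    using le_a[OF that] a(2)[of n]
    by (simp add: emeasure_eq_measure)
  then have "summable (\<lambda>n. measure M (?A n))"
    by (intro summable_comparison_test'[OF a(1)]) auto
  then have "AE \<omega> in M. eventually (\<lambda>n. \<omega> \<in> space M - ?A n) sequentially"
    by (intro borel_cantelli_AE1) (auto simp: emeasure_eq_measure)
  then show ?thesis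
    by eventually_elim (auto elim!: eventually_mono)
qed

lemma char_normal_density:
  assumes "0 < \<sigma>"
  shows "char (density lborel (normal_density 0 \<sigma>)) t = exp (- (\<sigma>\<^sup>2 * t\<^sup>2 / 2))"
proof -
  interpret S: prob_space std_normal_distribution
    by (rule prob_space_normal_density) simp
  have "distributed std_normal_distribution lborel (\<lambda>x. x) std_normal_density"
    by (simp add: distributed_def distr_id2)
  from S.normal_density_affine[OF this, of \<sigma> 0] assms
  have "distributed std_normal_distribution lborel (\<lambda>x. \<sigma> * x) (normal_density 0 \<sigma>)"
    by simp
  then have "density lborel (normal_density 0 \<sigma>) = distr std_normal_distribution lborel (\<lambda>x. \<sigma> * x)"
    by (simp add: distributed_def)
  then have "char (density lborel (normal_density 0 \<sigma>)) t = char std_normal_distribution (\<sigma> * t)"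
    by (simp add: char_def integral_distr mult_ac)
  then show ?thesis
    by (simp add: char_std_normal_distribution power_mult_distrib)
qed

section \<open>The transforms with stations counted backward from \<open>n\<close>\<close>

context bus_line
begin

lemma sum_reverse: "(\<Sum>j=1..n. g (n - j)) = (\<Sum>k<n. g k)" for g :: "nat \<Rightarrow> 'b::comm_monoid_add"
  by (rule sum.reindex_bij_witness[of _ "\<lambda>k. n - k" "\<lambda>j. n - j"]) auto

lemma backward_reindex:
  fixes g :: "nat \<Rightarrow> 'b::comm_monoid_add"
  assumes "1 \<le> j" "j \<le> n"
  shows "(\<Sum>l<n - j. if (n - l) - d (n - l) < n - (n - j) then g l else 0)
    = (\<Sum>i\<in>{j<..n}. if i - d i < j then g (n - i) else 0)"
  by (rule sum.reindex_bij_witness[of _ "\<lambda>i. n - i" "\<lambda>l. n - l"]) (use assms in auto)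

lemma nn_integral_exp_backward:
  assumes "\<And>k. k < n \<Longrightarrow> log_mgf_le (b k) (q k)"
    and b: "\<And>k. k < n \<Longrightarrow> b k = z (n - k) + (\<Sum>l<k. if (n - l) - d (n - l) < n - k then q l else 0)"
  shows "(\<integral>\<^sup>+\<omega>. ennreal (exp (\<Sum>j=1..n. z j * inc j \<omega>)) \<partial>M) \<le> ennreal (exp (\<tau> * (\<Sum>k<n. b k + q k)))"
  unfolding sum_reverse[symmetric, of "\<lambda>k. b k + q k" n]
proof (rule nn_integral_exp_linear)
  fix j assume j: "1 \<le> j" "j \<le> n"
  then show "log_mgf_le (b (n - j)) (q (n - j))" using assms(1) by simp
  have "b (n - j) = z (n - (n - j)) + (\<Sum>l<n - j. if (n - l) - d (n - l) < n - (n - j) then q l else 0)"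
    using j by (intro b) simp
  then show "b (n - j) = z j + (\<Sum>i\<in>{j<..n}. if i - d i < j then q (n - i) else 0)"
    unfolding backward_reindex[OF j] using j by simp
qed

lemma integral_exp_backward:
  fixes b q z :: "nat \<Rightarrow> complex"
  assumes "\<And>k. k < n \<Longrightarrow> Re (b k) \<le> 0 \<and> Re (b k + q k) \<le> 0 \<and> q k = \<alpha> * (exp (b k + q k) - 1)"
    and b: "\<And>k. k < n \<Longrightarrow> b k = z (n - k) + (\<Sum>l<k. if (n - l) - d (n - l) < n - k then q l else 0)"
    and z: "\<And>j. Re (z j) \<le> 0"
  shows "(\<integral>\<omega>. exp (\<Sum>j=1..n. z j * inc j \<omega>) \<partial>M) = exp (\<tau> * (\<Sum>k<n. b k + q k))"
  unfolding sum_reverse[symmetric, of "\<lambda>k. b k + q k" n]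
proof (rule integral_exp_linear)
  fix j assume j: "1 \<le> j" "j \<le> n"
  then show "Re (b (n - j)) \<le> 0 \<and> Re (b (n - j) + q (n - j)) \<le> 0
      \<and> q (n - j) = \<alpha> * (exp (b (n - j) + q (n - j)) - 1)" using assms(1)[of "n - j"] by simp
  have "b (n - j) = z (n - (n - j)) + (\<Sum>l<n - j. if (n - l) - d (n - l) < n - (n - j) then q l else 0)"
    using j by (intro b) simp
  then show "b (n - j) = z j + (\<Sum>i\<in>{j<..n}. if i - d i < j then q (n - i) else 0)"
    unfolding backward_reindex[OF j] using j by simp
qed (rule z)

lemma sum_inc_eq_D: "(\<Sum>j=1..n. inc j \<omega>) = D n \<omega>"
proof -
  have "{1..n} = {0<..n}" by auto
  then show ?thesis using sum_inc[of 0 n \<omega>] by (simp add: D_0)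
qed

end

section \<open>Subcritical windows of fixed length\<close>

locale fixed_window = bus_line +
  fixes h :: nat
  assumes d_eq: "\<And>n. 1 \<le> n \<Longrightarrow> d n = min (Suc h) n"
    and subcritical: "m * real h < 1"
begin

text \<open>Early stations, whose window reaches back to station 0, obey the same rule because
  \<open>n - k\<close> is positive. Hence the backward recursion has the same form for every
  \<open>n\<close>.\<close>

lemma window_iff:
  assumes "l < k" "k < n"
  shows "(n - l) - d (n - l) < n - k \<longleftrightarrow> k - l \<le> h"
  using assms by (auto simp: d_eq min_def)

lemma window_sum_eq:
  fixes q :: "nat \<Rightarrow> 'b::comm_monoid_add"
  assumes "k < n"
  shows "(\<Sum>l<k. if (n - l) - d (n - l) < n - k then q l else 0) = (\<Sum>i=1..h. if i \<le> k then q (k - i) else 0)"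
  unfolding sum_window[symmetric] using assms by (intro sum.cong if_cong window_iff refl) auto

text \<open>The solution of the balance equation
  \<open>c = \<tau> + \<mu> * (\<tau> + h * c)\<close>: travel time plus \<open>\<mu>\<close> times
  the length of a window made of \<open>\<tau>\<close> and \<open>h\<close> increments.\<close>

definition speed :: "real \<Rightarrow> real" where
  "speed \<mu> = \<tau> * (1 + \<mu>) / (1 - \<mu> * real h)"

text \<open>If the line of slope \<open>\<mu>\<close> dominates the cumulant at all weights that
  occur, then \<open>x * response \<mu> h k\<close> solves the backward recursion with that line.
  These weights lie between \<open>x\<close> and \<open>x\<close> times the gain, whence the range
  of \<open>y\<close>. The sign of \<open>x\<close> selects the upper or the lower tail.\<close>

lemma exponential_tail:
  assumes mu: "0 \<le> \<mu>" "\<mu> * real h < 1" and "x \<noteq> 0" "0 < \<delta>"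
    and mgf: "\<And>y. 1 \<le> y \<Longrightarrow> y \<le> 1 / (1 - \<mu> * real h) \<Longrightarrow> log_mgf_le (x * y) (\<mu> * (x * y))"
  shows "AE \<omega> in M. eventually (\<lambda>n. x * D n \<omega> < x * speed \<mu> * real n + \<delta> * real n) sequentially"
proof -
  let ?K = "1 / (1 - \<mu> * real h)" and ?P = "response \<mu> h"
  define c0 where "c0 = (real h)\<^sup>2 * \<mu> * ?K\<^sup>2"
  define A where "A = exp (\<bar>x\<bar> * (\<tau> * (1 + \<mu>) * c0))"
  let ?f = "\<lambda>n \<omega>. exp (x * D n \<omega> - (x * speed \<mu> * real n + \<delta> * real n))"
  have "AE \<omega> in M. eventually (\<lambda>n. ?f n \<omega> < 1) sequentially"
  proof (rule AE_eventually_less_1)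
    show "(\<integral>\<^sup>+\<omega>. ennreal (?f n \<omega>) \<partial>M) \<le> ennreal (A * exp (- \<delta>) ^ n)" for n
    proof -
      have mgf_D: "(\<integral>\<^sup>+\<omega>. ennreal (exp (\<Sum>j=1..n. x * inc j \<omega>)) \<partial>M)
          \<le> ennreal (exp (\<tau> * (\<Sum>k<n. x * ?P k + \<mu> * (x * ?P k))))"
      proof (rule nn_integral_exp_backward[where z = "\<lambda>_. x"])
        fix k assume k: "k < n"
        show "log_mgf_le (x * ?P k) (\<mu> * (x * ?P k))"
          using response_bounds[OF mu, of k] by (intro mgf) auto
        have "x * ?P k = x + (\<Sum>i=1..h. if i \<le> k then \<mu> * (x * ?P (k - i)) else 0)"
          by (subst response_eq) (auto simp: algebra_simps sum_distrib_left intro!: sum.cong)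
        then show "x * ?P k = x + (\<Sum>l<k. if (n - l) - d (n - l) < n - k then \<mu> * (x * ?P l) else 0)"
          by (simp only: window_sum_eq[OF k])
      qed
      have "(\<integral>\<^sup>+\<omega>. ennreal (?f n \<omega>) \<partial>M)
          = (\<integral>\<^sup>+\<omega>. ennreal (exp (\<Sum>j=1..n. x * inc j \<omega>)) * ennreal (exp (- (x * speed \<mu> * real n + \<delta> * real n))) \<partial>M)"
        by (intro nn_integral_cong)
           (simp add: sum_distrib_left[symmetric] sum_inc_eq_D[simplified] ennreal_mult'[symmetric] exp_add[symmetric] del: minus_add_distrib)
      also have "\<dots> = (\<integral>\<^sup>+\<omega>. ennreal (exp (\<Sum>j=1..n. x * inc j \<omega>)) \<partial>M) * ennreal (exp (- (x * speed \<mu> * real n + \<delta> * real n)))"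
        by (rule nn_integral_multc) measurable
      also have "\<dots> \<le> ennreal (exp (\<tau> * (\<Sum>k<n. x * ?P k + \<mu> * (x * ?P k)))) * ennreal (exp (- (x * speed \<mu> * real n + \<delta> * real n)))"
        by (intro mult_right_mono mgf_D) simp
      also have "\<dots> = ennreal (exp (\<tau> * (\<Sum>k<n. x * ?P k + \<mu> * (x * ?P k)) - (x * speed \<mu> * real n + \<delta> * real n)))"
        by (simp add: ennreal_mult'[symmetric] exp_add[symmetric])
      also have "\<tau> * (\<Sum>k<n. x * ?P k + \<mu> * (x * ?P k)) - (x * speed \<mu> * real n + \<delta> * real n)
          = x * (\<tau> * (1 + \<mu>) * ((\<Sum>k<n. ?P k) - real n * ?K)) - \<delta> * real n"
        by (simp add: speed_def sum.distrib sum_distrib_left[symmetric] algebra_simps)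
      also have "\<dots> \<le> \<bar>x\<bar> * (\<tau> * (1 + \<mu>) * c0) - \<delta> * real n"
      proof -
        have "x * (\<tau> * (1 + \<mu>) * ((\<Sum>k<n. ?P k) - real n * ?K)) \<le> \<bar>x * (\<tau> * (1 + \<mu>) * ((\<Sum>k<n. ?P k) - real n * ?K))\<bar>"
          by (rule abs_ge_self)
        also have "\<dots> = \<bar>x\<bar> * (\<tau> * (1 + \<mu>) * \<bar>(\<Sum>k<n. ?P k) - real n * ?K\<bar>)"
          using tau mu by (simp add: abs_mult)
        also have "\<dots> \<le> \<bar>x\<bar> * (\<tau> * (1 + \<mu>) * c0)"
          using sum_response[OF mu, of n] tau mu
          by (intro mult_left_mono) (auto simp: c0_def)
        finally show ?thesis by simp
      qed
      also have "exp (\<bar>x\<bar> * (\<tau> * (1 + \<mu>) * c0) - \<delta> * real n) = A * exp (- \<delta>) ^ n"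
        by (simp add: A_def exp_diff exp_minus exp_of_nat_mult[symmetric] power_inverse field_simps)
      finally show ?thesis by (simp add: ennreal_leI)
    qed
    show "summable (\<lambda>n. A * exp (- \<delta>) ^ n)"
      using \<open>0 < \<delta>\<close> by (intro summable_mult summable_geometric) simp
    show "0 \<le> A * exp (- \<delta>) ^ n" for n by (simp add: A_def)
  qed measurable
  then show ?thesis
    by eventually_elim (auto elim!: eventually_mono)
qed

lemma continuous_speed: "isCont speed m"
  unfolding speed_def[abs_def] using subcritical by (intro continuous_intros) auto

text \<open>The sign \<open>\<sigma>\<close> treats both tails at once: where
  \<open>\<sigma> * (\<mu> - m) > 0\<close>, the parabola bounding the cumulant lies below the line
  of slope \<open>\<mu>\<close> near 0 on the side of \<open>\<sigma>\<close>.\<close>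

lemma AE_one_sided_bound:
  assumes mu: "0 \<le> \<mu>" "\<mu> * real h < 1" and sign: "\<sigma>\<^sup>2 = 1" "0 < \<sigma> * (\<mu> - m)" and "0 < \<epsilon>"
  shows "AE \<omega> in M. eventually (\<lambda>n. \<sigma> * D n \<omega> < (\<sigma> * speed \<mu> + \<epsilon>) * real n) sequentially"
proof -
  obtain C x0 where C: "0 < C" "0 < x0" "\<And>x. \<bar>x\<bar> \<le> x0 \<Longrightarrow> log_mgf_le x (m * x + C * x\<^sup>2)"
    by (rule log_mgf_quadratic) blast
  have abs_sign: "\<bar>\<sigma>\<bar> = 1" using sign(1) by (auto simp: power2_eq_1_iff)
  let ?K = "1 / (1 - \<mu> * real h)"
  \<comment> \<open>Division by the gain \<open>?K\<close> keeps \<open>x * y\<close> in the good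
    range for every \<open>y \<le> ?K\<close>; the second entry of the minimum gives
    \<open>C * (x * y)^2 \<le> \<sigma> * (\<mu> - m) * (x * y)\<close>.\<close>
  define x where "x = min x0 (\<sigma> * (\<mu> - m) / C) / ?K"
  have K: "0 < ?K" using mu by simp
  have x: "0 < x" using C sign K by (simp add: x_def)
  have "AE \<omega> in M. eventually (\<lambda>n. (\<sigma> * x) * D n \<omega> < (\<sigma> * x) * speed \<mu> * real n + (x * \<epsilon>) * real n) sequentially"
  proof (rule exponential_tail)
    fix y assume y: "1 \<le> y" "y \<le> ?K"
    have "x * y \<le> x * ?K" using y x by (intro mult_left_mono) auto
    also have "\<dots> = min x0 (\<sigma> * (\<mu> - m) / C)"
      unfolding x_def using K by (intro nonzero_eq_divide_eq[THEN iffD1] refl) auto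
    finally have xy: "x * y \<le> x0" "x * y \<le> \<sigma> * (\<mu> - m) / C" "0 \<le> x * y" using x y by auto
    have "log_mgf_le (\<sigma> * x * y) (m * (\<sigma> * x * y) + C * (\<sigma> * x * y)\<^sup>2)"
      using xy abs_sign by (intro C(3)) (simp add: abs_mult mult.assoc)
    moreover have "m * (\<sigma> * x * y) + C * (\<sigma> * x * y)\<^sup>2 \<le> \<mu> * (\<sigma> * x * y)"
    proof -
      have "C * (x * y) \<le> \<sigma> * (\<mu> - m)" using xy(2) C by (simp add: field_simps)
      from mult_right_mono[OF this xy(3)] have "C * (x * y)\<^sup>2 \<le> \<sigma> * (\<mu> - m) * (x * y)"
        by (simp add: power2_eq_square mult.assoc)
      then show ?thesis
        unfolding power_mult_distrib sign(1) by (simp add: algebra_simps)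
    qed
    ultimately show "log_mgf_le (\<sigma> * x * y) (\<mu> * (\<sigma> * x * y))" by (rule log_mgf_le_mono[OF _ order_refl])
  qed (use mu x abs_sign assms(5) in auto)
  then show ?thesis
  proof eventually_elim
    case (elim \<omega>)
    then show ?case
    proof eventually_elim
      case (elim n)
      then have "x * (\<sigma> * D n \<omega>) < x * ((\<sigma> * speed \<mu> + \<epsilon>) * real n)" by (simp add: algebra_simps)
      then show ?case using x by simp
    qed
  qed
qed

lemma AE_speed_upper:
  assumes "0 < \<epsilon>"
  shows "AE \<omega> in M. eventually (\<lambda>n. D n \<omega> < (speed m + \<epsilon>) * real n) sequentially"
proof -
  have "eventually (\<lambda>\<mu>. speed \<mu> < speed m + \<epsilon> / 2 \<and> \<mu> * real h < 1) (at_right m)"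
  proof (intro eventually_conj)
    have "(speed \<longlongrightarrow> speed m) (at_right m)"
      using continuous_speed by (auto simp: isCont_def intro: tendsto_within_subset)
    then show "eventually (\<lambda>\<mu>. speed \<mu> < speed m + \<epsilon> / 2) (at_right m)"
      by (rule order_tendstoD) (use assms in simp)
    have "((\<lambda>\<mu>. \<mu> * real h) \<longlongrightarrow> m * real h) (at_right m)" by (intro tendsto_intros)
    then show "eventually (\<lambda>\<mu>. \<mu> * real h < 1) (at_right m)"
      by (rule order_tendstoD) (rule subcritical)
  qed
  then have "eventually (\<lambda>\<mu>. speed \<mu> < speed m + \<epsilon> / 2 \<and> \<mu> * real h < 1 \<and> m < \<mu>) (at_right m)"
    using eventually_at_right_less[of m] by eventually_elim auto
  then obtain \<mu> where mu: "speed \<mu> < speed m + \<epsilon> / 2" "\<mu> * real h < 1" "m < \<mu>"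
    using eventually_happens'[of "at_right m"] by (auto simp: trivial_limit_at_right_real)
  have "AE \<omega> in M. eventually (\<lambda>n. 1 * D n \<omega> < (1 * speed \<mu> + \<epsilon> / 2) * real n) sequentially"
    using mu m_pos assms by (intro AE_one_sided_bound) auto
  then show ?thesis
  proof eventually_elim
    case (elim \<omega>)
    then show ?case
    proof eventually_elim
      case (elim n)
      then have "D n \<omega> < (speed \<mu> + \<epsilon> / 2) * real n" by simp
      also have "\<dots> \<le> (speed m + \<epsilon>) * real n" using mu by (intro mult_right_mono) auto
      finally show ?case .
    qed
  qed
qed

lemma AE_speed_lower:
  assumes "0 < \<epsilon>"
  shows "AE \<omega> in M. eventually (\<lambda>n. (speed m - \<epsilon>) * real n < D n \<omega>) sequentially"
proof -
  have "eventually (\<lambda>\<mu>. speed m - \<epsilon> / 2 < speed \<mu> \<and> 0 < \<mu>) (at_left m)"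
  proof (intro eventually_conj)
    have "(speed \<longlongrightarrow> speed m) (at_left m)"
      using continuous_speed by (auto simp: isCont_def intro: tendsto_within_subset)
    then show "eventually (\<lambda>\<mu>. speed m - \<epsilon> / 2 < speed \<mu>) (at_left m)"
      by (rule order_tendstoD) (use assms in simp)
    show "eventually (\<lambda>\<mu>. 0 < \<mu>) (at_left m)"
      using m_pos by (rule order_tendstoD(1)[OF tendsto_ident_at])
  qed
  moreover have "eventually (\<lambda>\<mu>. \<mu> \<in> {m - 1<..<m}) (at_left m)"
    by (rule eventually_at_left_real) simp
  ultimately have "eventually (\<lambda>\<mu>. speed m - \<epsilon> / 2 < speed \<mu> \<and> 0 < \<mu> \<and> \<mu> < m) (at_left m)"
    by eventually_elim auto
  then obtain \<mu> where mu: "speed m - \<epsilon> / 2 < speed \<mu>" "0 < \<mu>" "\<mu> < m"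
    using eventually_happens'[of "at_left m"] by (auto simp: trivial_limit_at_left_real)
  have muh: "\<mu> * real h < 1"
    using mult_right_mono[of \<mu> m "real h"] mu subcritical by linarith
  have "AE \<omega> in M. eventually (\<lambda>n. (- 1) * D n \<omega> < ((- 1) * speed \<mu> + \<epsilon> / 2) * real n) sequentially"
    using mu muh assms by (intro AE_one_sided_bound) auto
  then show ?thesis
  proof eventually_elim
    case (elim \<omega>)
    then show ?case
    proof eventually_elim
      case (elim n)
      then have "(speed \<mu> - \<epsilon> / 2) * real n < D n \<omega>" by (simp add: algebra_simps)
      moreover have "(speed m - \<epsilon>) * real n \<le> (speed \<mu> - \<epsilon> / 2) * real n"
        using mu by (intro mult_right_mono) auto
      ultimately show ?case by simp
    qed
  qed
qed

lemma speed_gt: "\<tau> < speed m"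
proof -
  have "0 < \<tau> * (m * (1 + real h))" using m_pos tau by simp
  then have "\<tau> * (1 - m * real h) < \<tau> * (1 + m)" by (simp add: algebra_simps)
  then show ?thesis using subcritical by (simp add: speed_def field_simps)
qed

theorem strong_law: "AE \<omega> in M. (\<lambda>n. D n \<omega> / (speed m * real n)) \<longlonglongrightarrow> 1"
proof -
  let ?c = "speed m"
  have c: "0 < ?c" using speed_gt tau by simp
  have "AE \<omega> in M. \<forall>i. eventually (\<lambda>n. D n \<omega> < (?c + inverse (Suc i)) * real n \<and> (?c - inverse (Suc i)) * real n < D n \<omega>) sequentially"
    unfolding AE_all_countable
  proof
    fix i
    show "AE \<omega> in M. eventually (\<lambda>n. D n \<omega> < (?c + inverse (Suc i)) * real n \<and> (?c - inverse (Suc i)) * real n < D n \<omega>) sequentially"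
      using AE_speed_upper[of "inverse (Suc i)"] AE_speed_lower[of "inverse (Suc i)"]
      by (simp add: eventually_conj_iff)
  qed
  then show ?thesis
  proof eventually_elim
    case (elim \<omega>)
    have "(\<lambda>n. D n \<omega> / real n) \<longlonglongrightarrow> ?c"
    proof (rule tendstoI)
      fix e :: real assume "0 < e"
      then obtain i where i: "inverse (real (Suc i)) < e" using reals_Archimedean by blast
      have "eventually (\<lambda>n. D n \<omega> < (?c + inverse (Suc i)) * real n \<and> (?c - inverse (Suc i)) * real n < D n \<omega>) sequentially"
        using elim by blast
      then show "eventually (\<lambda>n. dist (D n \<omega> / real n) ?c < e) sequentially"
        using eventually_gt_at_top[of 0]
      proof eventually_elim
        case (elim n)
        then have "D n \<omega> / real n < ?c + inverse (Suc i)" "?c - inverse (Suc i) < D n \<omega> / real n"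
          by (simp_all add: field_simps)
        with i show ?case by (simp add: dist_real_def abs_less_iff)
      qed
    qed
    from tendsto_divide[OF this tendsto_const[of ?c]] c show ?case by (simp add: mult.commute)
  qed
qed

theorem central_limit:
  obtains \<sigma> where "0 < \<sigma>"
    "weak_conv_m (\<lambda>n. distr M borel (\<lambda>\<omega>. (D n \<omega> - real n * speed m) / sqrt (real n)))
       (density lborel (normal_density 0 \<sigma>))"
proof -
  define K where "K = 1 / (1 - m * real h)"
  define v where "v = m * (1 + m)\<^sup>2"
  \<comment> \<open>Chosen so that \<open>\<tau>\<close> times the quadratic coefficient of
    \<open>cumulant_expansion\<close>, times \<open>n * \<epsilon>^2 = - t^2\<close>, is
    \<open>- \<sigma>^2 * t^2 / 2\<close>.\<close>
  define \<sigma> where "\<sigma> = sqrt (\<tau> * (1 + real h) * K ^ 3 * v)"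
  have K: "0 < K" using subcritical by (simp add: K_def)
  have speed: "speed m = \<tau> * (1 + m) * K" by (simp add: speed_def K_def)
  have s2: "0 < \<tau> * (1 + real h) * K ^ 3 * v"
    using K tau m_pos by (simp add: v_def)
  then have s: "0 < \<sigma>" by (simp add: \<sigma>_def)
  obtain \<psi> :: "complex \<Rightarrow> complex" and B
    where psi: "\<And>w::complex. Re w \<le> 0 \<Longrightarrow> \<psi> w = \<alpha> * (exp (w + \<psi> w) - 1)"
    "\<And>w::complex. Re w \<le> 0 \<Longrightarrow> Re (w + \<psi> w) \<le> 0"
    "\<And>w::complex. Re w \<le> 0 \<Longrightarrow> Re (\<psi> w) \<le> 0"
    "\<And>w::complex. Re w \<le> 0 \<Longrightarrow> norm (\<psi> w) \<le> m * norm w"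
    "\<And>w::complex. Re w \<le> 0 \<Longrightarrow> norm w \<le> 1 \<Longrightarrow> norm (\<psi> w - of_real m * w) \<le> B * (norm w)\<^sup>2"
    "\<And>w::complex. Re w \<le> 0 \<Longrightarrow> norm w \<le> 1 \<Longrightarrow>
       norm (\<psi> w - (of_real m * w + of_real (v / 2) * w\<^sup>2)) \<le> B * norm w ^ 3"
    "0 \<le> B"
    using busy_cumulant[OF alpha] unfolding m_def[symmetric] v_def by blast
  obtain A where A: "\<And>(\<epsilon>::complex) u n. Re \<epsilon> \<le> 0 \<Longrightarrow> K * norm \<epsilon> \<le> 1 \<Longrightarrow>
      (\<And>k. u k = \<epsilon> + (\<Sum>i=1..h. if i \<le> k then \<psi> (u (k - i)) else 0)) \<Longrightarrow>
      (\<forall>k. Re (u k) \<le> 0) \<and>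
      norm ((\<Sum>k<n. u k + \<psi> (u k)) - of_nat n * (of_real ((1 + m) * K) * \<epsilon> + of_real ((1 + real h) * K ^ 3 * v / 2) * \<epsilon>\<^sup>2))
        \<le> A * (norm \<epsilon> + real n * norm \<epsilon> ^ 3)"
    using cumulant_expansion[OF less_imp_le[OF m_pos] subcritical psi(3-7)] unfolding K_def by blast
  let ?X = "\<lambda>n \<omega>. (D n \<omega> - real n * speed m) / sqrt (real n)"
  have conv: "(\<lambda>n. char (distr M borel (?X n)) t) \<longlonglongrightarrow> char (density lborel (normal_density 0 \<sigma>)) t" for t
  proof -
    define \<epsilon> where "\<epsilon> n = \<i> * of_real (t / sqrt (real n))" for n
    define u where "u n = backward \<psi> (\<lambda>_. \<epsilon> n) (\<lambda>l k. k - l \<le> h)" for n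
    have u: "u n k = \<epsilon> n + (\<Sum>i=1..h. if i \<le> k then \<psi> (u n (k - i)) else 0)" for n k
      unfolding u_def
      using backward_eq[of \<psi> "\<lambda>_. \<epsilon> n" "\<lambda>l k. k - l \<le> h" k] by (simp add: sum_window)
    have norm_eps: "norm (\<epsilon> n) = \<bar>t\<bar> / sqrt (real n)" for n
      unfolding \<epsilon>_def norm_mult norm_of_real by simp
    define r where "r n = (\<Sum>k<n. u n k + \<psi> (u n k))
      - of_nat n * (of_real ((1 + m) * K) * \<epsilon> n + of_real ((1 + real h) * K ^ 3 * v / 2) * (\<epsilon> n)\<^sup>2)" for n
    have eps_lim: "(\<lambda>n. norm (\<epsilon> n)) \<longlonglongrightarrow> 0"
      unfolding norm_eps by real_asymp
    have ev: "eventually (\<lambda>n. K * norm (\<epsilon> n) \<le> 1 \<and> 0 < n) sequentially"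
    proof (intro eventually_conj eventually_gt_at_top)
      have "(\<lambda>n. K * norm (\<epsilon> n)) \<longlonglongrightarrow> 0" using tendsto_mult[OF tendsto_const eps_lim, of K] by simp
      then have "eventually (\<lambda>n. K * norm (\<epsilon> n) < 1) sequentially" by (rule order_tendstoD) simp
      then show "eventually (\<lambda>n. K * norm (\<epsilon> n) \<le> 1) sequentially" by eventually_elim simp
    qed
    have r_lim: "r \<longlonglongrightarrow> 0"
    proof (rule Lim_null_comparison)
      show "eventually (\<lambda>n. norm (r n) \<le> A * (norm (\<epsilon> n) + real n * norm (\<epsilon> n) ^ 3)) sequentially"
        using ev
      proof eventually_elim
        case (elim n)
        then show ?case unfolding r_def using A[of "\<epsilon> n" "u n" n] u by (simp add: \<epsilon>_def)
      qed
      have "(\<lambda>n. A * (\<bar>t\<bar> + \<bar>t\<bar> ^ 3) * (1 / sqrt (real n))) \<longlonglongrightarrow> A * (\<bar>t\<bar> + \<bar>t\<bar> ^ 3) * 0"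
        by (intro tendsto_mult tendsto_const) real_asymp
      moreover have "eventually (\<lambda>n. A * (\<bar>t\<bar> + \<bar>t\<bar> ^ 3) * (1 / sqrt (real n))
          = A * (\<bar>t\<bar> / sqrt (real n) + real n * (\<bar>t\<bar> / sqrt (real n)) ^ 3)) sequentially"
        using eventually_gt_at_top[of 0]
      proof eventually_elim
        case (elim n)
        then have "real n = sqrt (real n) * sqrt (real n)" by simp
        then have "real n * (\<bar>t\<bar> / sqrt (real n)) ^ 3 = \<bar>t\<bar> ^ 3 * (1 / sqrt (real n))"
          using elim by (simp add: power3_eq_cube field_simps)
        then show ?case by (simp add: algebra_simps add_divide_distrib)
      qed
      ultimately have "(\<lambda>n. A * (\<bar>t\<bar> / sqrt (real n) + real n * (\<bar>t\<bar> / sqrt (real n)) ^ 3)) \<longlonglongrightarrow> 0"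
        by (simp add: Lim_transform_eventually)
      then show "(\<lambda>n. A * (norm (\<epsilon> n) + real n * norm (\<epsilon> n) ^ 3)) \<longlonglongrightarrow> 0"
        by (simp add: norm_eps)
    qed
    have "eventually (\<lambda>n. exp (of_real (- (\<sigma>\<^sup>2 * t\<^sup>2 / 2)) + of_real \<tau> * r n) = char (distr M borel (?X n)) t) sequentially"
      using ev
    proof eventually_elim
      case (elim n)
      have Re: "Re (u n k) \<le> 0" for k
        using A[of "\<epsilon> n" "u n" n] u elim by (simp add: \<epsilon>_def)
      have "char (distr M borel (?X n)) t = (\<integral>\<omega>. exp (\<i> * of_real (t * ?X n \<omega>)) \<partial>M)"
        by (simp add: char_def integral_distr)
      also have "\<dots> = (\<integral>\<omega>. exp (- \<epsilon> n * of_real (real n * speed m)) * exp (\<Sum>j=1..n. \<epsilon> n * inc j \<omega>) \<partial>M)"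
      proof (intro Bochner_Integration.integral_cong refl)
        fix \<omega>
        have "(\<Sum>j=1..n. \<epsilon> n * inc j \<omega>) = \<epsilon> n * of_real (D n \<omega>)"
          by (simp flip: sum_distrib_left of_real_sum add: sum_inc_eq_D[simplified])
        then show "exp (\<i> * of_real (t * ?X n \<omega>)) = exp (- \<epsilon> n * of_real (real n * speed m)) * exp (\<Sum>j=1..n. \<epsilon> n * inc j \<omega>)"
          by (simp add: \<epsilon>_def exp_add[symmetric] algebra_simps diff_divide_distrib)
      qed
      also have "\<dots> = exp (- \<epsilon> n * of_real (real n * speed m)) * exp (\<tau> * (\<Sum>k<n. u n k + \<psi> (u n k)))"
      proof -
        have "(\<integral>\<omega>. exp (\<Sum>j=1..n. \<epsilon> n * inc j \<omega>) \<partial>M) = exp (\<tau> * (\<Sum>k<n. u n k + \<psi> (u n k)))"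
        proof (rule integral_exp_backward)
          fix k assume k: "k < n"
          show "Re (u n k) \<le> 0 \<and> Re (u n k + \<psi> (u n k)) \<le> 0 \<and> \<psi> (u n k) = \<alpha> * (exp (u n k + \<psi> (u n k)) - 1)"
            using Re psi(1,2) by blast
          show "u n k = \<epsilon> n + (\<Sum>l<k. if (n - l) - d (n - l) < n - k then \<psi> (u n l) else 0)"
            unfolding window_sum_eq[OF k] by (rule u)
        qed (simp add: \<epsilon>_def)
        then show ?thesis by simp
      qed
      also have "\<dots> = exp (- \<epsilon> n * of_real (real n * speed m) + \<tau> * (\<Sum>k<n. u n k + \<psi> (u n k)))"
        by (simp only: exp_add)
      \<comment> \<open>The centring cancels the linear term of the expansion, since
        \<open>speed m = \<tau> * (1 + m) * K\<close>.\<close>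
      also have "- \<epsilon> n * of_real (real n * speed m) + \<tau> * (\<Sum>k<n. u n k + \<psi> (u n k))
          = of_real (\<tau> * (1 + real h) * K ^ 3 * v / 2) * (of_nat n * (\<epsilon> n)\<^sup>2) + of_real \<tau> * r n"
        by (simp add: r_def speed algebra_simps)
      also have "of_nat n * (\<epsilon> n)\<^sup>2 = of_real (- t\<^sup>2)"
      proof -
        have "real n * (t / sqrt (real n))\<^sup>2 = t\<^sup>2" using elim by (simp add: power_divide)
        then have "of_nat n * (of_real (t / sqrt (real n)))\<^sup>2 = (of_real (t\<^sup>2) :: complex)"
          by (metis of_real_mult of_real_of_nat_eq of_real_power)
        then show ?thesis by (simp add: \<epsilon>_def power_mult_distrib del: of_real_divide)
      qed
      also have "of_real (\<tau> * (1 + real h) * K ^ 3 * v / 2) * of_real (- t\<^sup>2) = complex_of_real (- (\<sigma>\<^sup>2 * t\<^sup>2 / 2))"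
        using s2 by (simp add: \<sigma>_def)
      finally show ?case by simp
    qed
    moreover have "(\<lambda>n. exp (of_real (- (\<sigma>\<^sup>2 * t\<^sup>2 / 2)) + of_real \<tau> * r n))
        \<longlonglongrightarrow> exp (of_real (- (\<sigma>\<^sup>2 * t\<^sup>2 / 2)) + of_real \<tau> * 0)"
      by (intro tendsto_intros r_lim)
    ultimately have "(\<lambda>n. char (distr M borel (?X n)) t) \<longlonglongrightarrow> exp (of_real (- (\<sigma>\<^sup>2 * t\<^sup>2 / 2)))"
      by (simp add: Lim_transform_eventually)
    then show ?thesis by (simp only: char_normal_density[OF s] exp_of_real)
  qed
  have "weak_conv_m (\<lambda>n. distr M borel (?X n)) (density lborel (normal_density 0 \<sigma>))"
  proof (rule levy_continuity)
    show "real_distribution (distr M borel (?X n))" for n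
      by (simp add: real_distribution_distr)
    interpret N: prob_space "density lborel (normal_density 0 \<sigma>)"
      by (rule prob_space_normal_density[OF s])
    show "real_distribution (density lborel (normal_density 0 \<sigma>))"
      by standard (auto simp: space_density)
  qed (rule conv)
  with s show thesis by (rule that)
qed

end

section \<open>Exponential growth and fluctuations of the increments\<close>

context bus_line
begin

text \<open>Near 0 the slope of the cumulant is \<open>m > \<beta>\<close>. Beyond
  \<open>\<delta>\<close> the bound at \<open>- \<delta>\<close> is kept by monotonicity; this cap
  is the price for a bound valid at arbitrarily large weights.\<close>

lemma log_mgf_linear_below:
  assumes "\<beta> < m"
  obtains \<delta> where "0 < \<delta>" "\<And>x. 0 \<le> x \<Longrightarrow> log_mgf_le (- x) (- (\<beta> * min x \<delta>))"
proof -
  obtain C x0 where C: "0 < C" "0 < x0" "\<And>x. \<bar>x\<bar> \<le> x0 \<Longrightarrow> log_mgf_le x (m * x + C * x\<^sup>2)"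
    by (rule log_mgf_quadratic) blast
  define \<delta> where "\<delta> = min x0 ((m - \<beta>) / C)"
  have delta: "0 < \<delta>" using C assms by (simp add: \<delta>_def)
  have small: "log_mgf_le (- x) (- (\<beta> * x))" if x: "0 \<le> x" "x \<le> \<delta>" for x
  proof (rule log_mgf_le_mono[OF _ order_refl])
    show "log_mgf_le (- x) (m * (- x) + C * (- x)\<^sup>2)"
      using x by (intro C(3)) (auto simp: \<delta>_def)
    have "C * x \<le> m - \<beta>" using x C by (simp add: \<delta>_def field_simps)
    from mult_right_mono[OF this x(1)]
    show "m * (- x) + C * (- x)\<^sup>2 \<le> - (\<beta> * x)" by (simp add: power2_eq_square algebra_simps)
  qed
  show thesis
  proof (rule that[OF delta])
    fix x :: real assume "0 \<le> x"
    show "log_mgf_le (- x) (- (\<beta> * min x \<delta>))"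
    proof (cases "x \<le> \<delta>")
      case True
      then show ?thesis using small[of x] \<open>0 \<le> x\<close> by (simp add: min_def)
    next
      case False
      with small[of \<delta>] delta show ?thesis
        by (auto simp: min_def intro: log_mgf_le_mono)
    qed
  qed
qed

text \<open>For \<open>k \<ge> h\<close> each of the \<open>h\<close> predecessors is at least
  \<open>1 / r ^ h\<close> times the claimed bound, and \<open>r ^ h \<le> \<beta> * h\<close> makes
  their sum suffice. For \<open>k < h\<close> the window is not yet full; there only the nearest
  predecessor is used, at the cost of a factor \<open>b\<close> per step, and the factor
  \<open>(b / r) ^ h\<close> in the claim pays for it.\<close>

lemma backward_lower_bound:
  fixes v :: "nat \<Rightarrow> real"
  assumes h: "1 \<le> h" and r: "1 < r" "r ^ h \<le> \<beta> * real h" and "0 < \<delta>" "0 < \<beta>" "0 < l"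
    and v0: "v 0 = l" and v: "\<And>k. 0 \<le> v k"
    and vk: "\<And>k. 1 \<le> k \<Longrightarrow> k \<le> N \<Longrightarrow> (\<Sum>i=1..h. if i \<le> k then \<beta> * min (v (k - i)) \<delta> else 0) \<le> v k"
  defines "b \<equiv> min 1 \<beta>"
  assumes "k \<le> N"
  shows "min (b ^ h * \<delta>) (l * (b / r) ^ h * r ^ k) \<le> v k"
  using \<open>k \<le> N\<close>
proof (induction k rule: less_induct)
  case (less k)
  have b: "0 < b" "b \<le> 1" "b \<le> \<beta>" using assms by (auto simp: b_def)
  have nn: "0 \<le> \<beta> * min (v j) \<delta>" for j using v[of j] assms(4,5) by simp
  have early: "b ^ k * min l \<delta> \<le> v k" if "k \<le> N" for k
    using that
  proof (induction k)
    case 0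
    then show ?case using v0 by simp
  next
    case (Suc k)
    have "b ^ k * min l \<delta> \<le> 1 * \<delta>"
      using b assms(4,6) by (intro mult_mono power_le_one) auto
    then have "b ^ k * min l \<delta> \<le> min (v k) \<delta>" using Suc by simp
    then have "b * (b ^ k * min l \<delta>) \<le> \<beta> * min (v k) \<delta>"
      using b v[of k] assms(4-6) by (intro mult_mono) auto
    also have "\<dots> = (\<Sum>i\<in>{1}. if i \<le> Suc k then \<beta> * min (v (Suc k - i)) \<delta> else 0)" by simp
    also have "\<dots> \<le> (\<Sum>i=1..h. if i \<le> Suc k then \<beta> * min (v (Suc k - i)) \<delta> else 0)"
      using h nn by (intro sum_mono2) auto
    also have "\<dots> \<le> v (Suc k)" using Suc.prems by (intro vk) auto
    finally show ?case by (simp add: mult_ac)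
  qed
  show ?case
  proof (cases "k < h")
    case True
    have "min (b ^ h * \<delta>) (l * (b / r) ^ h * r ^ k) \<le> b ^ h * min l \<delta>"
    proof -
      have "r ^ k \<le> r ^ h" using r True by (intro power_increasing) auto
      then have "l * (b / r) ^ h * r ^ k \<le> l * (b / r) ^ h * r ^ h"
        using b r assms(6) by (intro mult_left_mono) auto
      also have "\<dots> = b ^ h * l" using r by (simp add: power_divide)
      finally show ?thesis by (auto simp: min_def)
    qed
    also have "\<dots> \<le> b ^ k * min l \<delta>"
      using b True assms(4,6) by (intro mult_right_mono power_decreasing) auto
    finally show ?thesis using early[OF less.prems] by simp
  next
    case False
    define x where "x = l * (b / r) ^ h * r ^ k"
    have x: "0 \<le> x" using assms(6) b r by (simp add: x_def)
    let ?m = "min (b ^ h * \<delta>) x"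
    have "?m \<le> (\<Sum>i=1..h. \<beta> * (?m / r ^ h))"
    proof -
      have "0 \<le> ?m" using b x assms(4) by simp
      then have "?m * r ^ h \<le> ?m * (\<beta> * real h)" by (intro mult_left_mono r(2)) simp
      then show ?thesis using r by (simp add: field_simps)
    qed
    also have "\<dots> \<le> (\<Sum>i=1..h. if i \<le> k then \<beta> * min (v (k - i)) \<delta> else 0)"
    proof (rule sum_mono)
      fix i assume i: "i \<in> {1..h}"
      have bd: "b ^ h * \<delta> \<le> \<delta>" using b assms(4) by (simp add: power_le_one mult_left_le_one_le)
      have rh: "1 \<le> r ^ h" "r ^ i \<le> r ^ h" using r i by (auto intro: power_increasing)
      have "?m / r ^ h \<le> b ^ h * \<delta>"
      proof -
        have "?m / r ^ h \<le> ?m / 1" using rh b x assms(4) by (intro divide_left_mono) auto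
        then show ?thesis by simp
      qed
      moreover have "?m / r ^ h \<le> l * (b / r) ^ h * r ^ (k - i)"
      proof -
        have "?m / r ^ h \<le> x / r ^ h" using r by (intro divide_right_mono) auto
        also have "\<dots> \<le> x / r ^ i" using x r rh by (intro divide_left_mono) auto
        also have "\<dots> = l * (b / r) ^ h * r ^ (k - i)"
          using r i False by (simp add: x_def power_diff)
        finally show ?thesis .
      qed
      ultimately have "?m / r ^ h \<le> v (k - i)"
        using less.IH[of "k - i"] less.prems i False by simp
      then have "?m / r ^ h \<le> min (v (k - i)) \<delta>"
        using \<open>?m / r ^ h \<le> b ^ h * \<delta>\<close> bd by simp
      then show "\<beta> * (?m / r ^ h) \<le> (if i \<le> k then \<beta> * min (v (k - i)) \<delta> else 0)"
        using i False assms(5) mult_left_mono[of "?m / r ^ h" "min (v (k - i)) \<delta>" \<beta>] by simp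
    qed
    also have "\<dots> \<le> v k" using less.prems False h by (intro vk) auto
    finally show ?thesis unfolding x_def .
  qed
qed

text \<open>Started with weight \<open>s ^ (-n)\<close> on station \<open>n\<close> alone, the backward recursion grows like \<open>s ^ (2 * k)\<close>
  until it is of order one. So about \<open>n / 2\<close> of the weights are of order one, and the Laplace transform
  of \<open>inc n\<close> at \<open>s ^ (-n)\<close> is exponentially small.\<close>

theorem AE_exponential_growth:
  assumes h: "1 < m * real h" and d_ge: "\<And>n. N0 \<le> n \<Longrightarrow> h < d n"
  obtains s where "1 < s" "AE \<omega> in M. eventually (\<lambda>n. s ^ n < inc n \<omega>) sequentially"
proof -
  have h0: "0 < h" using h by (cases h) auto
  \<comment> \<open>Midway between \<open>1 / h\<close> and \<open>m\<close>, so that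
    \<open>\<beta> < m\<close> and still \<open>\<beta> * h > 1\<close>.\<close>
  define \<beta> where "\<beta> = (m + 1 / real h) / 2"
  have beta: "0 < \<beta>" "\<beta> < m" "1 < \<beta> * real h"
    using h h0 m_pos by (auto simp: \<beta>_def field_simps)
  obtain \<delta> where delta: "0 < \<delta>" "\<And>x. 0 \<le> x \<Longrightarrow> log_mgf_le (- x) (- (\<beta> * min x \<delta>))"
    using log_mgf_linear_below[OF beta(2)] by blast
  define r where "r = root h (\<beta> * real h)"
  have r: "1 < r" "r ^ h = \<beta> * real h"
    using beta h0 by (simp_all add: r_def)
  define s where "s = sqrt r"
  have s: "1 < s" "s\<^sup>2 = r" using r by (simp_all add: s_def)
  define b where "b = min 1 \<beta>"
  have b: "0 < b" using beta by (simp add: b_def)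
  define \<kappa> where "\<kappa> = (b / r) ^ h"
  define \<delta>' where "\<delta>' = b ^ h * \<delta>"
  have pos: "0 < \<kappa>" "0 < \<delta>'" using b r delta by (simp_all add: \<kappa>_def \<delta>'_def)
  \<comment> \<open>The number of steps beyond \<open>n / 2\<close> that lift
    \<open>\<kappa> * s ^ (2 * k - n)\<close> to the plateau \<open>\<delta>'\<close>.\<close>
  obtain a where a: "\<delta>' / \<kappa> < s ^ a" using real_arch_pow[OF s(1)] by blast
  \<comment> \<open>\<open>?f n \<ge> 1\<close> is the event \<open>inc n \<le> s ^ n\<close>, and
    its expectation is \<open>exp 1\<close> times the Laplace transform of \<open>inc n\<close> at
    \<open>s ^ (-n)\<close>.\<close>
  let ?f = "\<lambda>n \<omega>. exp (1 - inc n \<omega> / s ^ n)"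
  define A where "A = exp (1 + \<tau> * \<delta>' * (real N0 + real a + 1))"
  have "AE \<omega> in M. eventually (\<lambda>n. ?f n \<omega> < 1) sequentially"
  proof (rule AE_eventually_less_1[where ?n0.0 = 1])
    fix n :: nat assume n: "1 \<le> n"
    define l where "l = 1 / s ^ n"
    have l: "0 < l" using s by (simp add: l_def)
    define v where "v = backward (\<lambda>x. \<beta> * min x \<delta>) (\<lambda>k. if k = 0 then l else 0) (\<lambda>i k. (n - i) - d (n - i) < n - k)"
    have v_eq: "v k = (if k = 0 then l else 0) + (\<Sum>i<k. if (n - i) - d (n - i) < n - k then \<beta> * min (v i) \<delta> else 0)" for k
      unfolding v_def by (rule backward_eq)
    have v_nonneg: "0 \<le> v k" for k
    proof (induction k rule: less_induct)
      case (less k)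
      then show ?case
        unfolding v_eq[of k] using l beta delta by (intro add_nonneg_nonneg sum_nonneg) auto
    qed
    have low: "min \<delta>' (l * \<kappa> * r ^ k) \<le> v k" if "k \<le> n - N0 - 1" for k
      unfolding \<delta>'_def \<kappa>_def b_def
    proof (rule backward_lower_bound[where N = "n - N0 - 1"])
      show "v 0 = l" using v_eq[of 0] by simp
      fix k assume k: "1 \<le> k" "k \<le> n - N0 - 1"
      have "(\<Sum>i=1..h. if i \<le> k then \<beta> * min (v (k - i)) \<delta> else 0)
          = (\<Sum>i<k. if k - i \<le> h then \<beta> * min (v i) \<delta> else 0)"
        by (rule sum_window[symmetric])
      also have "\<dots> \<le> (\<Sum>i<k. if (n - i) - d (n - i) < n - k then \<beta> * min (v i) \<delta> else 0)"
      proof (rule sum_mono)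
        fix i assume "i \<in> {..<k}"
        then have "N0 \<le> n - i" "i < k" "k < n" using k by auto
        then have "(n - i) - d (n - i) < n - k" if "k - i \<le> h"
          using that d_ge[of "n - i"] by linarith
        then show "(if k - i \<le> h then \<beta> * min (v i) \<delta> else 0)
            \<le> (if (n - i) - d (n - i) < n - k then \<beta> * min (v i) \<delta> else 0)"
          using beta delta v_nonneg[of i] by auto
      qed
      also have "\<dots> = v k" using v_eq[of k] k by simp
      finally show "(\<Sum>i=1..h. if i \<le> k then \<beta> * min (v (k - i)) \<delta> else 0) \<le> v k" .
    qed (use h0 r beta delta l v_nonneg that in auto)
    have sum_v: "\<delta>' * (real n / 2 - real N0 - real a - 1) \<le> (\<Sum>k<n. v k)"
    proof -
      \<comment> \<open>Indices on the plateau whose station \<open>n - k\<close> is beyond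
        \<open>N0\<close>, where the windows are known to be long. They are at least
        \<open>n / 2\<close> in number up to a constant.\<close>
      let ?I = "{n div 2 + a + 1..<n - N0}"
      have "n \<le> 2 * card ?I + 2 * N0 + 2 * a + 2"
        unfolding card_atLeastLessThan by linarith
      then have "real n \<le> real (2 * card ?I + 2 * N0 + 2 * a + 2)"
        by (simp only: of_nat_le_iff)
      then have "real n / 2 - real N0 - real a - 1 \<le> real (card ?I)"
        by (simp del: card_atLeastLessThan)
      then have "\<delta>' * (real n / 2 - real N0 - real a - 1) \<le> (\<Sum>k\<in>?I. \<delta>')"
        using pos by (simp add: mult.commute)
      also have "\<dots> \<le> (\<Sum>k\<in>?I. v k)"
      proof (rule sum_mono)
        fix k assume k: "k \<in> ?I"
        have "\<delta>' \<le> \<kappa> * s ^ a" using a pos by (simp add: field_simps)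
        also have "\<dots> \<le> \<kappa> * s ^ (2 * k - n)"
          using k pos s by (intro mult_left_mono power_increasing) auto
        also have "s ^ (2 * k - n) = l * r ^ k"
        proof -
          have "n \<le> 2 * k" using k by auto
          then have "s ^ (2 * k - n) = s ^ (2 * k) / s ^ n" using s by (intro power_diff) auto
          then show ?thesis by (simp add: l_def power_mult s(2))
        qed
        finally have "\<delta>' \<le> l * \<kappa> * r ^ k" by (simp add: mult_ac)
        moreover have "k \<le> n - N0 - 1" using k by auto
        ultimately show "\<delta>' \<le> v k" using low[of k] by simp
      qed
      also have "\<dots> \<le> (\<Sum>k<n. v k)"
        using v_nonneg by (intro sum_mono2) auto
      finally show ?thesis .
    qed
    have "(\<integral>\<^sup>+\<omega>. ennreal (exp (\<Sum>j=1..n. (if j = n then - l else 0) * inc j \<omega>)) \<partial>M)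
        \<le> ennreal (exp (\<tau> * (\<Sum>k<n. - v k + - (\<beta> * min (v k) \<delta>))))"
    proof (rule nn_integral_exp_backward)
      fix k assume k: "k < n"
      show "log_mgf_le (- v k) (- (\<beta> * min (v k) \<delta>))" by (rule delta(2)) (rule v_nonneg)
      show "- v k = (if n - k = n then - l else 0) +
          (\<Sum>i<k. if (n - i) - d (n - i) < n - k then - (\<beta> * min (v i) \<delta>) else 0)"
        using k by (subst v_eq) (auto simp: sum_negf[symmetric] intro!: sum.cong)
    qed
    also have "\<tau> * (\<Sum>k<n. - v k + - (\<beta> * min (v k) \<delta>)) \<le> - (\<tau> * (\<delta>' * (real n / 2 - real N0 - real a - 1)))"
    proof -
      have "(\<Sum>k<n. - v k + - (\<beta> * min (v k) \<delta>)) \<le> (\<Sum>k<n. - v k)"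
        using v_nonneg beta delta by (intro sum_mono) auto
      also have "\<dots> \<le> - (\<delta>' * (real n / 2 - real N0 - real a - 1))"
        using sum_v by (simp add: sum_negf)
      finally show ?thesis using tau mult_left_mono[of _ _ \<tau>] by fastforce
    qed
    finally have le: "(\<integral>\<^sup>+\<omega>. ennreal (exp (\<Sum>j=1..n. (if j = n then - l else 0) * inc j \<omega>)) \<partial>M)
        \<le> ennreal (exp (- (\<tau> * (\<delta>' * (real n / 2 - real N0 - real a - 1)))))"
      by (simp add: ennreal_leI)
    have "(\<integral>\<^sup>+\<omega>. ennreal (?f n \<omega>) \<partial>M)
        = (\<integral>\<^sup>+\<omega>. ennreal (exp 1) * ennreal (exp (\<Sum>j=1..n. (if j = n then - l else 0) * inc j \<omega>)) \<partial>M)"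
    proof (intro nn_integral_cong)
      fix \<omega>
      have "(\<Sum>j=1..n. (if j = n then - l else 0) * inc j \<omega>) = (\<Sum>j=1..n. if n = j then - l * inc j \<omega> else 0)"
        by (intro sum.cong) auto
      also have "\<dots> = - l * inc n \<omega>" using n by simp
      finally show "ennreal (?f n \<omega>) = ennreal (exp 1) * ennreal (exp (\<Sum>j=1..n. (if j = n then - l else 0) * inc j \<omega>))"
        by (simp add: ennreal_mult'[symmetric] exp_add[symmetric] l_def)
    qed
    also have "\<dots> = ennreal (exp 1) * (\<integral>\<^sup>+\<omega>. ennreal (exp (\<Sum>j=1..n. (if j = n then - l else 0) * inc j \<omega>)) \<partial>M)"
      by (rule nn_integral_cmult) measurable
    also have "\<dots> \<le> ennreal (exp 1) * ennreal (exp (- (\<tau> * (\<delta>' * (real n / 2 - real N0 - real a - 1)))))"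
      by (intro mult_left_mono le) simp
    also have "\<dots> = ennreal (exp (1 + - (\<tau> * (\<delta>' * (real n / 2 - real N0 - real a - 1)))))"
      by (simp only: exp_add ennreal_mult' exp_ge_zero)
    also have "1 + - (\<tau> * (\<delta>' * (real n / 2 - real N0 - real a - 1))) = (1 + \<tau> * \<delta>' * (real N0 + real a + 1)) + real n * (- (\<tau> * \<delta>' / 2))"
      by (simp add: algebra_simps)
    also have "exp \<dots> = A * exp (- (\<tau> * \<delta>' / 2)) ^ n"
      by (simp only: exp_add exp_of_nat_mult A_def)
    finally show "(\<integral>\<^sup>+\<omega>. ennreal (?f n \<omega>) \<partial>M) \<le> ennreal (A * exp (- (\<tau> * \<delta>' / 2)) ^ n)" .
  next
    show "summable (\<lambda>n. A * exp (- (\<tau> * \<delta>' / 2)) ^ n)"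
      using tau pos by (intro summable_mult summable_geometric) simp
    show "0 \<le> A * exp (- (\<tau> * \<delta>' / 2)) ^ n" for n by (simp add: A_def)
  qed measurable
  then have "AE \<omega> in M. eventually (\<lambda>n. s ^ n < inc n \<omega>) sequentially"
  proof eventually_elim
    case (elim \<omega>)
    then show ?case
    proof eventually_elim
      case (elim n)
      then have "1 < inc n \<omega> / s ^ n" by simp
      then show ?case using s by (simp add: field_simps)
    qed
  qed
  with s(1) show thesis by (rule that)
qed

text \<open>Conditionally on the past the deviation has variance of order \<open>span n\<close>.
  Dividing by \<open>sqrt (span n)\<close>, a function of the past, turns the quadratic term of the
  cumulant bound into the constant \<open>C * t^2\<close>. Markov's inequality at level
  \<open>exp (n + 1)\<close>, applied to both signs, produces the factor
  \<open>Suc n\<close>.\<close>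

theorem AE_noise_bound:
  obtains \<kappa> where "0 < \<kappa>"
    "AE \<omega> in M. eventually (\<lambda>n. \<bar>inc (Suc n) \<omega> - \<tau> - m * span n \<omega>\<bar> < \<kappa> * real (Suc n) * sqrt (span n \<omega>)) sequentially"
proof -
  obtain C x0 where C: "0 < C" "0 < x0" "\<And>x. \<bar>x\<bar> \<le> x0 \<Longrightarrow> log_mgf_le x (m * x + C * x\<^sup>2)"
    by (rule log_mgf_quadratic) blast
  \<comment> \<open>Because \<open>span n \<ge> \<tau>\<close>, the argument
    \<open>t / sqrt (span n)\<close> is then at most \<open>x0\<close>.\<close>
  define t where "t = x0 * sqrt \<tau>"
  have t: "0 < t" using C tau by (simp add: t_def)
  define L where "L n p = departure \<tau> d p n + \<tau> - departure \<tau> d p (n - (d (Suc n) - 1))" for n p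
  have L: "L n (past n \<omega>) = span n \<omega>" for n \<omega>
    by (simp add: L_def D_past span_def gate_def)
  have [measurable]: "L n \<in> borel_measurable (past_space n)" for n
    unfolding L_def[abs_def]
    by (intro borel_measurable_add borel_measurable_diff borel_measurable_const departure_past_measurable) auto
  have sp: "0 < span n \<omega>" for n \<omega> using span_ge[of n \<omega>] tau by simp
  have one: "(\<integral>\<^sup>+\<omega>. ennreal (exp (y * (inc (Suc n) \<omega> - \<tau> - m * span n \<omega>) / sqrt (span n \<omega>))) \<partial>M) \<le> ennreal (exp (C * t\<^sup>2))"
    if y: "\<bar>y\<bar> = t" for y n
  proof -
    let ?F = "\<lambda>p b. ennreal (exp (y * (b - m * L n p) / sqrt (L n p)))"
    have "(\<integral>\<^sup>+\<omega>. ennreal (exp (y * (inc (Suc n) \<omega> - \<tau> - m * span n \<omega>) / sqrt (span n \<omega>))) \<partial>M)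
        = (\<integral>\<^sup>+\<omega>. ?F (past n \<omega>) (D (Suc n) \<omega> - D n \<omega> - \<tau>) \<partial>M)"
      by (simp add: L inc_Suc)
    also have "\<dots> = (\<integral>\<^sup>+\<omega>. (\<integral>\<^sup>+\<omega>'. ?F (past n \<omega>) (boarders (arr (Suc n) \<omega>') (gate n \<omega>) (D n \<omega> + \<tau>)) \<partial>M) \<partial>M)"
      by (intro nn_integral_boarders) measurable
    also have "\<dots> \<le> (\<integral>\<^sup>+\<omega>. ennreal (exp (C * t\<^sup>2)) \<partial>M)"
    proof (rule nn_integral_mono)
      fix \<omega>
      let ?l = "span n \<omega>" and ?b = "\<lambda>\<omega>'. boarders (arr (Suc n) \<omega>') (gate n \<omega>) (D n \<omega> + \<tau>)"
      let ?x = "y / sqrt ?l"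
      have meas: "?b \<in> borel_measurable M"
        by (intro boarders_measurable measurable_compose[OF arr_measurable arr_coordinate]) auto
      have "\<bar>?x\<bar> = t / sqrt ?l" using y sp[of n \<omega>] by simp
      also have "\<dots> \<le> t / sqrt \<tau>"
        using t tau span_ge[of n \<omega>] sp[of n \<omega>] by (intro divide_left_mono) auto
      also have "\<dots> = x0" using tau by (simp add: t_def)
      finally have mgf: "log_mgf_le ?x (m * ?x + C * ?x\<^sup>2)" by (rule C(3))
      have "gate n \<omega> \<le> D n \<omega> + \<tau>" using sp[of n \<omega>] by (simp add: span_def)
      then have mgf': "(\<integral>\<^sup>+\<omega>'. ennreal (exp (?x * ?b \<omega>')) \<partial>M) \<le> ennreal (exp (?l * (m * ?x + C * ?x\<^sup>2)))"
        using mgf gate_nonneg[of n \<omega>] by (auto simp: log_mgf_le_def span_def)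
      have "(\<integral>\<^sup>+\<omega>'. ?F (past n \<omega>) (?b \<omega>') \<partial>M) = (\<integral>\<^sup>+\<omega>'. ennreal (exp (?x * ?b \<omega>')) * ennreal (exp (- (?x * (m * ?l)))) \<partial>M)"
        by (intro nn_integral_cong) (simp add: L ennreal_mult'[symmetric] exp_add[symmetric] algebra_simps diff_divide_distrib)
      also have "\<dots> = (\<integral>\<^sup>+\<omega>'. ennreal (exp (?x * ?b \<omega>')) \<partial>M) * ennreal (exp (- (?x * (m * ?l))))"
        by (intro nn_integral_multc measurable_compose[OF meas]) measurable
      also have "\<dots> \<le> ennreal (exp (?l * (m * ?x + C * ?x\<^sup>2))) * ennreal (exp (- (?x * (m * ?l))))"
        by (intro mult_right_mono mgf') simp
      also have "\<dots> = ennreal (exp (?l * (m * ?x + C * ?x\<^sup>2) + - (?x * (m * ?l))))"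
        by (simp only: exp_add ennreal_mult' exp_ge_zero)
      also have "?l * (m * ?x + C * ?x\<^sup>2) + - (?x * (m * ?l)) = C * (?l * ?x\<^sup>2)" by (simp add: algebra_simps)
      also have "?l * ?x\<^sup>2 = t\<^sup>2" using y sp[of n \<omega>] by (auto simp: power_divide)
      finally show "(\<integral>\<^sup>+\<omega>'. ?F (past n \<omega>) (?b \<omega>') \<partial>M) \<le> ennreal (exp (C * t\<^sup>2))" .
    qed
    also have "\<dots> = ennreal (exp (C * t\<^sup>2))" by (simp add: emeasure_space_1)
    finally show ?thesis .
  qed
  let ?g = "\<lambda>y n \<omega>. exp (y * (inc (Suc n) \<omega> - \<tau> - m * span n \<omega>) / sqrt (span n \<omega>))"
  have ev: "AE \<omega> in M. eventually (\<lambda>n. ?g y n \<omega> * exp (- 1) ^ Suc n < 1) sequentially" if y: "\<bar>y\<bar> = t" for y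
  proof (rule AE_eventually_less_1)
    fix n
    have "(\<integral>\<^sup>+\<omega>. ennreal (?g y n \<omega> * exp (- 1) ^ Suc n) \<partial>M) = (\<integral>\<^sup>+\<omega>. ennreal (?g y n \<omega>) * ennreal (exp (- 1) ^ Suc n) \<partial>M)"
      by (intro nn_integral_cong) (simp only: ennreal_mult' exp_ge_zero)
    also have "\<dots> = (\<integral>\<^sup>+\<omega>. ennreal (?g y n \<omega>) \<partial>M) * ennreal (exp (- 1) ^ Suc n)"
      by (rule nn_integral_multc) measurable
    also have "\<dots> \<le> ennreal (exp (C * t\<^sup>2)) * ennreal (exp (- 1) ^ Suc n)"
      by (intro mult_right_mono one y) simp
    also have "\<dots> = ennreal (exp (C * t\<^sup>2) * exp (- 1) ^ Suc n)"
      by (simp only: ennreal_mult' exp_ge_zero)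
    finally show "(\<integral>\<^sup>+\<omega>. ennreal (?g y n \<omega> * exp (- 1) ^ Suc n) \<partial>M) \<le> ennreal (exp (C * t\<^sup>2) * exp (- 1) ^ Suc n)" .
  next
    have "summable (\<lambda>n. exp (- 1 :: real) ^ n)" by (intro summable_geometric) simp
    then have "summable (\<lambda>n. exp (- 1 :: real) ^ Suc n)" by (subst summable_Suc_iff)
    then show "summable (\<lambda>n. exp (C * t\<^sup>2) * exp (- 1 :: real) ^ Suc n)" by (intro summable_mult)
  qed (auto intro!: mult_nonneg_nonneg)
  have "AE \<omega> in M. eventually (\<lambda>n. \<bar>inc (Suc n) \<omega> - \<tau> - m * span n \<omega>\<bar> < 1 / t * real (Suc n) * sqrt (span n \<omega>)) sequentially"
  proof -
    have "\<bar>t\<bar> = t" "\<bar>- t\<bar> = t" using t by auto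
    from ev[OF this(1)] ev[OF this(2)] show ?thesis
    proof eventually_elim
      case (elim \<omega>)
      then show ?case
      proof eventually_elim
        case (elim n)
        let ?xi = "inc (Suc n) \<omega> - \<tau> - m * span n \<omega>" and ?s = "sqrt (span n \<omega>)"
        have s: "0 < ?s" using sp[of n \<omega>] by simp
        have lt: "y * ?xi / ?s < real (Suc n)" if "?g y n \<omega> * exp (- 1) ^ Suc n < 1" for y
        proof -
          have "?g y n \<omega> * exp (- 1) ^ Suc n = exp (y * ?xi / ?s + real (Suc n) * (- 1))"
            by (simp only: exp_add exp_of_nat_mult)
          then show ?thesis using that by simp
        qed
        have "t * ?xi < real (Suc n) * ?s" "(- t) * ?xi < real (Suc n) * ?s"
          using lt[OF elim(1)] lt[OF elim(2)] s by (simp_all only: pos_divide_less_eq)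
        then have "\<bar>t * ?xi\<bar> < real (Suc n) * ?s"
          unfolding abs_less_iff by simp
        then have "t * \<bar>?xi\<bar> < real (Suc n) * ?s" using t by (simp add: abs_mult)
        then show ?case using t by (simp add: field_simps)
      qed
    qed
  qed
  moreover have "0 < 1 / t" using t by simp
  ultimately show thesis using that by blast
qed

end

section \<open>Perturbed window recursions\<close>

lemma contraction_tendsto_0:
  fixes b c :: "nat \<Rightarrow> real"
  assumes "\<And>n. 0 \<le> b n" "0 \<le> q" "q < 1"
    and rec: "eventually (\<lambda>n. b (Suc n) \<le> q * b n + c n) sequentially" and c: "c \<longlonglongrightarrow> 0"
  shows "b \<longlonglongrightarrow> 0"
proof (rule LIMSEQ_I)
  fix \<epsilon> :: real assume e: "0 < \<epsilon>"
  have "eventually (\<lambda>n. c n < \<epsilon> * (1 - q) / 2) sequentially"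
    using c e assms(3) by (intro order_tendstoD(2)[OF c]) simp
  with rec have "eventually (\<lambda>n. b (Suc n) \<le> q * b n + \<epsilon> * (1 - q) / 2) sequentially"
    by eventually_elim simp
  then obtain N where N: "\<And>n. N \<le> n \<Longrightarrow> b (Suc n) \<le> q * b n + \<epsilon> * (1 - q) / 2"
    by (auto simp: eventually_sequentially)
  have le: "b (N + k) \<le> q ^ k * b N + \<epsilon> / 2" for k
  proof (induction k)
    case 0
    then show ?case using e by simp
  next
    case (Suc k)
    have "b (N + Suc k) \<le> q * b (N + k) + \<epsilon> * (1 - q) / 2" using N[of "N + k"] by simp
    also have "\<dots> \<le> q * (q ^ k * b N + \<epsilon> / 2) + \<epsilon> * (1 - q) / 2"
      using Suc assms(2) by (intro add_right_mono mult_left_mono) auto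
    also have "\<dots> = q ^ Suc k * b N + \<epsilon> / 2" by (simp add: field_simps)
    finally show ?case .
  qed
  have "(\<lambda>k. q ^ k * b N) \<longlonglongrightarrow> 0 * b N"
    using assms(2,3) by (intro tendsto_mult LIMSEQ_realpow_zero tendsto_const)
  then have "eventually (\<lambda>k. q ^ k * b N < \<epsilon> / 2) sequentially"
    using e by (intro order_tendstoD(2)) auto
  then obtain K where K: "\<And>k. K \<le> k \<Longrightarrow> q ^ k * b N < \<epsilon> / 2"
    by (auto simp: eventually_sequentially)
  show "\<exists>no. \<forall>n\<ge>no. norm (b n - 0) < \<epsilon>"
  proof (intro exI allI impI)
    fix n assume "N + K \<le> n"
    then have "K \<le> n - N" "N + (n - N) = n" by simp_all
    then have "b n < \<epsilon>" using le[of "n - N"] K[of "n - N"] by simp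
    then show "norm (b n - 0) < \<epsilon>" using assms(1)[of n] by simp
  qed
qed

text \<open>The normalised sums satisfy
  \<open>a (n + 1) = p n * (a n + X (n + 1) / y (n + 1))\<close>, where \<open>p n\<close> tends to
  \<open>1 / g < 1\<close>. This is asymptotically a contraction whose fixed point solves
  \<open>A = (A + R) / g\<close>.\<close>

lemma partial_sum_ratio_tendsto:
  fixes X y :: "nat \<Rightarrow> real"
  assumes y: "\<And>n. 1 \<le> n \<Longrightarrow> 0 < y n" and "1 < g"
    and ratio: "(\<lambda>n. y (Suc n) / y n) \<longlonglongrightarrow> g" and X: "(\<lambda>n. X n / y n) \<longlonglongrightarrow> R"
  shows "(\<lambda>n. (\<Sum>j=1..n. X j) / y (Suc n)) \<longlonglongrightarrow> R / (g - 1)"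
proof -
  define a where "a n = (\<Sum>j=1..n. X j) / y (Suc n)" for n
  define A where "A = R / (g - 1)"
  define p where "p n = y (Suc n) / y (Suc (Suc n))" for n
  define c where "c n = \<bar>p n * (A + X (Suc n) / y (Suc n)) - A\<bar>" for n
  have "(\<lambda>n. inverse (y (Suc (Suc n)) / y (Suc n))) \<longlonglongrightarrow> inverse g"
    using \<open>1 < g\<close> by (intro tendsto_inverse LIMSEQ_Suc[OF ratio]) auto
  then have p: "p \<longlonglongrightarrow> 1 / g" unfolding p_def by (simp add: inverse_eq_divide)
  have X': "(\<lambda>n. X (Suc n) / y (Suc n)) \<longlonglongrightarrow> R" by (rule LIMSEQ_Suc[OF X])
  have "1 / g * (A + R) - A = 0" using \<open>1 < g\<close> by (simp add: A_def field_simps)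
  moreover have "c \<longlonglongrightarrow> \<bar>1 / g * (A + R) - A\<bar>"
    unfolding c_def by (intro tendsto_intros p X')
  ultimately have c: "c \<longlonglongrightarrow> 0" by simp
  define q where "q = (1 + 1 / g) / 2"
  have q: "0 \<le> q" "q < 1" "1 / g < q" using \<open>1 < g\<close> by (auto simp: q_def field_simps)
  have "eventually (\<lambda>n. p n < q) sequentially" by (rule order_tendstoD(2)[OF p q(3)])
  then have "eventually (\<lambda>n. \<bar>a (Suc n) - A\<bar> \<le> q * \<bar>a n - A\<bar> + c n) sequentially"
  proof eventually_elim
    case (elim n)
    have y0: "0 < y (Suc n)" "0 < y (Suc (Suc n))" using y by auto
    have "a (Suc n) = p n * (a n + X (Suc n) / y (Suc n))"
      using y0 by (simp add: a_def p_def field_simps)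
    then have "a (Suc n) - A = p n * (a n - A) + (p n * (A + X (Suc n) / y (Suc n)) - A)"
      by (simp add: algebra_simps)
    then have "\<bar>a (Suc n) - A\<bar> \<le> \<bar>p n * (a n - A)\<bar> + c n"
      unfolding c_def by (simp only: abs_triangle_ineq)
    also have "\<bar>p n * (a n - A)\<bar> = p n * \<bar>a n - A\<bar>" using y0 by (simp add: abs_mult p_def)
    also have "\<dots> \<le> q * \<bar>a n - A\<bar>" using elim by (intro mult_right_mono) auto
    finally show ?case by simp
  qed
  from contraction_tendsto_0[OF _ q(1,2) this c] have "(\<lambda>n. \<bar>a n - A\<bar>) \<longlonglongrightarrow> 0" by simp
  then have "(\<lambda>n. a n - A) \<longlonglongrightarrow> 0" by (rule tendsto_rabs_zero_cancel)
  then show ?thesis unfolding a_def A_def by (rule LIM_zero_cancel)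
qed

text \<open>Station \<open>i\<close> is fed by the stations in \<open>{e i<..<i}\<close>. The recursion \<open>y i = m * (\<Sum>j\<in>{e i<..<i}. y j)\<close>
  gives \<open>y (i + 1) = (1 + m) * y i\<close>, up to a term \<open>m * y (e i + 1)\<close> if the window moves. Hence, for another
  solution \<open>X\<close>, the increment of \<open>X i / y i\<close> is at most \<open>w i\<close> times the sum of the previous ones
  in the window, and these increments are summable because each of them is used with total weight \<open>\<kappa> j < 1\<close>.\<close>

locale window_recursion =
  fixes e :: "nat \<Rightarrow> nat" and m :: real and y :: "nat \<Rightarrow> real" and N0 :: nat
    and w :: "nat \<Rightarrow> real" and \<kappa> :: "nat \<Rightarrow> real" and \<theta> g :: real
  assumes m: "0 < m" and N0: "1 \<le> N0"
    and e_less: "\<And>i. N0 \<le> i \<Longrightarrow> Suc (e i) < i"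
    and e_Suc: "\<And>i. N0 \<le> i \<Longrightarrow> e (Suc i) = e i \<or> e (Suc i) = Suc (e i)"
    and y_pos: "\<And>j. 1 \<le> j \<Longrightarrow> 0 < y j"
    and y_rec: "\<And>i. N0 \<le> i \<Longrightarrow> y i = m * (\<Sum>j\<in>{e i<..<i}. y j)"
    and w: "\<And>i. N0 \<le> i \<Longrightarrow> 0 \<le> w i"
    and y_w: "\<And>i. N0 \<le> i \<Longrightarrow> e (Suc i) = Suc (e i) \<Longrightarrow> m * y (Suc (e i)) / y (Suc i) \<le> w i"
    and \<kappa>: "\<And>j N. 1 \<le> j \<Longrightarrow> (\<Sum>i\<in>{i\<in>{N0..N}. e i < j \<and> j < i}. w i) \<le> \<kappa> j"
    and \<kappa>_le: "eventually (\<lambda>j. \<kappa> j \<le> \<theta>) sequentially" and \<theta>: "\<theta> < 1"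
    and ratio: "(\<lambda>n. y (Suc n) / y n) \<longlonglongrightarrow> g" and g: "1 < g"
begin

text \<open>The ratio \<open>X / y\<close> is first kept between positive constants: a relative
  error \<open>\<delta> i\<close> can move its extreme values only by a factor
  \<open>1 + \<delta> i / m\<close> or \<open>1 - \<delta> i / m\<close>, and the product of these
  converges. The upper bound then turns the errors into a summable perturbation of the increments of
  the ratio, and the lower bound makes the limit positive.\<close>

lemma solution_limit:
  fixes X \<delta> :: "nat \<Rightarrow> real"
  assumes X_pos: "\<And>j. 1 \<le> j \<Longrightarrow> 0 < X j"
    and \<delta>: "\<And>i. 0 \<le> \<delta> i" "summable \<delta>"
    and X_rec: "\<And>i. N1 \<le> i \<Longrightarrow> \<bar>X i - m * (\<Sum>j\<in>{e i<..<i}. X j)\<bar> \<le> \<delta> i * (\<Sum>j\<in>{e i<..<i}. X j)"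
  obtains R where "0 < R" "(\<lambda>n. X n / y n) \<longlonglongrightarrow> R"
proof -
  define R where "R n = X n / y n" for n
  define V where "V X i = (\<Sum>j\<in>{e i<..<i}. X j)" for X :: "nat \<Rightarrow> real" and i
  define S where "S = suminf \<delta>"
  have R_pos: "0 < R j" if "1 \<le> j" for j using that X_pos y_pos by (simp add: R_def)
  have X_eq: "X j = R j * y j" if "1 \<le> j" for j using y_pos[OF that] by (simp add: R_def)
  have sum_le_S: "sum \<delta> A \<le> S" if "finite A" for A
    unfolding S_def using that \<delta> by (intro sum_le_suminf) auto
  have "\<delta> \<longlonglongrightarrow> 0" by (rule summable_LIMSEQ_zero[OF \<delta>(2)])
  then have "eventually (\<lambda>i. \<delta> i < m / 2) sequentially"
    using m by (intro order_tendstoD(2)) auto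
  then obtain N2 where N2: "\<And>i. N2 \<le> i \<Longrightarrow> \<delta> i < m / 2"
    by (auto simp: eventually_sequentially)
  define N where "N = max N0 (max N1 N2)"
  have N: "N0 \<le> N" "1 \<le> N" "\<And>i. N \<le> i \<Longrightarrow> N0 \<le> i \<and> N1 \<le> i \<and> \<delta> i \<le> m / 2"
    using N0 N2 by (auto simp: N_def less_imp_le)
  have V_pos: "0 < V X i" if "N \<le> i" for i
  proof -
    have "Suc (e i) < i" using e_less N(3)[OF that] by auto
    then show ?thesis unfolding V_def using X_pos by (intro sum_pos) auto
  qed
  have Vy: "V y i = y i / m" if "N \<le> i" for i
    using y_rec N(3)[OF that] m by (simp add: V_def)
  have rec: "\<bar>X i - m * V X i\<bar> \<le> \<delta> i * V X i" if "N \<le> i" for i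
    using X_rec N(3)[OF that] by (simp add: V_def)

  define Q where "Q = Max (R ` {1..N})"
  have "R 1 \<le> Q" unfolding Q_def using N by (intro Max_ge) auto
  then have Q0: "0 < Q" using R_pos[of 1] by simp
  have upper: "R j \<le> Q * exp (sum \<delta> {..j} / m)" if "1 \<le> j" for j
    using that
  proof (induction j rule: less_induct)
    case (less j)
    have Q: "R i \<le> Q" if "1 \<le> i" "i \<le> N" for i unfolding Q_def using that by (intro Max_ge) auto
    show ?case
    proof (cases "j \<le> N")
      case True
      have "1 \<le> exp (sum \<delta> {..j} / m)" using m \<delta> by (simp add: sum_nonneg)
      then have "Q * 1 \<le> Q * exp (sum \<delta> {..j} / m)" using Q0 by (intro mult_left_mono) auto
      then show ?thesis using Q[OF less.prems True] by simp
    next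
      case False
      then obtain k where k: "j = Suc k" by (cases j) auto
      have N_j: "N \<le> j" using False by simp
      let ?E = "Q * exp (sum \<delta> {..k} / m)"
      have "V X j \<le> (\<Sum>i\<in>{e j<..<j}. ?E * y i)"
        unfolding V_def
      proof (rule sum_mono)
        fix i assume i: "i \<in> {e j<..<j}"
        have "R i \<le> Q * exp (sum \<delta> {..i} / m)" using i less.IH by auto
        also have "\<dots> \<le> ?E"
          using i k m \<delta> Q0 by (intro mult_left_mono) (auto intro!: divide_right_mono sum_mono2)
        finally show "X i \<le> ?E * y i" using X_eq[of i] y_pos[of i] i by (simp add: mult_right_mono)
      qed
      also have "\<dots> = ?E * (y j / m)" using Vy[OF N_j] by (simp add: V_def sum_distrib_left[symmetric])
      finally have VX: "V X j \<le> ?E * (y j / m)" .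
      have "X j \<le> (m + \<delta> j) * V X j" using rec[OF N_j] by (simp add: algebra_simps abs_le_iff)
      also have "\<dots> \<le> (m + \<delta> j) * (?E * (y j / m))" using VX m \<delta>(1)[of j] by (intro mult_left_mono) auto
      finally have "R j \<le> (m + \<delta> j) * (?E / m)" using y_pos[OF less.prems] by (simp add: R_def field_simps)
      also have "\<dots> = (1 + \<delta> j / m) * ?E" using m by (simp add: field_simps)
      also have "\<dots> \<le> exp (\<delta> j / m) * ?E"
        using Q0 exp_ge_add_one_self[of "\<delta> j / m"] by (intro mult_right_mono) auto
      also have "\<dots> = Q * exp (sum \<delta> {..j} / m)" by (simp add: k exp_add[symmetric] add_divide_distrib add.commute)
      finally show ?thesis .
    qed
  qed
  define C where "C = Q * exp (S / m)"
  have R_le: "R j \<le> C" if "1 \<le> j" for j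
  proof -
    have "Q * exp (sum \<delta> {..j} / m) \<le> C"
      unfolding C_def using sum_le_S[of "{..j}"] m Q0 by (intro mult_left_mono) (auto intro: divide_right_mono)
    with upper[OF that] show ?thesis by simp
  qed
  have C: "0 < C" using R_le[of 1] R_pos[of 1] by simp

  define q where "q = Min (R ` {1..N})"
  have q0: "0 < q" unfolding q_def using N R_pos by (subst Min_gr_iff) auto
  have lower: "q * exp (- (2 * sum \<delta> {..j} / m)) \<le> R j" if "1 \<le> j" for j
    using that
  proof (induction j rule: less_induct)
    case (less j)
    have q: "q \<le> R i" if "1 \<le> i" "i \<le> N" for i unfolding q_def using that by (intro Min_le) auto
    show ?case
    proof (cases "j \<le> N")
      case True
      have "exp (- (2 * sum \<delta> {..j} / m)) \<le> 1" using m \<delta> by (simp add: sum_nonneg)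
      then have "q * exp (- (2 * sum \<delta> {..j} / m)) \<le> q * 1" using q0 by (intro mult_left_mono) auto
      then show ?thesis using q[OF less.prems True] by simp
    next
      case False
      then obtain k where k: "j = Suc k" by (cases j) auto
      have N_j: "N \<le> j" using False by simp
      let ?E = "q * exp (- (2 * sum \<delta> {..k} / m))"
      have "?E * (y j / m) = (\<Sum>i\<in>{e j<..<j}. ?E * y i)"
        using Vy[OF N_j] by (simp add: V_def sum_distrib_left[symmetric])
      also have "\<dots> \<le> V X j"
        unfolding V_def
      proof (rule sum_mono)
        fix i assume i: "i \<in> {e j<..<j}"
        have "?E \<le> q * exp (- (2 * sum \<delta> {..i} / m))"
          using i k m \<delta> q0 by (intro mult_left_mono) (auto intro!: divide_right_mono sum_mono2)
        also have "\<dots> \<le> R i" using i less.IH by auto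
        finally show "?E * y i \<le> X i" using X_eq[of i] y_pos[of i] i by (simp add: mult_right_mono)
      qed
      finally have VX: "?E * (y j / m) \<le> V X j" .
      define x where "x = \<delta> j / m"
      have x: "0 \<le> x" "x \<le> 1 / 2" using N(3)[OF N_j] \<delta>(1)[of j] m by (auto simp: x_def field_simps)
      \<comment> \<open>Holds on \<open>[0, 1/2]\<close>. This is the reason for
        \<open>\<delta> i \<le> m / 2\<close> beyond \<open>N\<close> and for the factor 2 in the
        lower bound.\<close>
      have "exp (- (2 * x)) \<le> 1 - x"
      proof -
        have "1 \<le> (1 + 2 * x) * (1 - x)" using x mult_left_mono[of x "1/2" x] by (simp add: algebra_simps)
        also have "\<dots> \<le> exp (2 * x) * (1 - x)"
          using x exp_ge_add_one_self[of "2 * x"] by (intro mult_right_mono) auto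
        finally show ?thesis by (simp add: exp_minus field_simps)
      qed
      then have "exp (- (2 * x)) * ?E \<le> (1 - x) * ?E" using q0 by (intro mult_right_mono) auto
      also have "\<dots> = (m - \<delta> j) * (?E / m)" using m by (simp add: x_def field_simps)
      finally have "exp (- (2 * x)) * ?E * y j \<le> (m - \<delta> j) * (?E / m) * y j"
        using y_pos[OF less.prems] by (intro mult_right_mono) auto
      also have "\<dots> = (m - \<delta> j) * (?E * (y j / m))" by simp
      also have "\<dots> \<le> (m - \<delta> j) * V X j" using N(3)[OF N_j] m by (intro mult_left_mono VX) auto
      also have "\<dots> \<le> X j" using rec[OF N_j] by (simp add: algebra_simps abs_le_iff)
      finally have "exp (- (2 * x)) * ?E \<le> R j" using y_pos[OF less.prems] by (simp add: R_def field_simps)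
      moreover have "exp (- (2 * x)) * ?E = q * exp (- (2 * sum \<delta> {..j} / m))"
        by (simp add: k x_def exp_add[symmetric] add_divide_distrib algebra_simps)
      ultimately show ?thesis by simp
    qed
  qed
  define c where "c = q * exp (- (2 * S / m))"
  have c: "0 < c" using q0 by (simp add: c_def)
  have R_ge: "c \<le> R j" if "1 \<le> j" for j
  proof -
    have "c \<le> q * exp (- (2 * sum \<delta> {..j} / m))"
      unfolding c_def using sum_le_S[of "{..j}"] m q0
      by (intro mult_left_mono) (auto intro: divide_right_mono)
    with lower[OF that] show ?thesis by simp
  qed

  define Dr where "Dr n = \<bar>R (Suc n) - R n\<bar>" for n
  define p where "p n = C / m * (\<delta> (Suc n) + \<delta> n / m)" for n
  have telescope: "\<bar>R n - R k\<bar> \<le> (\<Sum>j\<in>{k..<n}. Dr j)" if "k \<le> n" for n k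
    using that
  proof (induction n rule: dec_induct)
    case (step n)
    have "\<bar>R (Suc n) - R k\<bar> \<le> \<bar>R (Suc n) - R n\<bar> + \<bar>R n - R k\<bar>" by simp
    with step show ?case by (simp add: Dr_def)
  qed simp
  have step: "Dr n \<le> w n * (\<Sum>j\<in>{e n<..<n}. Dr j) + p n" if n: "N \<le> n" for n
  proof -
    have Suc_n: "N \<le> Suc n" and n1: "1 \<le> n" using n N by auto
    have en: "Suc (e n) < n" using e_less N(3)[OF n] by auto
    have eSn: "Suc (e (Suc n)) < Suc n" using e_less N(3)[OF Suc_n] by auto
    have y0: "0 < y n" "0 < y (Suc n)" using y_pos n1 by auto
    \<comment> \<open>Indicator that the oldest station \<open>Suc (e n)\<close> drops out when the
      window passes from \<open>n\<close> to \<open>Suc n\<close>.\<close>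
    define chi :: real where "chi = (if e (Suc n) = Suc (e n) then 1 else 0)"
    have shift: "V Z (Suc n) = V Z n + Z n - chi * Z (Suc (e n))" for Z
    proof (cases "e (Suc n) = Suc (e n)")
      case True
      have "{e n<..<n} = insert (Suc (e n)) {Suc (e n)<..<n}" "{Suc (e n)<..<Suc n} = insert n {Suc (e n)<..<n}"
        using en by auto
      then show ?thesis by (simp add: V_def chi_def True)
    next
      case False
      then have eq: "e (Suc n) = e n" using e_Suc N(3)[OF n] by auto
      have "{e n<..<Suc n} = insert n {e n<..<n}" using en by auto
      then show ?thesis by (simp add: V_def chi_def eq)
    qed
    define \<eta> where "\<eta> i = X i - m * V X i" for i
    have X_next: "X (Suc n) = (1 + m) * X n - m * chi * X (Suc (e n)) + \<eta> (Suc n) - \<eta> n"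
      unfolding \<eta>_def shift[of X] by (simp add: algebra_simps)
    have y_next: "y (Suc n) = (1 + m) * y n - m * chi * y (Suc (e n))"
    proof -
      have "m * V y (Suc n) = y (Suc n)" "m * V y n = y n" using Vy n Suc_n m by simp_all
      then show ?thesis unfolding shift[of y] by (simp add: algebra_simps)
    qed
    \<comment> \<open>Subtracting \<open>R n\<close> times the recursion of \<open>y\<close> cancels
      the terms with \<open>1 + m\<close>; what remains is a difference of ratios inside the window
      and the errors.\<close>
    have "(R (Suc n) - R n) * y (Suc n) = X (Suc n) - R n * y (Suc n)"
      using X_eq[of "Suc n"] by (simp add: algebra_simps)
    also have "\<dots> = m * chi * y (Suc (e n)) * (R n - R (Suc (e n))) + (\<eta> (Suc n) - \<eta> n)"
      unfolding X_next y_next using X_eq[OF n1] X_eq[of "Suc (e n)"] by (simp add: algebra_simps)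
    finally have "R (Suc n) - R n = (m * chi * y (Suc (e n)) * (R n - R (Suc (e n))) + (\<eta> (Suc n) - \<eta> n)) / y (Suc n)"
      using y0 by (simp only: eq_divide_eq) simp
    then have "R (Suc n) - R n = m * chi * y (Suc (e n)) / y (Suc n) * (R n - R (Suc (e n))) + (\<eta> (Suc n) - \<eta> n) / y (Suc n)"
      by (simp add: add_divide_distrib)
    then have "Dr n \<le> \<bar>m * chi * y (Suc (e n)) / y (Suc n) * (R n - R (Suc (e n)))\<bar> + \<bar>(\<eta> (Suc n) - \<eta> n) / y (Suc n)\<bar>"
      unfolding Dr_def by (simp only: abs_triangle_ineq)
    moreover have "\<bar>m * chi * y (Suc (e n)) / y (Suc n) * (R n - R (Suc (e n)))\<bar> \<le> w n * (\<Sum>j\<in>{e n<..<n}. Dr j)"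
    proof -
      have "0 \<le> m * chi * y (Suc (e n)) / y (Suc n)" "m * chi * y (Suc (e n)) / y (Suc n) \<le> w n"
        using m y_pos[of "Suc (e n)"] y0 y_w[of n] w[of n] N(3)[OF n] by (auto simp: chi_def)
      moreover have "\<bar>R n - R (Suc (e n))\<bar> \<le> (\<Sum>j\<in>{e n<..<n}. Dr j)"
        using telescope[of "Suc (e n)" n] en by (simp add: atLeastSucLessThan_greaterThanLessThan)
      ultimately show ?thesis unfolding abs_mult by (intro mult_mono) auto
    qed
    moreover have "\<bar>(\<eta> (Suc n) - \<eta> n) / y (Suc n)\<bar> \<le> p n"
    proof -
      have eta: "\<bar>\<eta> i\<bar> \<le> \<delta> i * (C * (y i / m))" if i: "N \<le> i" for i
      proof -
        have "V X i \<le> (\<Sum>j\<in>{e i<..<i}. C * y j)"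
          unfolding V_def
        proof (rule sum_mono)
          fix j assume j: "j \<in> {e i<..<i}"
          then show "X j \<le> C * y j" using X_eq[of j] R_le[of j] y_pos[of j] by (simp add: mult_right_mono)
        qed
        also have "\<dots> = C * (y i / m)" using Vy[OF i] by (simp add: V_def sum_distrib_left[symmetric])
        finally have "\<delta> i * V X i \<le> \<delta> i * (C * (y i / m))" using \<delta> by (intro mult_left_mono) auto
        then show ?thesis using rec[OF i] by (simp add: \<eta>_def)
      qed
      have "y n \<le> V y (Suc n)"
        unfolding V_def using eSn y_pos by (intro member_le_sum) (auto intro: less_imp_le)
      then have yn: "y n \<le> y (Suc n) / m" using Vy[OF Suc_n] by simp
      have "\<bar>\<eta> (Suc n) - \<eta> n\<bar> \<le> \<bar>\<eta> (Suc n)\<bar> + \<bar>\<eta> n\<bar>" by simp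
      also have "\<dots> \<le> \<delta> (Suc n) * (C * (y (Suc n) / m)) + \<delta> n * (C * (y n / m))"
        by (intro add_mono eta n Suc_n)
      also have "\<dots> \<le> \<delta> (Suc n) * (C * (y (Suc n) / m)) + \<delta> n * (C * (y (Suc n) / m / m))"
        using \<delta> C m yn by (intro add_left_mono mult_left_mono divide_right_mono) auto
      also have "\<dots> = p n * y (Suc n)" by (simp add: p_def algebra_simps add_divide_distrib)
      finally show ?thesis using y0 by (simp add: abs_divide divide_le_eq)
    qed
    ultimately show ?thesis by linarith
  qed

  have p_nonneg: "0 \<le> p n" for n using C m \<delta> by (simp add: p_def)
  have p_summable: "summable p"
    unfolding p_def using \<delta>(2) by (intro summable_mult summable_add summable_divide) (simp_all add: summable_Suc_iff)
  obtain J0 where J0: "\<And>j. J0 \<le> j \<Longrightarrow> \<kappa> j \<le> \<theta>" using \<kappa>_le by (auto simp: eventually_sequentially)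
  define J where "J = max N J0"
  define B where "B = (\<Sum>j\<in>{1..<J}. \<bar>\<kappa> j\<bar> * Dr j) + suminf p"
  have Dr_nonneg: "0 \<le> Dr n" for n by (simp add: Dr_def)
  \<comment> \<open>Summing \<open>step\<close> and exchanging the sums, \<open>Dr j\<close> appears
    with weight at most \<open>\<kappa> j\<close>. Indices below \<open>J\<close> give a constant;
    for the others the weight is at most \<open>\<theta> < 1\<close>, and since the sum is finite,
    \<open>\<theta>\<close> times it can be moved to the left.\<close>
  have bound: "(\<Sum>n\<in>{J..K}. Dr n) \<le> B / (1 - \<theta>)" for K
  proof -
    have J1: "1 \<le> J" "N \<le> J" "N0 \<le> J" using N by (auto simp: J_def)
    have "(\<Sum>n\<in>{J..K}. Dr n) \<le> (\<Sum>n\<in>{J..K}. (\<Sum>j\<in>{e n<..<n}. w n * Dr j) + p n)"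
      using step J1 by (intro sum_mono) (auto simp: sum_distrib_left)
    also have "\<dots> = (\<Sum>n\<in>{J..K}. \<Sum>j\<in>{e n<..<n}. w n * Dr j) + (\<Sum>n\<in>{J..K}. p n)"
      by (rule sum.distrib)
    also have "(\<Sum>n\<in>{J..K}. p n) \<le> suminf p"
      using p_nonneg p_summable by (intro sum_le_suminf) auto
    also have "(\<Sum>n\<in>{J..K}. \<Sum>j\<in>{e n<..<n}. w n * Dr j) = (\<Sum>n\<in>{J..K}. \<Sum>j\<in>{j\<in>{1..<Suc K}. e n < j \<and> j < n}. w n * Dr j)"
      by (intro sum.cong refl) auto
    also have "\<dots> = (\<Sum>j\<in>{1..<Suc K}. \<Sum>n\<in>{n\<in>{J..K}. e n < j \<and> j < n}. w n * Dr j)"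
      by (rule sum.swap_restrict) auto
    also have "\<dots> = (\<Sum>j\<in>{1..<Suc K}. (\<Sum>n\<in>{n\<in>{J..K}. e n < j \<and> j < n}. w n) * Dr j)"
      by (simp add: sum_distrib_right)
    also have "\<dots> \<le> (\<Sum>j\<in>{1..<Suc K}. \<kappa> j * Dr j)"
    proof (intro sum_mono mult_right_mono Dr_nonneg)
      fix j assume j: "j \<in> {1..<Suc K}"
      have "(\<Sum>n\<in>{n\<in>{J..K}. e n < j \<and> j < n}. w n) \<le> (\<Sum>n\<in>{n\<in>{N0..K}. e n < j \<and> j < n}. w n)"
        using J1 w by (intro sum_mono2) auto
      also have "\<dots> \<le> \<kappa> j" using j by (intro \<kappa>) auto
      finally show "(\<Sum>n\<in>{n\<in>{J..K}. e n < j \<and> j < n}. w n) \<le> \<kappa> j" .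
    qed
    also have "\<dots> \<le> (\<Sum>j\<in>{1..<J} \<union> {J..K}. if j < J then \<bar>\<kappa> j\<bar> * Dr j else \<theta> * Dr j)"
    proof -
      have "(\<Sum>j\<in>{1..<Suc K}. \<kappa> j * Dr j) \<le> (\<Sum>j\<in>{1..<Suc K}. if j < J then \<bar>\<kappa> j\<bar> * Dr j else \<theta> * Dr j)"
        using J0 Dr_nonneg by (intro sum_mono) (auto simp: J_def intro!: mult_right_mono)
      also have "\<dots> \<le> (\<Sum>j\<in>{1..<J} \<union> {J..K}. if j < J then \<bar>\<kappa> j\<bar> * Dr j else \<theta> * Dr j)"
        using Dr_nonneg J1 by (intro sum_mono2) auto
      finally show ?thesis .
    qed
    also have "\<dots> = (\<Sum>j\<in>{1..<J}. \<bar>\<kappa> j\<bar> * Dr j) + \<theta> * (\<Sum>j\<in>{J..K}. Dr j)"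
      by (subst sum.union_disjoint) (auto simp: sum_distrib_left)
    finally have "(1 - \<theta>) * (\<Sum>n\<in>{J..K}. Dr n) \<le> B" by (simp add: B_def algebra_simps)
    then show ?thesis using \<theta> by (simp add: field_simps)
  qed
  have "summable (\<lambda>n. Dr (n + J))"
  proof (rule summableI_nonneg_bounded)
    fix k
    have "(\<Sum>i<k. Dr (i + J)) \<le> (\<Sum>n\<in>{J..J + k}. Dr n)"
    proof -
      have "(\<Sum>i<k. Dr (i + J)) = (\<Sum>n\<in>{J..<J + k}. Dr n)"
        by (rule sum.reindex_bij_witness[of _ "\<lambda>n. n - J" "\<lambda>i. i + J"]) auto
      also have "\<dots> \<le> (\<Sum>n\<in>{J..J + k}. Dr n)" using Dr_nonneg by (intro sum_mono2) auto
      finally show ?thesis .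
    qed
    also have "\<dots> \<le> B / (1 - \<theta>)" by (rule bound)
    finally show "(\<Sum>i<k. Dr (i + J)) \<le> B / (1 - \<theta>)" .
  qed (rule Dr_nonneg)
  then have "summable (\<lambda>n. norm (R (Suc n) - R n))"
    by (subst (asm) summable_iff_shift) (simp add: Dr_def[abs_def])
  then have "summable (\<lambda>n. R (Suc n) - R n)" by (rule summable_norm_cancel)
  then have "convergent (\<lambda>n. \<Sum>k<n. R (Suc k) - R k)" by (simp add: summable_iff_convergent)
  then have "convergent (\<lambda>n. R n - R 0)" by (simp add: sum_lessThan_telescope)
  then obtain L where "(\<lambda>n. R n - R 0) \<longlonglongrightarrow> L" by (auto simp: convergent_def)
  from tendsto_add[OF this tendsto_const[of "R 0"]] have lim: "R \<longlonglongrightarrow> L + R 0" by simp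
  have "c \<le> L + R 0"
    using R_ge by (intro tendsto_lowerbound[OF lim]) (auto simp: eventually_sequentially intro: exI[of _ 1])
  then have "0 < L + R 0" using c by simp
  moreover have "(\<lambda>n. X n / y n) \<longlonglongrightarrow> L + R 0" using lim by (simp add: R_def[abs_def])
  ultimately show thesis by (rule that)
qed

text \<open>Both \<open>X\<close> and the exact solution \<open>Y\<close> are compared with the
  reference solution \<open>y\<close>, and the quotient of the limits is taken. So \<open>y\<close>
  may be chosen for convenience, for instance geometric.\<close>

theorem partial_sums_limit:
  fixes X Y \<delta> :: "nat \<Rightarrow> real"
  assumes "\<And>j. 1 \<le> j \<Longrightarrow> 0 < X j" "\<And>i. 0 \<le> \<delta> i" "summable \<delta>"
    and "\<And>i. N1 \<le> i \<Longrightarrow> \<bar>X i - m * (\<Sum>j\<in>{e i<..<i}. X j)\<bar> \<le> \<delta> i * (\<Sum>j\<in>{e i<..<i}. X j)"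
    and "\<And>j. 1 \<le> j \<Longrightarrow> 0 < Y j"
    and "\<And>i. N2 \<le> i \<Longrightarrow> Y i = m * (\<Sum>j\<in>{e i<..<i}. Y j)"
  obtains W where "0 < W" "(\<lambda>n. (\<Sum>j=1..n. X j) / Y (Suc n)) \<longlonglongrightarrow> W"
proof -
  obtain R where R: "0 < R" "(\<lambda>n. X n / y n) \<longlonglongrightarrow> R"
    using solution_limit[OF assms(1-4)] by blast
  obtain R' where R': "0 < R'" "(\<lambda>n. Y n / y n) \<longlonglongrightarrow> R'"
    using solution_limit[where X = Y and \<delta> = "\<lambda>_. 0" and ?N1.0 = N2] assms(5,6) by auto
  have "(\<lambda>n. (\<Sum>j=1..n. X j) / y (Suc n) / (Y (Suc n) / y (Suc n))) \<longlonglongrightarrow> R / (g - 1) / R'"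
    using R' by (intro tendsto_divide partial_sum_ratio_tendsto[OF y_pos g ratio R(2)] LIMSEQ_Suc[OF R'(2)]) auto
  moreover have "(\<Sum>j=1..n. X j) / y (Suc n) / (Y (Suc n) / y (Suc n)) = (\<Sum>j=1..n. X j) / Y (Suc n)" for n
    using y_pos[of "Suc n"] by simp
  ultimately have "(\<lambda>n. (\<Sum>j=1..n. X j) / Y (Suc n)) \<longlonglongrightarrow> R / (g - 1) / R'" by (simp only:)
  moreover have "0 < R / (g - 1) / R'" using R R' g by simp
  ultimately show thesis using that by blast
qed

end

section \<open>Queueing disciplines and the mean sequence\<close>

lemma discipline_step:
  "queueing_discipline d \<Longrightarrow> 2 \<le> i \<Longrightarrow> d (Suc i) = d i \<or> d (Suc i) = Suc (d i)"
  unfolding queueing_discipline_def by (metis Suc_eq_plus1 le_Suc_eq le_antisym)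

lemma discipline_bounds:
  assumes "queueing_discipline d" "2 \<le> i"
  shows "2 \<le> d i \<and> d i \<le> i"
  using assms(2)
proof (induction i rule: dec_induct)
  case base
  then show ?case using assms by (simp add: queueing_discipline_def)
next
  case (step i)
  then show ?case using discipline_step[OF assms(1), of i] by auto
qed

lemma discipline_mono:
  assumes "queueing_discipline d" "1 \<le> i" "i \<le> j"
  shows "d i \<le> d j"
  using assms(3)
proof (induction j rule: dec_induct)
  case (step j)
  have "d j \<le> d (Suc j)"
  proof (cases "j = 1")
    case True
    then show ?thesis using assms(1) by (simp add: queueing_discipline_def numeral_2_eq_2)
  next
    case False
    then show ?thesis using discipline_step[OF assms(1), of j] step assms(2) by auto
  qed
  with step show ?case by simp
qed simp

lemma mean_seq_pos: "0 < m \<Longrightarrow> 0 < mean_seq m d n"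
proof (induction n rule: less_induct)
  case (less n)
  then show ?case by (cases n) (auto intro!: mult_pos_pos sum_pos)
qed

text \<open>Attaching \<open>mean_seq m d (i - 1)\<close> to station \<open>i\<close> gives the mean
  recursion exactly the windows of the increments of \<open>H\<close>.\<close>

lemma mean_seq_window:
  assumes "queueing_discipline d" "2 \<le> i"
  shows "mean_seq m d (i - 1) = m * (\<Sum>j\<in>{i - d i<..<i}. mean_seq m d (j - 1))"
proof -
  obtain n where i: "i = Suc (Suc n)" using assms(2) by (metis Suc_1 Suc_le_D add_2_eq_Suc le_Suc_ex)
  have b: "2 \<le> d i" "d i \<le> i" using discipline_bounds[OF assms] by auto
  have "(\<Sum>k=0..d i - 2. mean_seq m d (n - k)) = (\<Sum>j\<in>{i - d i<..<i}. mean_seq m d (j - 1))"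
    by (rule sum.reindex_bij_witness[of _ "\<lambda>j. i - 1 - j" "\<lambda>k. i - 1 - k"])
       (use b in \<open>auto simp: i Suc_diff_le\<close>)
  then show ?thesis by (simp add: i)
qed

section \<open>The characteristic polynomial\<close>

lemma poly_char_poly: "poly (char_poly m a) x = x ^ Suc a - m * (\<Sum>k\<le>a. x ^ k)"
  by (simp add: char_poly_def poly_monom poly_sum atLeast0AtMost)

lemma char_poly_root_above:
  assumes "0 < m" "0 \<le> x" "poly (char_poly m a) x \<le> 0"
  obtains z where "x \<le> z" "0 < z" "poly (char_poly m a) z = 0"
proof -
  \<comment> \<open>From \<open>b \<ge> 1\<close> and \<open>b \<ge> m * (a + 1)\<close> the leading
    power dominates the sum, so the polynomial is nonnegative at \<open>b\<close> and the
    intermediate value theorem applies.\<close>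
  define b where "b = x + 1 + m * real (Suc a)"
  have b: "1 \<le> b" "m * real (Suc a) \<le> b" "x \<le> b" using assms by (auto simp: b_def)
  have "m * (\<Sum>k\<le>a. b ^ k) \<le> m * (\<Sum>k\<le>a. b ^ a)"
    using assms b by (intro mult_left_mono sum_mono power_increasing) auto
  also have "\<dots> = (m * real (Suc a)) * b ^ a" by simp
  also have "\<dots> \<le> b * b ^ a" using b by (intro mult_right_mono) auto
  finally have "0 \<le> poly (char_poly m a) b" by (simp add: poly_char_poly)
  moreover have "continuous_on {x..b} (\<lambda>z. poly (char_poly m a) z)" by (intro continuous_intros)
  ultimately obtain z where z: "x \<le> z" "poly (char_poly m a) z = 0"
    using IVT'[of "poly (char_poly m a)" x 0 b] assms b by auto
  have "(\<Sum>k\<le>a. (0::real) ^ k) = 1"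
    by (simp add: power_0_left sum.delta')
  then have "z \<noteq> 0" using z(2) assms(1) by (auto simp: poly_char_poly)
  then show thesis using that z assms(2) by auto
qed

lemma
  assumes "0 < m"
  shows rho_root: "0 < rho m a" "rho m a ^ Suc a = m * (\<Sum>k\<le>a. rho m a ^ k)"
    and rho_ge: "0 < z \<Longrightarrow> poly (char_poly m a) z = 0 \<Longrightarrow> z \<le> rho m a"
proof -
  let ?R = "{x. 0 < x \<and> poly (char_poly m a) x = 0}"
  have "(\<Sum>k\<le>a. (0::real) ^ k) = 1" by (simp add: power_0_left sum.delta')
  then have P0: "poly (char_poly m a) 0 = - m" by (simp add: poly_char_poly)
  then have "char_poly m a \<noteq> 0" using assms by auto
  from poly_roots_finite[OF this] have fin: "finite ?R" by (rule rev_finite_subset) auto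
  obtain z where "0 < z" "poly (char_poly m a) z = 0"
    using char_poly_root_above[OF assms order_refl, of a] P0 assms by auto
  then have "?R \<noteq> {}" by auto
  from Max_in[OF fin this] show "0 < rho m a" "rho m a ^ Suc a = m * (\<Sum>k\<le>a. rho m a ^ k)"
    by (auto simp: rho_def poly_char_poly)
  show "0 < z \<Longrightarrow> poly (char_poly m a) z = 0 \<Longrightarrow> z \<le> rho m a" for z
    unfolding rho_def using fin by (intro Max_ge) auto
qed

text \<open>The value at 1 is \<open>1 - m * (a + 1)\<close>; were it nonpositive, there would be a
  root in \<open>[1, \<infinity>)\<close>.\<close>

lemma rho_less_1_imp:
  assumes "0 < m" "rho m a < 1"
  shows "m * real (Suc a) < 1"
proof (rule ccontr)
  assume "\<not> m * real (Suc a) < 1"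
  then have "poly (char_poly m a) 1 \<le> 0" by (simp add: poly_char_poly)
  then obtain z where "1 \<le> z" "0 < z" "poly (char_poly m a) z = 0"
    using char_poly_root_above[OF assms(1), of 1 a] by auto
  with rho_ge[OF assms(1), of z a] assms(2) show False by simp
qed

text \<open>In the root equation, bounding the powers from above by the last one gives the first
  claim. Bounding them from below by 1 gives \<open>m * (a + 1) \<le> \<rho> ^ (a + 1)\<close>, so
  the left side of the second claim, the total weight required by \<open>window_recursion\<close>,
  is at most \<open>1 / \<rho>\<close>.\<close>

lemma rho_gt_1_imp:
  assumes "0 < m" "1 < rho m a"
  shows "1 < m * real (Suc a)" "m * real (Suc a) * (1 / rho m a) ^ Suc (Suc a) < 1"
proof -
  let ?r = "rho m a"
  have r: "0 < ?r" "?r ^ Suc a = m * (\<Sum>k\<le>a. ?r ^ k)" using rho_root[OF assms(1)] by auto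
  have "m * (\<Sum>k\<le>a. ?r ^ k) \<le> m * (\<Sum>k\<le>a. ?r ^ a)"
    using assms by (intro mult_left_mono sum_mono power_increasing) auto
  then have "?r * ?r ^ a \<le> (m * real (Suc a)) * ?r ^ a" using r(2) by simp
  then have "?r \<le> m * real (Suc a)" using r(1) by simp
  then show "1 < m * real (Suc a)" using assms by simp
  have "m * real (Suc a) = m * (\<Sum>k\<le>a. 1)" by simp
  also have "\<dots> \<le> m * (\<Sum>k\<le>a. ?r ^ k)"
    using assms by (intro mult_left_mono sum_mono one_le_power) auto
  finally have "m * real (Suc a) \<le> ?r ^ Suc a" using r(2) by simp
  then have "m * real (Suc a) / ?r ^ Suc (Suc a) \<le> ?r ^ Suc a / ?r ^ Suc (Suc a)"
    using r(1) by (intro divide_right_mono) auto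
  also have "\<dots> = 1 / ?r" using r(1) by simp
  also have "\<dots> < 1" using assms by simp
  finally show "m * real (Suc a) * (1 / ?r) ^ Suc (Suc a) < 1" by (simp only: power_one_over times_divide_eq_right mult_1_right)
qed

section \<open>Reference solutions of the mean recursion\<close>

text \<open>Once the windows are full, \<open>\<rho> ^ i\<close> solves the recursion exactly. The
  station leaving the window lies \<open>a + 2\<close> places before \<open>Suc i\<close>, which
  gives the weight \<open>m / \<rho> ^ (a + 2)\<close>, and each station belongs to at most
  \<open>a + 1\<close> windows.\<close>

lemma geometric_window_recursion:
  assumes m: "0 < m" and rho: "1 < rho m a"
    and d: "\<And>i. 1 \<le> i \<Longrightarrow> d i = min (Suc (Suc a)) i"
  shows "window_recursion (\<lambda>i. i - d i) m (\<lambda>i. rho m a ^ i) (Suc (Suc (Suc a)))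
    (\<lambda>_. m * (1 / rho m a) ^ Suc (Suc a)) (\<lambda>_. m * real (Suc a) * (1 / rho m a) ^ Suc (Suc a))
    (m * real (Suc a) * (1 / rho m a) ^ Suc (Suc a)) (rho m a)"
proof
  let ?r = "rho m a"
  have r: "0 < ?r" "?r ^ Suc a = m * (\<Sum>k\<le>a. ?r ^ k)" using rho_root[OF m] by auto
  show "0 < m" "1 < ?r" by fact+
  show "?r ^ i = m * (\<Sum>j\<in>{i - d i<..<i}. ?r ^ j)" if i: "Suc (Suc (Suc a)) \<le> i" for i
  proof -
    have "(\<Sum>j\<in>{i - d i<..<i}. ?r ^ j) = (\<Sum>k\<le>a. ?r ^ (k + (i - Suc a)))"
      by (rule sum.reindex_bij_witness[of _ "\<lambda>k. k + (i - Suc a)" "\<lambda>j. j - (i - Suc a)"])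
         (use i d[of i] in auto)
    also have "\<dots> = (\<Sum>k\<le>a. ?r ^ k) * ?r ^ (i - Suc a)" by (simp add: power_add sum_distrib_right)
    finally have "m * (\<Sum>j\<in>{i - d i<..<i}. ?r ^ j) = ?r ^ Suc a * ?r ^ (i - Suc a)" using r(2) by simp
    also have "\<dots> = ?r ^ i" unfolding power_add[symmetric] using i by simp
    finally show ?thesis by simp
  qed
  show "m * ?r ^ Suc (i - d i) / ?r ^ Suc i \<le> m * (1 / ?r) ^ Suc (Suc a)"
    if i: "Suc (Suc (Suc a)) \<le> i" for i
  proof -
    have "Suc (i - d i) + Suc (Suc a) = Suc i" using i d[of i] by simp
    then have "?r ^ Suc i = ?r ^ Suc (i - d i) * ?r ^ Suc (Suc a)"
      by (simp only: power_add[symmetric])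
    then show ?thesis using r(1) by (simp add: power_one_over)
  qed
  show "(\<Sum>i\<in>{i \<in> {Suc (Suc (Suc a))..N}. i - d i < j \<and> j < i}. m * (1 / ?r) ^ Suc (Suc a))
      \<le> m * real (Suc a) * (1 / ?r) ^ Suc (Suc a)" if "1 \<le> j" for j N
  proof -
    have "{i \<in> {Suc (Suc (Suc a))..N}. i - d i < j \<and> j < i} \<subseteq> {j<..<j + Suc (Suc a)}"
      using d by auto
    from card_mono[OF _ this] have "card {i \<in> {Suc (Suc (Suc a))..N}. i - d i < j \<and> j < i} \<le> Suc a" by simp
    then have "real (card {i \<in> {Suc (Suc (Suc a))..N}. i - d i < j \<and> j < i}) \<le> real (Suc a)" by (simp only: of_nat_le_iff)
    then have "real (card {i \<in> {Suc (Suc (Suc a))..N}. i - d i < j \<and> j < i}) * (m * (1 / ?r) ^ Suc (Suc a))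
        \<le> real (Suc a) * (m * (1 / ?r) ^ Suc (Suc a))"
      using m r by (intro mult_right_mono) auto
    then show ?thesis by (simp add: mult_ac)
  qed
  show "m * real (Suc a) * (1 / ?r) ^ Suc (Suc a) < 1" by (rule rho_gt_1_imp[OF m rho])
  show "(\<lambda>n. ?r ^ Suc n / ?r ^ n) \<longlonglongrightarrow> ?r" using r(1) by simp
  show "0 \<le> m * (1 / ?r) ^ Suc (Suc a)" using m r by simp
qed (use m rho_root(1)[OF m, of a] d in auto)

text \<open>No geometric sequence solves a recursion of growing order, so \<open>mean_seq\<close> is
  its own reference. It grows at least geometrically, hence the station leaving the window of
  \<open>i\<close> contributes only \<open>O((1 / r) ^ d i)\<close>, and the total weights tend to
  0.\<close>

lemma unbounded_window_recursion:
  assumes m: "0 < m" and disc: "queueing_discipline d" and lim: "filterlim d at_top sequentially"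
  shows "\<exists>w \<kappa>. window_recursion (\<lambda>i. i - d i) m (\<lambda>i. mean_seq m d (i - 1)) 2 w \<kappa> (1 / 2) (1 + m)"
proof -
  define y where "y i = mean_seq m d (i - 1)" for i
  have y_pos: "0 < y j" for j using mean_seq_pos[OF m] by (simp add: y_def)
  have y_rec: "y i = m * (\<Sum>j\<in>{i - d i<..<i}. y j)" if "2 \<le> i" for i
    using mean_seq_window[OF disc that, of m] by (simp add: y_def)
  note db = discipline_bounds[OF disc]
  obtain h where "1 < real h * m" using reals_Archimedean3[OF m] by blast
  then have h: "1 < m * real h" by (simp add: mult.commute)
  have h0: "0 < h" using h by (cases h) auto
  define r where "r = root h (m * real h)"
  have r: "1 < r" "r ^ h = m * real h" using h h0 by (simp_all add: r_def)
  have "eventually (\<lambda>i. Suc h \<le> d i) sequentially" using lim by (simp add: filterlim_at_top)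
  then obtain N where N: "\<And>i. N \<le> i \<Longrightarrow> Suc h \<le> d i" by (auto simp: eventually_sequentially)
  \<comment> \<open>Pays for up to \<open>N + h + 2\<close> steps of the crude growth
    \<open>m * y i \<le> y (Suc i)\<close>. At larger distances a window holds \<open>h\<close>
    predecessors, and \<open>m * h = r ^ h\<close> carries the induction.\<close>
  define c where "c = (min 1 m / r) ^ (N + h + 2)"
  have c: "0 < c" using m r by (simp add: c_def)
  have y_Suc: "m * y i \<le> y (Suc i)" if "1 \<le> i" for i
  proof -
    have "y i \<le> (\<Sum>j\<in>{Suc i - d (Suc i)<..<Suc i}. y j)"
      using db[of "Suc i"] that y_pos by (intro member_le_sum) (auto intro: less_imp_le)
    then show ?thesis using y_rec[of "Suc i"] that m by simp
  qed
  have grow: "c * r ^ (n - j) * y j \<le> y n" if "1 \<le> j" "j \<le> n" for j n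
    using that(2)
  proof (induction n rule: less_induct)
    case (less n)
    show ?case
    proof (cases "n - j \<le> N + h + 2")
      case True
      have "min 1 m ^ k * y j \<le> y (j + k)" for k
      proof (induction k)
        case (Suc k)
        have "min 1 m ^ Suc k * y j \<le> m * (min 1 m ^ k * y j)"
          using m y_pos[of j] by (simp add: mult_right_mono mult.assoc)
        also have "\<dots> \<le> m * y (j + k)" using Suc m by (intro mult_left_mono) auto
        also have "\<dots> \<le> y (j + Suc k)" using y_Suc[of "j + k"] that by simp
        finally show ?case .
      qed simp
      from this[of "n - j"] have le: "min 1 m ^ (n - j) * y j \<le> y n" using less.prems by simp
      have "c * r ^ (n - j) \<le> (min 1 m / r) ^ (n - j) * r ^ (n - j)"
        unfolding c_def using True m r
        by (intro mult_right_mono power_decreasing) (auto simp: min_def divide_le_eq)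
      also have "\<dots> = min 1 m ^ (n - j)" using r by (simp add: power_divide)
      finally have "c * r ^ (n - j) * y j \<le> min 1 m ^ (n - j) * y j"
        using y_pos[of j] by (intro mult_right_mono) auto
      with le show ?thesis by simp
    next
      case False
      have dn: "Suc h \<le> d n" using N False by simp
      have "c * r ^ (n - j) * y j = m * (\<Sum>i\<in>{n - h..<n}. c * r ^ (n - j) / r ^ h * y j)"
        using r h h0 m False by (simp add: field_simps)
      also have "\<dots> \<le> m * (\<Sum>i\<in>{n - h..<n}. y i)"
      proof (intro mult_left_mono sum_mono)
        fix i assume i: "i \<in> {n - h..<n}"
        have "r ^ (n - j) / r ^ h \<le> r ^ (i - j)"
        proof -
          have "r ^ (n - j) \<le> r ^ (i - j + h)" using i r False by (intro power_increasing) auto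
          moreover have "0 < r ^ h" using r(1) by simp
          ultimately show ?thesis by (simp only: pos_divide_le_eq power_add)
        qed
        then have "c * r ^ (n - j) / r ^ h * y j \<le> c * r ^ (i - j) * y j"
          using c y_pos[of j] by (intro mult_right_mono) (auto simp flip: times_divide_eq_right)
        also have "\<dots> \<le> y i" using i False by (intro less.IH) auto
        finally show "c * r ^ (n - j) / r ^ h * y j \<le> y i" .
      qed (use m in simp)
      also have "\<dots> \<le> m * (\<Sum>i\<in>{n - d n<..<n}. y i)"
        using m dn False y_pos by (intro mult_left_mono sum_mono2) (auto intro: less_imp_le)
      also have "\<dots> = y n" using y_rec[of n] False by simp
      finally show ?thesis .
    qed
  qed
  \<comment> \<open>The weight \<open>(1 / r) ^ d i\<close> is split into two factors
    \<open>s ^ d i\<close>. One is at most \<open>s ^ d j\<close> by monotonicity of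
    \<open>d\<close>; the other is at most \<open>s ^ (i - j)\<close> because \<open>j\<close> lies
    in the window of \<open>i\<close>, which makes the sum over \<open>i\<close> geometric.\<close>
  define s where "s = 1 / sqrt r"
  have s: "0 < s" "s < 1" "s\<^sup>2 = 1 / r" using r by (auto simp: s_def power_divide)
  define w where "w i = m / c * (1 / r) ^ d i" for i
  define \<kappa> where "\<kappa> j = m / c * s ^ d j * (1 / (1 - s))" for j
  have y_ratio: "m * y (Suc (i - d i)) / y (i + k) \<le> m / c * (1 / r) ^ (d i + k - 1)" if i: "2 \<le> i" for i k
  proof -
    have "c * r ^ (i + k - Suc (i - d i)) * y (Suc (i - d i)) \<le> y (i + k)"
      using db[OF i] by (intro grow) auto
    moreover have "i + k - Suc (i - d i) = d i + k - 1" using db[OF i] by simp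
    ultimately have "y (Suc (i - d i)) \<le> y (i + k) / (c * r ^ (d i + k - 1))"
      using c r by (simp add: field_simps)
    then have "m * y (Suc (i - d i)) / y (i + k) \<le> m * (y (i + k) / (c * r ^ (d i + k - 1))) / y (i + k)"
      using m y_pos[of "i + k"] by (intro divide_right_mono mult_left_mono) auto
    also have "\<dots> = m / c * (1 / r) ^ (d i + k - 1)"
      using y_pos[of "i + k"] by (simp add: power_one_over)
    finally show ?thesis .
  qed
  have d_lim: "(\<lambda>i. q ^ d i) \<longlonglongrightarrow> 0" if "0 \<le> q" "q < 1" for q :: real
    using filterlim_compose[OF LIMSEQ_realpow_zero[OF that] lim] by simp
  have "window_recursion (\<lambda>i. i - d i) m y 2 w \<kappa> (1 / 2) (1 + m)"
  proof
    show "0 < m" by fact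
    show "y i = m * (\<Sum>j\<in>{i - d i<..<i}. y j)" if "2 \<le> i" for i by (rule y_rec[OF that])
    show "Suc (i - d i) < i" if "2 \<le> i" for i using db[OF that] by auto
    show "Suc i - d (Suc i) = i - d i \<or> Suc i - d (Suc i) = Suc (i - d i)" if "2 \<le> i" for i
      using discipline_step[OF disc that] db[OF that] by auto
    show "m * y (Suc (i - d i)) / y (Suc i) \<le> w i" if "2 \<le> i" for i
      using y_ratio[OF that, of 1] by (simp add: w_def)
    show "0 \<le> w i" for i using m c r by (simp add: w_def)
    show "(\<Sum>i\<in>{i \<in> {2..n}. i - d i < j \<and> j < i}. w i) \<le> \<kappa> j" if "1 \<le> j" for j n
    proof -
      let ?I = "{i \<in> {2..n}. i - d i < j \<and> j < i}"
      have "(\<Sum>i\<in>?I. w i) \<le> (\<Sum>i\<in>?I. m / c * s ^ d j * s ^ (i - j))"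
      proof (rule sum_mono)
        fix i assume i: "i \<in> ?I"
        have "(1 / r) ^ d i = s ^ (d i + d i)" by (simp add: s(3)[symmetric] power_mult[symmetric] mult_2)
        also have "\<dots> \<le> s ^ (d j + (i - j))"
          using s i discipline_mono[OF disc that, of i] by (intro power_decreasing) auto
        also have "\<dots> = s ^ d j * s ^ (i - j)" by (simp add: power_add)
        finally show "w i \<le> m / c * s ^ d j * s ^ (i - j)"
          unfolding w_def using m c by (simp add: mult.assoc divide_right_mono mult_left_mono)
      qed
      also have "\<dots> = m / c * s ^ d j * (\<Sum>i\<in>?I. s ^ (i - j))" by (simp add: sum_distrib_left)
      also have "\<dots> \<le> m / c * s ^ d j * (1 / (1 - s))"
      proof (rule mult_left_mono)
        have "(\<Sum>i\<in>?I. s ^ (i - j)) = (\<Sum>k\<in>(\<lambda>i. i - j) ` ?I. s ^ k)"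
          by (subst sum.reindex) (auto simp: inj_on_def)
        also have "\<dots> \<le> (\<Sum>k. s ^ k)"
          using s by (intro sum_le_suminf summable_geometric) auto
        also have "\<dots> = 1 / (1 - s)" using s by (intro suminf_geometric) auto
        finally show "(\<Sum>i\<in>?I. s ^ (i - j)) \<le> 1 / (1 - s)" .
      qed (use m c s in simp)
      finally show ?thesis unfolding \<kappa>_def .
    qed
    have "\<kappa> \<longlonglongrightarrow> m / c * 0 * (1 / (1 - s))"
      unfolding \<kappa>_def using s by (intro tendsto_intros d_lim) auto
    then have "eventually (\<lambda>j. \<kappa> j < 1 / 2) sequentially" by (intro order_tendstoD(2)) auto
    then show "eventually (\<lambda>j. \<kappa> j \<le> 1 / 2) sequentially" by eventually_elim simp
    have "(\<lambda>i. y (Suc i) / y i - (1 + m)) \<longlonglongrightarrow> 0"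
    proof (rule Lim_null_comparison)
      show "eventually (\<lambda>i. norm (y (Suc i) / y i - (1 + m)) \<le> m * r / c * (1 / r) ^ d i) sequentially"
        using eventually_ge_at_top[of 2]
      proof eventually_elim
        case (elim i)
        have bi: "2 \<le> d i" "d i \<le> i" using db[OF elim] by auto
        \<comment> \<open>The window moves exactly if \<open>d (Suc i) = d i\<close>; if
          \<open>d\<close> increases, it only gains station \<open>i\<close>.\<close>
        have "y (Suc i) = (1 + m) * y i \<or> y (Suc i) = (1 + m) * y i - m * y (Suc (i - d i))"
        proof (cases "d (Suc i) = d i")
          case True
          have "{Suc i - d (Suc i)<..<Suc i} = insert i {Suc (i - d i)<..<i}" "{i - d i<..<i} = insert (Suc (i - d i)) {Suc (i - d i)<..<i}"
            using bi True by auto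
          then show ?thesis using y_rec[of i] y_rec[of "Suc i"] elim by (simp add: algebra_simps)
        next
          case False
          then have "{Suc i - d (Suc i)<..<Suc i} = insert i {i - d i<..<i}"
            using discipline_step[OF disc elim] bi by auto
          then show ?thesis using y_rec[of i] y_rec[of "Suc i"] elim by (simp add: algebra_simps)
        qed
        then have "\<bar>y (Suc i) / y i - (1 + m)\<bar> \<le> m * y (Suc (i - d i)) / y i"
        proof
          assume "y (Suc i) = (1 + m) * y i"
          then show ?thesis using y_pos[of i] y_pos[of "Suc (i - d i)"] m by simp
        next
          assume eq: "y (Suc i) = (1 + m) * y i - m * y (Suc (i - d i))"
          have "y (Suc i) / y i - (1 + m) = - (m * y (Suc (i - d i)) / y i)"
            unfolding eq using y_pos[of i] by (simp add: field_simps)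
          then show ?thesis using y_pos[of i] y_pos[of "Suc (i - d i)"] m by simp
        qed
        also have "\<dots> \<le> m / c * (1 / r) ^ (d i - 1)" using y_ratio[OF elim, of 0] by simp
        also have "(1 / r) ^ (d i - 1) = r * (1 / r) ^ d i"
          using bi r by (cases "d i") (auto simp: field_simps)
        finally show ?case by (simp add: mult_ac)
      qed
      have "(\<lambda>i. m * r / c * (1 / r) ^ d i) \<longlonglongrightarrow> m * r / c * 0"
        using r by (intro tendsto_intros d_lim) auto
      then show "(\<lambda>i. m * r / c * (1 / r) ^ d i) \<longlonglongrightarrow> 0" by simp
    qed
    then show "(\<lambda>i. y (Suc i) / y i) \<longlonglongrightarrow> 1 + m" by (rule LIM_zero_cancel)
  qed (use m y_pos in auto)
  then show ?thesis unfolding y_def[abs_def] by blast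
qed

section \<open>Comparison of the increments with the mean recursion\<close>

context bus_line
begin

text \<open>Let \<open>V\<close> be the sum of the increments in the window of station
  \<open>n + 1\<close>. The noise is \<open>O((n + 1) * sqrt (\<tau> + V))\<close>, and
  \<open>V \<ge> inc n > s ^ n\<close> yields \<open>sqrt V \<le> V * q ^ n\<close>. So the relative
  error is \<open>O((n + 1) * q ^ n)\<close>, which is summable.\<close>

theorem supercritical_limit:
  assumes h: "1 < m * real h" "\<And>n. K0 \<le> n \<Longrightarrow> h < d n"
    and ref: "window_recursion (\<lambda>i. i - d i) m y N0 w \<kappa> \<theta> g"
  shows "AE \<omega> in M. \<exists>W>0. (\<lambda>n. D n \<omega> / mean_seq m d n) \<longlonglongrightarrow> W"
proof -
  interpret R: window_recursion "\<lambda>i. i - d i" m y N0 w \<kappa> \<theta> g by (rule ref)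
  obtain s where s: "1 < s" and growth: "AE \<omega> in M. eventually (\<lambda>n. s ^ n < inc n \<omega>) sequentially"
    using AE_exponential_growth[OF h] by blast
  obtain c where c: "0 < c" and noise: "AE \<omega> in M. eventually (\<lambda>n. \<bar>inc (Suc n) \<omega> - \<tau> - m * span n \<omega>\<bar>
      < c * real (Suc n) * sqrt (span n \<omega>)) sequentially"
    using AE_noise_bound by blast
  define q where "q = 1 / sqrt s"
  have q: "0 < q" "q < 1" "q\<^sup>2 = 1 / s" using s by (auto simp: q_def power_divide)
  \<comment> \<open>The first term absorbs the travel times through
    \<open>V * q ^ n \<ge> 1\<close>, the second one the noise. The division by \<open>q\<close>
    rewrites \<open>q ^ n\<close> as a power with exponent \<open>Suc n\<close>, the index of the
    station concerned.\<close>
  define B where "B = (\<tau> * (1 + m) + c * sqrt (\<tau> + 1)) / q"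
  have B: "0 < B" using tau m_pos c q by (simp add: B_def add_pos_pos)
  define \<delta> where "\<delta> i = B * (real (Suc i) * q ^ i)" for i
  have "summable (\<lambda>i. real (Suc i) * q ^ i)"
    using geometric_deriv_sums[of q] q by (auto simp: sums_iff)
  then have delta: "summable \<delta>" "\<And>i. 0 \<le> \<delta> i"
    using B q by (auto simp: \<delta>_def[abs_def] intro!: summable_mult)
  show ?thesis
    using growth noise
  proof eventually_elim
    case (elim \<omega>)
    from eventually_conj[OF elim] obtain N where N: "\<And>n. N \<le> n \<Longrightarrow> s ^ n < inc n \<omega> \<and>
        \<bar>inc (Suc n) \<omega> - \<tau> - m * span n \<omega>\<bar> < c * real (Suc n) * sqrt (span n \<omega>)"
      by (auto simp: eventually_sequentially)
    have rec: "\<bar>inc i \<omega> - m * (\<Sum>j\<in>{i - d i<..<i}. inc j \<omega>)\<bar> \<le> \<delta> i * (\<Sum>j\<in>{i - d i<..<i}. inc j \<omega>)"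
      if i: "Suc (Suc N) \<le> i" for i
    proof -
      obtain n where n: "i = Suc n" "N \<le> n" "1 \<le> n" using i by (cases i) auto
      let ?V = "\<Sum>j\<in>{i - d i<..<i}. inc j \<omega>"
      have "{i - d i<..<i} = {Suc n - d (Suc n)<..n}" using n by auto
      then have span: "span n \<omega> = \<tau> + ?V" by (simp add: span_eq)
      have "2 \<le> d i" using discipline_bounds[OF discipline, of i] n by simp
      then have "inc n \<omega> \<le> ?V" using n inc_nonneg by (intro member_le_sum) auto
      then have V: "s ^ n \<le> ?V" using N[OF n(2)] by simp
      moreover have "1 \<le> s ^ n" using s by simp
      ultimately have V1: "1 \<le> ?V" by linarith
      have Vq: "1 \<le> ?V * (q ^ n * q ^ n)"
      proof -
        have "s ^ n * (q ^ n * q ^ n) = (s * q\<^sup>2) ^ n" by (simp add: power_mult_distrib power2_eq_square)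
        then have "1 = s ^ n * (q ^ n * q ^ n)" using s q(3) by simp
        also have "\<dots> \<le> ?V * (q ^ n * q ^ n)" using V q by (intro mult_right_mono) auto
        finally show ?thesis .
      qed
      have sqrtV: "sqrt ?V \<le> ?V * q ^ n"
      proof (rule real_le_lsqrt)
        have "?V * 1 \<le> ?V * (?V * (q ^ n * q ^ n))" using V1 Vq by (intro mult_left_mono) auto
        then show "?V \<le> (?V * q ^ n)\<^sup>2" by (simp add: power2_eq_square mult_ac)
      qed (use V1 q in auto)
      have one: "1 \<le> ?V * q ^ n"
      proof -
        have "1 \<le> sqrt ?V" using V1 by simp
        also note sqrtV
        finally show ?thesis .
      qed
      have "sqrt (\<tau> + ?V) \<le> sqrt ((\<tau> + 1) * ?V)"
        using V1 tau mult_left_mono[OF V1, of \<tau>] by (simp add: algebra_simps)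
      also have "\<dots> = sqrt (\<tau> + 1) * sqrt ?V" by (rule real_sqrt_mult)
      also have "\<dots> \<le> sqrt (\<tau> + 1) * (?V * q ^ n)" using sqrtV tau by (intro mult_left_mono) auto
      finally have sq: "sqrt (\<tau> + ?V) \<le> sqrt (\<tau> + 1) * (?V * q ^ n)" .
      have "inc i \<omega> - m * ?V = (inc (Suc n) \<omega> - \<tau> - m * span n \<omega>) + \<tau> * (1 + m)"
        by (simp add: n span algebra_simps)
      then have "\<bar>inc i \<omega> - m * ?V\<bar> \<le> \<bar>inc (Suc n) \<omega> - \<tau> - m * span n \<omega>\<bar> + \<tau> * (1 + m)"
        using abs_triangle_ineq[of "inc (Suc n) \<omega> - \<tau> - m * span n \<omega>" "\<tau> * (1 + m)"] tau m_pos by simp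
      also have "\<dots> \<le> c * real (Suc n) * sqrt (span n \<omega>) + \<tau> * (1 + m)"
        using N[OF n(2)] by simp
      also have "\<dots> \<le> c * real (Suc n) * (sqrt (\<tau> + 1) * (?V * q ^ n)) + \<tau> * (1 + m) * (real (Suc n) * (?V * q ^ n))"
      proof (rule add_mono)
        show "c * real (Suc n) * sqrt (span n \<omega>) \<le> c * real (Suc n) * (sqrt (\<tau> + 1) * (?V * q ^ n))"
          unfolding span using sq c by (intro mult_left_mono) auto
        have "1 * 1 \<le> real (Suc n) * (?V * q ^ n)" using one by (intro mult_mono) auto
        then have "\<tau> * (1 + m) * 1 \<le> \<tau> * (1 + m) * (real (Suc n) * (?V * q ^ n))"
          using tau m_pos by (intro mult_left_mono) auto
        then show "\<tau> * (1 + m) \<le> \<tau> * (1 + m) * (real (Suc n) * (?V * q ^ n))" by simp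
      qed
      also have "\<dots> = (\<tau> * (1 + m) + c * sqrt (\<tau> + 1)) * (real (Suc n) * q ^ n) * ?V"
        by (simp add: algebra_simps)
      also have "(\<tau> * (1 + m) + c * sqrt (\<tau> + 1)) * (real (Suc n) * q ^ n) = B * (real (Suc n) * q ^ Suc n)"
        using q by (simp add: B_def)
      also have "B * (real (Suc n) * q ^ Suc n) * ?V \<le> \<delta> i * ?V"
        unfolding \<delta>_def n(1) using B q V1 by (intro mult_right_mono mult_left_mono) (auto simp: n(1))
      finally show ?thesis .
    qed
    obtain W where "0 < W" "(\<lambda>n. (\<Sum>j=1..n. inc j \<omega>) / mean_seq m d (Suc n - 1)) \<longlonglongrightarrow> W"
    proof (rule R.partial_sums_limit[where X = "\<lambda>j. inc j \<omega>" and Y = "\<lambda>i. mean_seq m d (i - 1)" and \<delta> = \<delta>])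
      show "0 < inc j \<omega>" if "1 \<le> j" for j using inc_ge[OF that, of \<omega>] tau by simp
      show "mean_seq m d (i - 1) = m * (\<Sum>j\<in>{i - d i<..<i}. mean_seq m d (j - 1))" if "2 \<le> i" for i
        by (rule mean_seq_window[OF discipline that])
    qed (use delta rec mean_seq_pos[OF m_pos] in auto)
    then show ?case by (auto simp: sum_inc_eq_D[simplified])
  qed
qed

end

section \<open>The two regimes of the theorem\<close>

theorem theorem5:
  fixes M :: "'a measure"
    and T :: "nat \<Rightarrow> nat \<Rightarrow> 'a \<Rightarrow> real"
    and \<alpha> \<tau> m :: real
    and ds :: "nat \<Rightarrow> nat"
    and d :: nat
    and H :: "nat \<Rightarrow> 'a \<Rightarrow> real"
  assumes "prob_space M"
    and "0 < \<alpha>" and "\<alpha> < 1" and "0 < \<tau>"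
    and "m = \<alpha> / (1 - \<alpha>)"
    and "independent_poisson_processes M \<alpha> T"
    and "queueing_discipline ds"
    and "H = (\<lambda>n \<omega>. departure \<tau> ds (\<lambda>i k. T i k \<omega>) n)"
    and "2 \<le> d"
  shows "((\<forall>n\<ge>1. ds n = min d n) \<and> rho m (d - 2) < 1 \<longrightarrow>
           (\<exists>c>\<tau>. (AE \<omega> in M. (\<lambda>n. H n \<omega> / (c * real n)) \<longlonglongrightarrow> 1) \<and>
              (\<exists>\<mu> \<sigma>. 0 < \<sigma> \<and>
                 weak_conv_m
                   (\<lambda>n. distr M borel (\<lambda>\<omega>. (H n \<omega> - real n * c) / sqrt (real n)))
                   (density lborel (normal_density \<mu> \<sigma>))))) \<and>
         (((\<forall>n\<ge>1. ds n = min d n) \<and> rho m (d - 2) > 1) \<or> filterlim ds at_top sequentially \<longrightarrow>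
           (\<exists>W \<in> borel_measurable M. (\<forall>\<omega>\<in>space M. 0 < W \<omega>) \<and>
              (AE \<omega> in M. (\<lambda>n. H n \<omega> / (mean_seq m ds n * W \<omega>)) \<longlonglongrightarrow> 1)))"
proof -
  interpret bus: bus_line M T \<alpha> \<tau> ds
    using assms(1-4,6,7) by (simp add: bus_line_def bus_line_axioms_def)
  have m: "bus.m = m" using assms(5) by (simp add: bus.m_def)
  have m_pos: "0 < m" using bus.m_pos by (simp add: m)
  obtain a where a: "d = Suc (Suc a)" using assms(9) by (metis Suc_1 Suc_le_D add_2_eq_Suc le_Suc_ex)
  have H_eq: "AE \<omega> in M. \<forall>n. H n \<omega> = bus.D n \<omega>"
    using bus.AE_departure_eq by (simp add: assms(8))
  have H_meas [measurable]: "H n \<in> borel_measurable M" for n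
    unfolding assms(8) by (intro departure_measurable bus.T_measurable)
  show ?thesis
  proof (intro conjI impI)
    assume i: "(\<forall>n\<ge>1. ds n = min d n) \<and> rho m (d - 2) < 1"
    \<comment> \<open>A window of \<open>d\<close> stations back holds \<open>d - 1 = Suc a\<close>
      increments, which matches the index \<open>d - 2 = a\<close> of the polynomial.\<close>
    interpret W: fixed_window M T \<alpha> \<tau> ds "Suc a"
      by unfold_locales (use i rho_less_1_imp[OF m_pos, of a] in \<open>auto simp: a m\<close>)
    let ?c = "W.speed bus.m"
    have law: "AE \<omega> in M. (\<lambda>n. H n \<omega> / (?c * real n)) \<longlonglongrightarrow> 1"
      using W.strong_law H_eq by eventually_elim simp
    obtain \<sigma> where \<sigma>: "0 < \<sigma>"
      "weak_conv_m (\<lambda>n. distr M borel (\<lambda>\<omega>. (bus.D n \<omega> - real n * ?c) / sqrt (real n)))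
         (density lborel (normal_density 0 \<sigma>))"
      by (rule W.central_limit)
    have "distr M borel (\<lambda>\<omega>. (H n \<omega> - real n * ?c) / sqrt (real n))
        = distr M borel (\<lambda>\<omega>. (bus.D n \<omega> - real n * ?c) / sqrt (real n))" for n
    proof (rule distr_cong_AE)
      show "AE \<omega> in M. (H n \<omega> - real n * ?c) / sqrt (real n) = (bus.D n \<omega> - real n * ?c) / sqrt (real n)"
        using H_eq by eventually_elim simp
    qed simp_all
    then show "\<exists>c>\<tau>. (AE \<omega> in M. (\<lambda>n. H n \<omega> / (c * real n)) \<longlonglongrightarrow> 1) \<and>
        (\<exists>\<mu> \<sigma>. 0 < \<sigma> \<and> weak_conv_m (\<lambda>n. distr M borel (\<lambda>\<omega>. (H n \<omega> - real n * c) / sqrt (real n)))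
           (density lborel (normal_density \<mu> \<sigma>)))"
      using W.speed_gt law \<sigma> by (intro exI[of _ ?c] conjI exI[of _ 0] exI[of _ \<sigma>]) simp_all
  next
    assume ii: "((\<forall>n\<ge>1. ds n = min d n) \<and> rho m (d - 2) > 1) \<or> filterlim ds at_top sequentially"
    have "AE \<omega> in M. \<exists>W>0. (\<lambda>n. bus.D n \<omega> / mean_seq m ds n) \<longlonglongrightarrow> W"
      using ii
    proof
      assume *: "(\<forall>n\<ge>1. ds n = min d n) \<and> rho m (d - 2) > 1"
      then have rho: "1 < rho m a" and ds: "\<And>i. 1 \<le> i \<Longrightarrow> ds i = min (Suc (Suc a)) i"
        by (auto simp: a)
      show ?thesis
        unfolding m[symmetric]
        by (rule bus.supercritical_limit[OF _ _ geometric_window_recursion[OF bus.m_pos _ ds],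
              where h = "Suc a" and ?K0.0 = "Suc (Suc a)"])
           (use rho ds rho_gt_1_imp(1)[OF m_pos rho] in \<open>auto simp: m\<close>)
    next
      assume lim: "filterlim ds at_top sequentially"
      obtain h where "1 < real h * m" using reals_Archimedean3[OF m_pos] by blast
      then have h: "1 < m * real h" by (simp add: mult.commute)
      have "eventually (\<lambda>i. Suc h \<le> ds i) sequentially" using lim by (simp add: filterlim_at_top)
      then obtain K0 where K0: "\<And>n. K0 \<le> n \<Longrightarrow> h < ds n"
        unfolding eventually_sequentially Suc_le_eq by blast
      obtain w \<kappa> where "window_recursion (\<lambda>i. i - ds i) m (\<lambda>i. mean_seq m ds (i - 1)) 2 w \<kappa> (1 / 2) (1 + m)"
        using unbounded_window_recursion[OF m_pos assms(7) lim] by blast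
      then show ?thesis
        using bus.supercritical_limit[of h K0] h K0 unfolding m by blast
    qed
    then have conv: "AE \<omega> in M. \<exists>W>0. (\<lambda>n. H n \<omega> / mean_seq m ds n) \<longlonglongrightarrow> W"
      using H_eq by eventually_elim simp
    \<comment> \<open>\<open>lim\<close> gives a measurable choice of the limit; outside the event
      of convergence to a positive value, a null set, \<open>W\<close> may fall back to 1 and so is
      positive everywhere.\<close>
    define L where "L \<omega> = lim (\<lambda>n. H n \<omega> / mean_seq m ds n)" for \<omega>
    define W where "W \<omega> = (if 0 < L \<omega> then L \<omega> else 1)" for \<omega>
    have [measurable]: "L \<in> borel_measurable M" unfolding L_def[abs_def] by measurable
    show "\<exists>W \<in> borel_measurable M. (\<forall>\<omega>\<in>space M. 0 < W \<omega>) \<and>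
        (AE \<omega> in M. (\<lambda>n. H n \<omega> / (mean_seq m ds n * W \<omega>)) \<longlonglongrightarrow> 1)"
    proof (intro bexI conjI ballI)
      show "W \<in> borel_measurable M" unfolding W_def[abs_def] by measurable
      show "0 < W \<omega>" for \<omega> by (simp add: W_def)
      show "AE \<omega> in M. (\<lambda>n. H n \<omega> / (mean_seq m ds n * W \<omega>)) \<longlonglongrightarrow> 1"
        using conv
      proof eventually_elim
        case (elim \<omega>)
        then obtain V where V: "0 < V" "(\<lambda>n. H n \<omega> / mean_seq m ds n) \<longlonglongrightarrow> V" by blast
        then have "W \<omega> = V" by (simp add: W_def L_def limI)
        then show ?case using tendsto_divide[OF V(2) tendsto_const[of V]] V(1) by simp
      qed
    qed
  qed
qed

end
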